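(* Assume that the collision kernel has separated form with exponent $\beta\in(1-D,0]$. Let $\mathcal M$ be a global Maxwellian, and let $F_1$ and $F_2$ be two mild solutions of the Boltzmann equation on $\mathbb R^D\times\mathbb R^D\times\mathbb R$ satisfying the bound $$|F_j(v,x,t)|\le\mathcal M(v,x,t)\quad\text{for a.e. }(v,x,t)\in\mathbb R^D\times\mathbb R^D\times\mathbb R\text{ and }j=1,2.$$ Then $$\|F_1-F_2\|_{\mathcal M}\le|F_1(0)-F_2(0)|_{\mathcal M(0)}\,e^{4\mu(\mathcal M)}.$$
   Context: Collision kernel and collision integral. $D\ge1$ is an integer. A collision kernel of separated form with exponent $\beta$ is $\mathsf b(z,\omega)=|z|^\beta\hat{\mathsf b}(\omega\cdot z/|z|)$, $z\in\mathbb R^D$, $\omega\in\mathbb S^{D-1}$, where $\hat{\mathsf b}\ge0$ is measurable and $\bar{\mathsf b}:=\int_{\mathbb S^{D-1}}\hat{\mathsf b}(\omega\cdot n)\,d\omega<\infty$ ($n$ any unit vector). With $v'=v-((v-v_* )\cdot\omega)\omega$ and $v_*'=v_*+((v-v_* )\cdot\omega)\omega$, the collision integral is $$\mathcal B(F,F)(v,x,t)=\iint_{\mathbb S^{D-1}\times\mathbb R^D}\big(F(v',x,t)F(v'_*,x,t)-F(v,x,t)F(v_*,x,t)\big)\mathsf b(v-v_*,\omega)\,d\omega\,dv_*,$$ and $\mathcal A(F)(v,x,t):=\bar{\mathsf b}\int_{\mathbb R^D}F(v_*,x,t)|v-v_*|^\beta\,dv_*$. The Boltzmann equation is $\partial_tF+v\cdot\nabla_xF=\mathcal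 B(F,F)$. Functions $F$ are real valued. Global Maxwellians (of finite mass) are the functions $$\mathcal M(v,x,t)=\frac{m}{(2\pi)^D}\sqrt{\det Q}\;e^{-q(v-v_0,x-x_0,t)},\qquad q(v,x,t)=\tfrac12\big(c|v|^2+a|x-tv|^2+2b(x-tv)\cdot v\big)-v\cdot B(x-tv),$$ with $m,a,c>0$, $b\in\mathbb R$, $x_0,v_0\in\mathbb R^D$, $B$ a real skew-symmetric $D\times D$ matrix such that $Q:=(ac-b^2)I+B^2$ is positive definite. They satisfy $\partial_t\mathcal M+v\cdot\nabla_x\mathcal M=0$ and $\mathcal B(\mathcal M,\mathcal M)=0$. $\mathcal M(t)$ denotes $(v,x)\mapsto\mathcal M(v,x,t)$. The constant $\mu$: for $\beta\in(1-D,0]$, $\mu(\mathcal M):=\int_{\mathbb R}\|\mathcal A(\mathcal M)(t)\|_{L^\infty(\mathbb R^D\times\mathbb R^D)}\,dt$, which is finite. Norms: $\|F\|_{\mathcal M}:=\|F/\mathcal M\|_{L^\infty(\mathbb R^D\times\mathbb R^D\times\mathbb R)}$ and $|f|_{\mathcal M(0)}:=\|f/\mathcal M(0)\|_{L^\infty(\mathbb R^D\times\mathbb R^D)}$. Mild solutions: $e^{t\mathsf A}$ is defined by $(e^{t\mathsf A}\phi)(v,x)=\phi(v,x+tv)$. A mild solution on $\mathbb R^D\times\mathbb R^D\times I$ ($I\subset\mathbb R$ an interval) is $F\in L^1_{loc}(\mathbb R^D\times\mathbb R^D\times I)$ with $\mathcal B(F,F)\in L^1_{loc}(\mathbb R^D\times\mathbb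 R^D\times I)$ and $$e^{t_2\mathsf A}F(v,x,t_2)=e^{t_1\mathsf A}F(v,x,t_1)+\int_{t_1}^{t_2}e^{s\mathsf A}\mathcal B(F,F)(v,x,s)\,ds$$ for a.e. $(v,x)\in\mathbb R^D\times\mathbb R^D$ and all $t_1,t_2\in I$. $F$ is identified with its representative in $C(I;L^1_{loc}(\mathbb R^D\times\mathbb R^D))$, and $F(t)$ denotes $(v,x)\mapsto F(v,x,t)$. *)

theory Defs
  imports "HOL-Analysis.Analysis" "HOL-Probability.Essential_Supremum"
begin

text \<open>Conventions. Velocity and position space are \<open>real ^ 'n\<close>, so that \<open>D = CARD('n)\<close>, and phase-space
  functions take their arguments in the order \<open>v x t\<close>. Null sets and measurability on Euclidean
  spaces refer to the completed measure \<open>lebesgue\<close>.\<close>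

section \<open>The surface measure of the unit sphere\<close>

text \<open>\<open>\<sigma>(A) = D \<cdot> Leb {r \<omega> | \<omega> \<in> A, 0 < r < 1}\<close>, which is the unnormalised surface measure in the polar
  decomposition \<open>dz = r\<^bsup>D-1\<^esup> dr d\<omega>\<close>; it is counting measure on the two unit vectors if \<open>D = 1\<close>.\<close>

definition sphere_measure :: "'a::euclidean_space measure" where
  "sphere_measure =
     scale_measure (of_nat DIM('a))
       (distr (restrict_space lborel (ball 0 1 - {0})) (restrict_space borel (sphere 0 1))
          (\<lambda>x. x /\<^sub>R norm x))"

lemma normalize_measurable_sphere:
  "(\<lambda>x::'a::euclidean_space. x /\<^sub>R norm x)
     \<in> restrict_space lborel (ball 0 1 - {0}) \<rightarrow>\<^sub>M restrict_space borel (sphere 0 1)"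
  by (intro measurable_restrict_space2 measurable_restrict_space1)
     (auto simp: space_restrict_space)

lemma space_sphere_measure: "space (sphere_measure :: 'a::euclidean_space measure) = sphere 0 1"
  by (simp add: sphere_measure_def space_scale_measure space_restrict_space)

lemma sets_sphere_measure:
  "sets (sphere_measure :: 'a::euclidean_space measure) = sets (restrict_space borel (sphere 0 1))"
  by (simp add: sphere_measure_def)

lemma emeasure_sphere_measure:
  fixes A :: "'a::euclidean_space set"
  assumes "A \<in> sets (restrict_space borel (sphere 0 1))"
  shows "emeasure sphere_measure A
           = of_nat DIM('a) * emeasure lborel {x \<in> ball 0 1 - {0}. x /\<^sub>R norm x \<in> A}"
proof -
  let ?R = "restrict_space (lborel :: 'a measure) (ball 0 1 - {0})"
  have eq: "(\<lambda>x. x /\<^sub>R norm x) -` A \<inter> space ?R = {x \<in> ball 0 1 - {0}. x /\<^sub>R norm x \<in> A}"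
    by (auto simp: space_restrict_space)
  have "emeasure (distr ?R (restrict_space borel (sphere 0 1)) (\<lambda>x. x /\<^sub>R norm x)) A
          = emeasure ?R {x \<in> ball 0 1 - {0}. x /\<^sub>R norm x \<in> A}"
    unfolding emeasure_distr[OF normalize_measurable_sphere assms] eq ..
  also have "\<dots> = emeasure lborel {x \<in> ball 0 1 - {0}. x /\<^sub>R norm x \<in> A}"
    by (rule emeasure_restrict_space) auto
  finally show ?thesis
    by (simp add: sphere_measure_def)
qed


section \<open>Collision kernel and collision integral\<close>

text \<open>The formula is only meaningful, and only required, for \<open>z \<noteq> 0\<close>. Finiteness of the angular integral is expressed
  by integrability, \<open>bhat\<close> being nonnegative on \<open>[-1, 1]\<close>.\<close>

definition separated_form ::
    "real \<Rightarrow> (real \<Rightarrow> real) \<Rightarrow> (real^'n \<Rightarrow> real^'n \<Rightarrow> real) \<Rightarrow> bool" where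
  "separated_form \<beta> bhat b \<longleftrightarrow>
     bhat \<in> borel_measurable (lebesgue_on {-1..1}) \<and>
     (\<forall>s\<in>{-1..1}. 0 \<le> bhat s) \<and>
     (\<forall>n::real^'n. norm n = 1 \<longrightarrow> integrable (completion sphere_measure) (\<lambda>\<omega>. bhat (\<omega> \<bullet> n))) \<and>
     (\<forall>z \<omega>. z \<noteq> 0 \<longrightarrow> norm \<omega> = 1 \<longrightarrow> b z \<omega> = norm z powr \<beta> * bhat (\<omega> \<bullet> (z /\<^sub>R norm z)))"

definition angular_mass :: "(real \<Rightarrow> real) \<Rightarrow> real^'n \<Rightarrow> real" where
  "angular_mass bhat n = (\<integral>\<omega>. bhat (\<omega> \<bullet> n) \<partial>completion sphere_measure)"

definition collide :: "real^'n \<Rightarrow> real^'n \<Rightarrow> real^'n \<Rightarrow> real^'n" where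
  "collide v w \<omega> = v - ((v - w) \<bullet> \<omega>) *\<^sub>R \<omega>"

definition collide_star :: "real^'n \<Rightarrow> real^'n \<Rightarrow> real^'n \<Rightarrow> real^'n" where
  "collide_star v w \<omega> = w + ((v - w) \<bullet> \<omega>) *\<^sub>R \<omega>"

definition collision_integrand ::
    "(real^'n \<Rightarrow> real^'n \<Rightarrow> real) \<Rightarrow> (real^'n \<Rightarrow> real^'n \<Rightarrow> real \<Rightarrow> real)
      \<Rightarrow> real^'n \<Rightarrow> real^'n \<Rightarrow> real \<Rightarrow> (real^'n) \<times> (real^'n) \<Rightarrow> real" where
  "collision_integrand b F v x t = (\<lambda>(\<omega>, w).
     (F (collide v w \<omega>) x t * F (collide_star v w \<omega>) x t - F v x t * F w x t) * b (v - w) \<omega>)"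

text \<open>The product measure is completed because \<open>F\<close> and \<open>b\<close> are only Lebesgue measurable.\<close>

definition collision_integral ::
    "(real^'n \<Rightarrow> real^'n \<Rightarrow> real) \<Rightarrow> (real^'n \<Rightarrow> real^'n \<Rightarrow> real \<Rightarrow> real)
      \<Rightarrow> real^'n \<Rightarrow> real^'n \<Rightarrow> real \<Rightarrow> real" where
  "collision_integral b F v x t =
     (\<integral>p. collision_integrand b F v x t p \<partial>completion (sphere_measure \<Otimes>\<^sub>M lborel))"

text \<open>By rotation invariance \<open>angular_mass bhat n\<close> is the same for every unit vector \<open>n\<close>, so an
  arbitrary one is chosen.\<close>

definition attenuation ::
    "real \<Rightarrow> (real \<Rightarrow> real) \<Rightarrow> (real^'n \<Rightarrow> real^'n \<Rightarrow> real \<Rightarrow> real)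
      \<Rightarrow> real^'n \<Rightarrow> real^'n \<Rightarrow> real \<Rightarrow> real" where
  "attenuation \<beta> bhat F v x t =
     angular_mass bhat (SOME n::real^'n. norm n = 1)
       * (\<integral>w. F w x t * norm (v - w) powr \<beta> \<partial>lebesgue)"


section \<open>Global Maxwellians\<close>

definition maxwellian_form ::
    "real \<Rightarrow> real \<Rightarrow> real \<Rightarrow> real^'n^'n \<Rightarrow> real^'n \<Rightarrow> real^'n \<Rightarrow> real \<Rightarrow> real" where
  "maxwellian_form a b c B v x t =
     (c * (norm v)\<^sup>2 + a * (norm (x - t *\<^sub>R v))\<^sup>2 + 2 * b * ((x - t *\<^sub>R v) \<bullet> v)) / 2
       - v \<bullet> (B *v (x - t *\<^sub>R v))"

definition maxwellian_matrix :: "real \<Rightarrow> real \<Rightarrow> real \<Rightarrow> real^'n^'n \<Rightarrow> real^'n^'n" where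
  "maxwellian_matrix a b c B = (a * c - b\<^sup>2) *\<^sub>R mat 1 + B ** B"

definition global_maxwellian :: "(real^'n \<Rightarrow> real^'n \<Rightarrow> real \<Rightarrow> real) \<Rightarrow> bool" where
  "global_maxwellian M \<longleftrightarrow>
     (\<exists>m a b c (x0::real^'n) v0 B.
        0 < m \<and> 0 < a \<and> 0 < c \<and> transpose B = - B \<and>
        (\<forall>y. y \<noteq> 0 \<longrightarrow> 0 < y \<bullet> (maxwellian_matrix a b c B *v y)) \<and>
        (\<forall>v x t. M v x t = m / (2 * pi) ^ CARD('n) * sqrt (det (maxwellian_matrix a b c B))
                             * exp (- maxwellian_form a b c B (v - v0) (x - x0) t)))"


section \<open>Norms\<close>

definition Linf_norm :: "('a::euclidean_space \<Rightarrow> real) \<Rightarrow> ereal" where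
  "Linf_norm f = esssup lebesgue (\<lambda>z. ereal \<bar>f z\<bar>)"

definition maxwellian_norm ::
    "(real^'n \<Rightarrow> real^'n \<Rightarrow> real \<Rightarrow> real) \<Rightarrow> (real^'n \<Rightarrow> real^'n \<Rightarrow> real \<Rightarrow> real) \<Rightarrow> ereal" where
  "maxwellian_norm M F = Linf_norm (\<lambda>(v, x, t). F v x t / M v x t)"

definition initial_norm ::
    "(real^'n \<Rightarrow> real^'n \<Rightarrow> real \<Rightarrow> real) \<Rightarrow> (real^'n \<Rightarrow> real^'n \<Rightarrow> real) \<Rightarrow> ereal" where
  "initial_norm M f = Linf_norm (\<lambda>(v, x). f v x / M v x 0)"

text \<open>The integral is finite for a global Maxwellian and \<open>\<beta> \<in> (1 - D, 0]\<close>, so that \<open>enn2real\<close>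
  does not lose information there.\<close>

definition mu :: "real \<Rightarrow> (real \<Rightarrow> real) \<Rightarrow> (real^'n \<Rightarrow> real^'n \<Rightarrow> real \<Rightarrow> real) \<Rightarrow> real" where
  "mu \<beta> bhat M =
     enn2real (\<integral>\<^sup>+t. e2ennreal (Linf_norm (\<lambda>(v, x). attenuation \<beta> bhat M v x t)) \<partial>lebesgue)"


section \<open>Mild solutions\<close>

definition L1_loc :: "'a::euclidean_space set \<Rightarrow> ('a \<Rightarrow> real) \<Rightarrow> bool" where
  "L1_loc S f \<longleftrightarrow> (\<forall>K. compact K \<longrightarrow> K \<subseteq> S \<longrightarrow> set_integrable lebesgue K f)"

definition continuous_L1_loc :: "real set \<Rightarrow> (real^'n \<Rightarrow> real^'n \<Rightarrow> real \<Rightarrow> real) \<Rightarrow> bool" where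
  "continuous_L1_loc I F \<longleftrightarrow>
     (\<forall>t\<in>I. L1_loc UNIV (\<lambda>(v, x). F v x t)) \<and>
     (\<forall>K. compact K \<longrightarrow>
        (\<forall>t\<in>I. ((\<lambda>s. LINT (v, x):K|lebesgue. \<bar>F v x s - F v x t\<bar>) \<longlongrightarrow> 0) (at t within I)))"

definition free_transport :: "real \<Rightarrow> (real^'n \<Rightarrow> real^'n \<Rightarrow> real) \<Rightarrow> real^'n \<Rightarrow> real^'n \<Rightarrow> real" where
  "free_transport t \<phi> v x = \<phi> v (x + t *\<^sub>R v)"

text \<open>\<open>F\<close> itself is the representative in \<open>C(I; L\<^sup>1\<^sub>l\<^sub>o\<^sub>c)\<close>. Since the Bochner integral of a
  non-integrable function is \<open>0\<close>, the existence of the collision integral almost everywhere,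
  which is implicit in \<open>\<B>(F,F) \<in> L\<^sup>1\<^sub>l\<^sub>o\<^sub>c\<close>, is spelled out. The time integral is oriented, and
  its integrand is integrable for almost every \<open>(v, x)\<close> because \<open>\<B>(F,F) \<in> L\<^sup>1\<^sub>l\<^sub>o\<^sub>c\<close>.\<close>

definition mild_solution ::
    "(real^'n \<Rightarrow> real^'n \<Rightarrow> real) \<Rightarrow> real set \<Rightarrow> (real^'n \<Rightarrow> real^'n \<Rightarrow> real \<Rightarrow> real) \<Rightarrow> bool" where
  "mild_solution b I F \<longleftrightarrow>
     is_interval I \<and>
     L1_loc (UNIV \<times> UNIV \<times> I) (\<lambda>(v, x, t). F v x t) \<and>
     continuous_L1_loc I F \<and>
     (AE (v, x, t) in lebesgue. t \<in> I \<longrightarrow>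
        integrable (completion (sphere_measure \<Otimes>\<^sub>M lborel)) (collision_integrand b F v x t)) \<and>
     L1_loc (UNIV \<times> UNIV \<times> I) (\<lambda>(v, x, t). collision_integral b F v x t) \<and>
     (AE (v, x) in lebesgue. \<forall>t1\<in>I. \<forall>t2\<in>I.
        free_transport t2 (\<lambda>v x. F v x t2) v x
          = free_transport t1 (\<lambda>v x. F v x t1) v x
            + (LINT s=t1..t2|lebesgue. free_transport s (\<lambda>v x. collision_integral b F v x s) v x))"

end

theory Submission
  imports Defs "HOL-Probability.Distributions"
begin

text \<open>If \<open>\<bar>F\<^sub>1\<bar>, \<bar>F\<^sub>2\<bar> \<le> M\<close> and \<open>\<bar>F\<^sub>1 - F\<^sub>2\<bar> \<le> g(t) M\<close>, then the identity \<open>M(v') M(v'\<^sub>*) = M(v) M(v\<^sub>*)\<close> gives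
  \<open>\<bar>\<B>(F\<^sub>1,F\<^sub>1) - \<B>(F\<^sub>2,F\<^sub>2)\<bar> \<le> 4 g(t) \<parallel>\<A>(M)(t)\<parallel>\<^sub>\<infinity> M\<close> almost everywhere. When \<open>M\<close> is constant along
  characteristics, the mild formulation turns a bound \<open>g\<close> into the bound
  \<open>\<bar>F\<^sub>1 - F\<^sub>2\<bar>(0) / M(0) + \<integral> 4 g \<parallel>\<A>(M)\<parallel>\<^sub>\<infinity>\<close>, and the iterates, started from \<open>g = 2\<close>, converge to the
  exponential. No regularity of the optimal \<open>g\<close> is needed.

  With the parametrisation of \<open>global_maxwellian\<close>, \<open>M\<close> is constant along characteristics only if
  \<open>v\<^sub>0 = 0\<close>. Otherwise \<open>M(v, x + t v, t) \<rightarrow> 0\<close> as \<open>t \<rightarrow> -\<infinity>\<close>, so \<open>\<bar>F(v, x + t v, t)\<bar>\<close> is at most the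
  integral of \<open>\<bar>\<B>(F,F)\<bar>\<close> along the past characteristic. Integrating over \<open>(v, x)\<close>, where the gain term
  has the same mass as the loss term, shows that the \<open>L\<^sup>1\<close> norm \<open>n\<close> of \<open>F(t)\<close> is bounded and satisfies
  \<open>n(t) \<le> 2 \<integral>\<^sub>s\<^sub><\<^sub>t \<parallel>\<A>(M)(s)\<parallel>\<^sub>\<infinity> n(s) ds\<close>; hence \<open>F = 0\<close> and there is nothing to compare.\<close>

section \<open>Null sets and iterated integrals in time\<close>

text \<open>The constant 4 is 2 times 2: a difference of two products produces one difference per
  factor, and gain and loss obey the same bound. All time integrals take values in
  \<open>ennreal\<close>, so that the iterates can be formed and reordered before anything is known
  to be finite. The case v0 \<noteq> 0 cannot use the Maxwellian weight, because M at an earlier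
  point of a characteristic is not uniformly controlled by M at the present point. The L1 norm is
  preserved by free transport, but equality of the gain and loss masses rests on Tonelli in (v, w,
  \<omega>), which needs a jointly measurable kernel, whereas \<open>bhat\<close> is only Lebesgue
  measurable. Hence the Borel version of \<open>bhat\<close>; it is harmless for D \<ge> 2, where
  null sets of cosines are null for the surface measure. The condition \<beta> > 1 - D is what makes
  the weight integrable in time: the velocity integral of M against |v - w|^\<beta> is at most a
  multiple of k(t)^(-(D + \<beta>)/2), where k is a positive quadratic polynomial in t.\<close>

lemma AE_lebesgue_compose:
  fixes h :: "'a::euclidean_space \<Rightarrow> 'b::euclidean_space" and k :: "'b \<Rightarrow> 'a"
  assumes P: "AE y in lebesgue. P y"
    and k: "k differentiable_on UNIV" "\<And>x. k (h x) = x"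
    and dim: "DIM('b) = DIM('a)"
  shows "AE x in lebesgue. P (h x)"
proof -
  have "{y. \<not> P y} \<in> null_sets lebesgue"
    using P by (simp add: completion.AE_iff_null_sets)
  \<comment> \<open>A differentiable map between spaces of equal dimension sends null sets to null
    sets. Only the left inverse has to be regular, since the exceptional set of the composition lies
    in its image.\<close>
  then have "negligible (k ` {y. \<not> P y})"
    using k dim by (intro negligible_differentiable_image_negligible)
      (auto simp: negligible_iff_null_sets intro: differentiable_on_subset)
  moreover have "{x. \<not> P (h x)} \<subseteq> k ` {y. \<not> P y}"
  proof
    fix x assume "x \<in> {x. \<not> P (h x)}"
    then show "x \<in> k ` {y. \<not> P y}" using k(2)[of x] by (intro image_eqI[of _ _ "h x"]) auto
  qed
  ultimately have "negligible {x. \<not> P (h x)}" by (rule negligible_subset)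
  then show ?thesis by (simp add: completion.AE_iff_null_sets negligible_iff_null_sets)
qed

text \<open>On a product space \<open>lebesgue\<close> is the completion of the product of the Borel
  versions, not the product of the completions; hence the detour through
  \<open>lborel\<close>.\<close>

lemma AE_lebesgue_prod:
  fixes P :: "'a::euclidean_space \<times> 'b::euclidean_space \<Rightarrow> bool"
  assumes "AE z in lebesgue. P z"
  shows "AE x in lebesgue. AE y in lebesgue. P (x, y)"
proof -
  have "AE z in lborel \<Otimes>\<^sub>M lborel. P z"
    using assms unfolding AE_completion_iff lborel_prod .
  from lborel_pair.AE_pair[OF this] show ?thesis by (simp add: AE_completion_iff)
qed

lemma AE_lebesgue_fst:
  fixes P :: "'a::euclidean_space \<Rightarrow> bool"
  assumes "AE x in lebesgue. P x"
  shows "AE z in lebesgue. P (fst (z :: 'a \<times> 'b::euclidean_space))"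
proof -
  obtain N where N: "N \<in> null_sets lborel" "{x. \<not> P x} \<subseteq> N"
    using assms[unfolded AE_completion_iff] unfolding eventually_ae_filter by auto
  then have "N \<times> (UNIV :: 'b set) \<in> null_sets (lborel \<Otimes>\<^sub>M lborel)"
    by (intro null_setsI, subst lborel.emeasure_pair_measure_Times) auto
  then show ?thesis
    unfolding AE_completion_iff lborel_prod[symmetric] using N(2)
    by (intro AE_I'[of "N \<times> UNIV"]) auto
qed

lemma AE_lebesgue_assoc:
  fixes P :: "'a::euclidean_space \<times> 'b::euclidean_space \<times> 'c::euclidean_space \<Rightarrow> bool"
  assumes "AE z in lebesgue. P z"
  shows "AE z in lebesgue. P (fst (fst z), snd (fst z), snd z)"
  by (rule AE_lebesgue_compose[where k = "\<lambda>(v, x, t). ((v, x), t)", OF assms])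
     (auto simp: split_beta intro!: derivative_intros linear_imp_differentiable_on linearI)

lemma AE_lebesgue_unassoc:
  fixes P :: "'a::euclidean_space \<times> 'b::euclidean_space \<times> 'c::euclidean_space \<Rightarrow> bool"
  assumes "AE z in lebesgue. P (fst (fst z), snd (fst z), snd z)"
  shows "AE z in lebesgue. P z"
proof -
  have "AE z in lebesgue. (\<lambda>z. P (fst (fst z), snd (fst z), snd z)) ((\<lambda>(v, x, t). ((v, x), t)) z)"
    by (rule AE_lebesgue_compose[where k = "\<lambda>z. (fst (fst z), snd (fst z), snd z)", OF assms])
       (auto simp: split_beta intro!: derivative_intros linear_imp_differentiable_on linearI)
  then show ?thesis by (simp add: split_beta)
qed

section \<open>Integrals over ordered times\<close>

definition span_integral :: "(real \<Rightarrow> real set) \<Rightarrow> (real \<Rightarrow> ennreal) \<Rightarrow> real \<Rightarrow> ennreal" where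
  "span_integral S a t = (\<integral>\<^sup>+s. a s * indicator (S t) s \<partial>lborel)"

text \<open>\<open>S t\<close> is the set of times between an initial time and \<open>t\<close>; \<open>r \<in> S t\<close> says that \<open>r\<close> comes before \<open>t\<close>.\<close>

locale time_order =
  fixes S :: "real \<Rightarrow> real set"
  assumes pred_S: "Measurable.pred borel (\<lambda>(s, t). s \<in> S t)"
    and S_mono: "r \<in> S t \<Longrightarrow> S r \<subseteq> S t"
    and S_total: "AE s in lborel. s \<in> S t \<and> r \<in> S s \<longleftrightarrow> r \<in> S t \<and> s \<in> S t \<and> s \<notin> S r"
begin

lemma pred_S'[measurable (raw)]:
  assumes [measurable]: "f \<in> borel_measurable M" "g \<in> borel_measurable M"
  shows "Measurable.pred M (\<lambda>x. f x \<in> S (g x))"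
  using measurable_compose[OF borel_measurable_Pair[OF assms] pred_S] by simp

lemma measurable_S[measurable]: "S t \<in> sets borel"
proof -
  have "Measurable.pred borel (\<lambda>s. s \<in> S t)" by measurable
  then show ?thesis by (simp add: pred_def)
qed

lemma borel_measurable_indicator_S[measurable (raw)]:
  assumes [measurable]: "f \<in> borel_measurable M" "g \<in> borel_measurable M"
  shows "(\<lambda>x. indicator (S (g x)) (f x) :: ennreal) \<in> borel_measurable M"
proof -
  have "(\<lambda>x. indicator (S (g x)) (f x) :: ennreal) = (\<lambda>x. if f x \<in> S (g x) then 1 else 0)"
    by (auto simp: indicator_def)
  then show ?thesis by simp
qed

lemma borel_measurable_span_integral[measurable]:
  assumes [measurable]: "a \<in> borel_measurable borel"
  shows "span_integral S a \<in> borel_measurable borel"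
  unfolding span_integral_def by measurable

lemma span_integral_add:
  assumes [measurable]: "a \<in> borel_measurable borel" "b \<in> borel_measurable borel"
  shows "span_integral S (\<lambda>s. a s + b s) t = span_integral S a t + span_integral S b t"
  unfolding span_integral_def distrib_right by (intro nn_integral_add) auto

lemma span_integral_cmult:
  assumes [measurable]: "a \<in> borel_measurable borel"
  shows "span_integral S (\<lambda>s. c * a s) t = c * span_integral S a t"
  unfolding span_integral_def mult.assoc by (intro nn_integral_cmult) auto

text \<open>This is d(A^(n+1)) = (n+1) A^n dA without differentiation, for a weight that is only
  measurable and an A that may be infinite. Exchanging the order in the integral over r before s
  before t replaces the inner integral by that of \<open>a\<close> over the times between r and t;
  together with \<open>A r\<close> it gives \<open>A t\<close>.\<close>

lemma span_integral_power:
  assumes a[measurable]: "a \<in> borel_measurable borel"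
  shows "of_nat (Suc n) * span_integral S (\<lambda>s. span_integral S a s ^ n * a s) t = span_integral S a t ^ Suc n"
proof (induction n arbitrary: t)
  case 0
  then show ?case by simp
next
  case (Suc n)
  let ?A = "span_integral S a"
  define I where "I = (\<lambda>m. span_integral S (\<lambda>s. ?A s ^ m * a s))"
  define J where "J = span_integral S (\<lambda>s. I n s * a s) t"
  have mI[measurable]: "I m \<in> borel_measurable borel" for m
    unfolding I_def by measurable
  have IH: "of_nat (Suc n) * I n s = ?A s ^ Suc n" for s
    using Suc.IH by (simp add: I_def)
  have I1: "I (Suc n) t = of_nat (Suc n) * J"
    unfolding J_def
    by (subst span_integral_cmult[symmetric], measurable)
       (simp only: I_def[of] IH[symmetric] mult.assoc)
  have "J = (\<integral>\<^sup>+s. (\<integral>\<^sup>+r. ?A r ^ n * a r * indicator (S s) r * (a s * indicator (S t) s) \<partial>lborel) \<partial>lborel)"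
    unfolding J_def I_def span_integral_def[of S "\<lambda>s. ?A s ^ n * a s"]
    by (subst span_integral_def, intro nn_integral_cong, subst nn_integral_multc) (auto simp: mult_ac)
  also have "\<dots> = (\<integral>\<^sup>+r. (\<integral>\<^sup>+s. ?A r ^ n * a r * indicator (S s) r * (a s * indicator (S t) s) \<partial>lborel) \<partial>lborel)"
    by (rule lborel_pair.Fubini') measurable
  also have "\<dots> = (\<integral>\<^sup>+r. (\<integral>\<^sup>+s. (?A r ^ n * a r * indicator (S t) r) * (a s * indicator (S t - S r) s) \<partial>lborel) \<partial>lborel)"
  \<comment> \<open>The two descriptions of r before s before t disagree only on a null set of s,
    for instance at s = r.\<close>
  proof (rule nn_integral_cong, rule nn_integral_cong_AE)
    fix r :: real
    show "AE s in lborel. ?A r ^ n * a r * indicator (S s) r * (a s * indicator (S t) s)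
        = ?A r ^ n * a r * indicator (S t) r * (a s * indicator (S t - S r) s)"
      using S_total[of t r] by eventually_elim (auto simp: indicator_def)
  qed
  also have "\<dots> = (\<integral>\<^sup>+r. (?A r ^ n * a r * indicator (S t) r) * (\<integral>\<^sup>+s. a s * indicator (S t - S r) s \<partial>lborel) \<partial>lborel)"
    by (intro nn_integral_cong nn_integral_cmult) measurable
  finally have J: "J = \<dots>" .
  have mD: "(\<lambda>r. \<integral>\<^sup>+s. a s * indicator (S t - S r) s \<partial>lborel) \<in> borel_measurable borel"
  proof -
    have "(\<lambda>(r, s). a s * indicator (S t - S r) s) = (\<lambda>(r, s). if s \<in> S t \<and> \<not> s \<in> S r then a s else 0)"
      by (auto simp: indicator_def)
    also have "\<dots> \<in> borel_measurable (borel \<Otimes>\<^sub>M lborel)" by measurable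
    finally show ?thesis
      by (intro lborel.borel_measurable_nn_integral) simp
  qed
  \<comment> \<open>Adding \<open>I (Suc n) t\<close> supplies the missing part over
    \<open>S r\<close>, so that nothing has to be subtracted in \<open>ennreal\<close>.\<close>
  have "J + I (Suc n) t = (\<integral>\<^sup>+r. (?A r ^ n * a r * indicator (S t) r) * (\<integral>\<^sup>+s. a s * indicator (S t - S r) s \<partial>lborel)
        + (?A r ^ n * a r * indicator (S t) r) * ?A r \<partial>lborel)"
  proof -
    have "I (Suc n) t = (\<integral>\<^sup>+r. (?A r ^ n * a r * indicator (S t) r) * ?A r \<partial>lborel)"
      unfolding I_def by (subst span_integral_def) (auto intro!: nn_integral_cong simp: mult_ac)
    then show ?thesis
      unfolding J using mD by (subst nn_integral_add) auto
  qed
  also have "\<dots> = (\<integral>\<^sup>+r. ?A t * (?A r ^ n * a r * indicator (S t) r) \<partial>lborel)"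
  proof (rule nn_integral_cong)
    fix r :: real
    have "(\<integral>\<^sup>+s. a s * indicator (S t - S r) s \<partial>lborel) + ?A r = ?A t" if "r \<in> S t"
      unfolding span_integral_def
      by (subst nn_integral_add[symmetric])
         (use S_mono[OF that] in \<open>auto intro!: nn_integral_cong simp: indicator_def\<close>)
    then show "(?A r ^ n * a r * indicator (S t) r) * (\<integral>\<^sup>+s. a s * indicator (S t - S r) s \<partial>lborel)
        + (?A r ^ n * a r * indicator (S t) r) * ?A r = ?A t * (?A r ^ n * a r * indicator (S t) r)"
      by (cases "r \<in> S t") (simp_all only: distrib_left[symmetric] mult.commute[of _ "?A t"], simp)
  qed
  also have "\<dots> = ?A t * I n t"
    by (subst nn_integral_cmult) (auto simp: I_def span_integral_def[of S "\<lambda>s. ?A s ^ n * a s"])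
  finally have "of_nat (Suc n) * (J + I (Suc n) t) = ?A t * (of_nat (Suc n) * I n t)"
    by (simp add: mult_ac)
  also have "\<dots> = ?A t ^ Suc (Suc n)"
    by (simp only: IH power_Suc)
  also have "of_nat (Suc n) * (J + I (Suc n) t) = of_nat (Suc (Suc n)) * I (Suc n) t"
    by (simp add: distrib_left distrib_right I1[symmetric] flip: I1) (simp add: I1 algebra_simps)
  finally show ?case by (simp add: I_def)
qed

text \<open>One Picard step raises the order of the truncated exponential by one and keeps the shape
  of the bound: \<phi> is the initial datum, and K is the crude constant from which the iteration
  starts. With \<phi> = 0 only the remainder is left.\<close>

lemma span_integral_exponential_iterate:
  fixes e :: "real \<Rightarrow> ennreal"
  assumes e[measurable]: "e \<in> borel_measurable borel"
  defines "A \<equiv> span_integral S e" and "c \<equiv> \<lambda>k. ennreal (inverse (fact k))"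
  shows "\<phi> + span_integral S (\<lambda>s. (\<phi> * (\<Sum>k<n. c k * A s ^ k) + K * (c n * A s ^ n)) * e s) t
    = \<phi> * (\<Sum>k<Suc n. c k * A t ^ k) + K * (c (Suc n) * A t ^ Suc n)"
proof -
  have [measurable]: "A \<in> borel_measurable borel" by (simp add: A_def)
  have c: "c k * span_integral S (\<lambda>s. A s ^ k * e s) t = c (Suc k) * A t ^ Suc k" for k
  proof -
    have "c k = c (Suc k) * of_nat (Suc k)"
      unfolding c_def by (simp add: ennreal_mult[symmetric] ennreal_of_nat_eq_real_of_nat fact_Suc del: of_nat_Suc)
    then show ?thesis
      using span_integral_power[OF e, of k t] by (simp add: A_def mult.assoc)
  qed
  have S: "span_integral S (\<lambda>s. (\<Sum>k<n. c k * A s ^ k) * e s) t = (\<Sum>k<n. c (Suc k) * A t ^ Suc k)" for n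
  proof (induction n)
    case 0
    then show ?case by (simp add: span_integral_def)
  next
    case (Suc n)
    have "span_integral S (\<lambda>s. (\<Sum>k<Suc n. c k * A s ^ k) * e s) t
        = span_integral S (\<lambda>s. (\<Sum>k<n. c k * A s ^ k) * e s + c n * (A s ^ n * e s)) t"
      by (simp add: distrib_right mult.assoc)
    also have "\<dots> = (\<Sum>k<n. c (Suc k) * A t ^ Suc k) + c n * span_integral S (\<lambda>s. A s ^ n * e s) t"
      by (simp add: span_integral_add span_integral_cmult Suc.IH)
    also have "\<dots> = (\<Sum>k<Suc n. c (Suc k) * A t ^ Suc k)"
      by (simp only: c sum.lessThan_Suc)
    finally show ?case .
  qed
  have "span_integral S (\<lambda>s. (\<phi> * (\<Sum>k<n. c k * A s ^ k) + K * (c n * A s ^ n)) * e s) t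
      = span_integral S (\<lambda>s. \<phi> * ((\<Sum>k<n. c k * A s ^ k) * e s) + (K * c n) * (A s ^ n * e s)) t"
    by (simp only: distrib_right mult.assoc)
  also have "\<dots> = \<phi> * (\<Sum>k<n. c (Suc k) * A t ^ Suc k) + K * (c n * span_integral S (\<lambda>s. A s ^ n * e s) t)"
    by (simp add: span_integral_add span_integral_cmult S mult.assoc)
  also have "\<dots> = \<phi> * (\<Sum>k<n. c (Suc k) * A t ^ Suc k) + K * (c (Suc n) * A t ^ Suc n)"
    by (simp only: c)
  finally show ?thesis
    by (simp add: sum.lessThan_Suc_shift distrib_left c_def add.assoc del: sum.lessThan_Suc)
qed

end

text \<open>Covers both signs of t: the estimate runs forward and backward from time 0, and on
  either side an earlier time is one closer to 0.\<close>

definition tspan :: "real \<Rightarrow> real set" where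
  "tspan t = {min 0 t<..<max 0 t}"

lemma tspan_iff: "s \<in> tspan t \<longleftrightarrow> min 0 t < s \<and> s < max 0 t"
  by (auto simp: tspan_def)

interpretation tspan: time_order tspan
proof
  show "Measurable.pred borel (\<lambda>(s, t). s \<in> tspan t)"
    unfolding tspan_iff split_beta borel_prod[symmetric] by measurable
  show "tspan r \<subseteq> tspan t" if "r \<in> tspan t" for r t
    using that by (auto simp: tspan_iff min_def max_def split: if_splits)
  show "AE s in lborel. s \<in> tspan t \<and> r \<in> tspan s \<longleftrightarrow> r \<in> tspan t \<and> s \<in> tspan t \<and> s \<notin> tspan r" for t r
    using AE_lborel_singleton[of r] AE_lborel_singleton[of 0]
    by eventually_elim (auto simp: tspan_iff min_def max_def)
qed

interpretation past: time_order lessThan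
proof
  show "Measurable.pred borel (\<lambda>(s :: real, t). s \<in> {..<t})"
    unfolding lessThan_iff split_beta borel_prod[symmetric] by measurable
  show "AE s in lborel. s \<in> {..<t} \<and> r \<in> {..<s} \<longleftrightarrow> r \<in> {..<t} \<and> s \<in> {..<t} \<and> s \<notin> {..<r}" for t r :: real
    using AE_lborel_singleton[of r] by eventually_elim auto
qed auto

section \<open>The surface measure and the angular mass\<close>

lemma finite_measure_sphere_measure: "finite_measure (sphere_measure :: 'a::euclidean_space measure)"
proof
  have "emeasure (sphere_measure :: 'a measure) (space sphere_measure)
      = of_nat DIM('a) * emeasure lborel {x :: 'a \<in> ball 0 1 - {0}. x /\<^sub>R norm x \<in> sphere 0 1}"
    by (subst emeasure_sphere_measure) (auto simp: space_sphere_measure sets_restrict_space)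
  also have "\<dots> \<le> of_nat DIM('a) * emeasure lborel (ball 0 1 :: 'a set)"
    by (intro mult_left_mono emeasure_mono) auto
  also have "\<dots> < \<infinity>"
    using emeasure_lborel_ball_finite[of "0::'a" 1] by (simp add: ennreal_mult_less_top of_nat_less_top)
  finally show "emeasure (sphere_measure :: 'a measure) (space sphere_measure) \<noteq> \<infinity>" by simp
qed

interpretation sphere_measure: finite_measure "sphere_measure :: 'a::euclidean_space measure"
  by (rule finite_measure_sphere_measure)

interpretation sphere_lborel: pair_sigma_finite "sphere_measure :: 'a::euclidean_space measure" "lborel :: 'b::euclidean_space measure" ..

lemma measurable_id_sphere_measure: "(\<lambda>x. x) \<in> sphere_measure \<rightarrow>\<^sub>M borel"
  by (simp add: measurable_cong_sets[OF sets_sphere_measure refl] measurable_restrict_space1)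

lemma nn_integral_lborel_translate:
  fixes f :: "'a::euclidean_space \<Rightarrow> ennreal"
  assumes [measurable]: "f \<in> borel_measurable borel"
  shows "(\<integral>\<^sup>+x. f (c + x) \<partial>lborel) = (\<integral>\<^sup>+x. f x \<partial>lborel)"
  by (subst (2) lborel_distr_plus[symmetric, of c]) (simp add: nn_integral_distr)

text \<open>Uniqueness of Haar measure: both sides times the volume of the unit ball, which is invariant
  under \<open>T\<close>, are evaluations of \<open>\<integral>\<integral> f (T x) 1\<^bsub>ball\<^esub> (y - T x) dx dy\<close>.\<close>

lemma nn_integral_lborel_orthogonal:
  fixes T :: "'a::euclidean_space \<Rightarrow> 'a" and f :: "'a \<Rightarrow> ennreal"
  assumes T: "orthogonal_transformation T" and f[measurable]: "f \<in> borel_measurable borel"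
  shows "(\<integral>\<^sup>+x. f (T x) \<partial>lborel) = (\<integral>\<^sup>+x. f x \<partial>lborel)"
proof -
  have lin: "linear T" using T by (rule orthogonal_transformation_linear)
  have Tb[measurable]: "T \<in> borel \<rightarrow>\<^sub>M borel"
    using lin by (simp add: borel_measurable_continuous_onI linear_continuous_on linear_conv_bounded_linear)
  have nT: "norm (T x) = norm x" for x using T by (simp add: orthogonal_transformation_norm)
  define g :: "'a \<Rightarrow> ennreal" where "g = indicator (ball 0 1)"
  have g[measurable]: "g \<in> borel_measurable borel" unfolding g_def by (intro borel_measurable_indicator) simp
  define V where "V = (\<integral>\<^sup>+x. g x \<partial>lborel)"
  have V: "V = emeasure lborel (ball 0 1 :: 'a set)" by (simp add: V_def g_def)
  have V0: "V \<noteq> 0" "V \<noteq> top"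
    using emeasure_lborel_ball_finite[of "0::'a" 1] content_ball_pos[of 1 "0::'a"]
    by (auto simp: V measure_def)
  have surj: "T (inv T y) = y" for y
    using orthogonal_transformation_surj[OF T] by (rule surj_f_inv_f)
  have "(\<integral>\<^sup>+x. f (T x) \<partial>lborel) * V = (\<integral>\<^sup>+x. \<integral>\<^sup>+y. f (T x) * g y \<partial>lborel \<partial>lborel)"
    unfolding V_def by (subst nn_integral_multc[symmetric], measurable) (simp add: nn_integral_cmult)
  also have "\<dots> = (\<integral>\<^sup>+x. \<integral>\<^sup>+y. f (T x) * g (- T x + y) \<partial>lborel \<partial>lborel)"
    by (intro nn_integral_cong nn_integral_lborel_translate[symmetric]) measurable
  also have "\<dots> = (\<integral>\<^sup>+y. \<integral>\<^sup>+x. f (T x) * g (- T x + y) \<partial>lborel \<partial>lborel)"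
    by (rule lborel_pair.Fubini'[symmetric]) measurable
  \<comment> \<open>The shift by \<open>inv T y\<close> turns \<open>T x\<close> into
    \<open>y + T x\<close>; the ball then depends on \<open>norm (T x) = norm x\<close> only, and T
    survives in the argument of f alone, where integration in y removes it.\<close>
  also have "\<dots> = (\<integral>\<^sup>+y. \<integral>\<^sup>+x. f (T (inv T y + x)) * g (- T (inv T y + x) + y) \<partial>lborel \<partial>lborel)"
    by (intro nn_integral_cong nn_integral_lborel_translate[symmetric]) measurable
  also have "\<dots> = (\<integral>\<^sup>+y. \<integral>\<^sup>+x. g x * f (T x + y) \<partial>lborel \<partial>lborel)"
    by (intro nn_integral_cong) (simp add: linear_add[OF lin] surj g_def indicator_def nT add.commute mult.commute)
  also have "\<dots> = (\<integral>\<^sup>+x. \<integral>\<^sup>+y. g x * f (T x + y) \<partial>lborel \<partial>lborel)"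
    by (rule lborel_pair.Fubini') measurable
  also have "\<dots> = (\<integral>\<^sup>+x. g x * (\<integral>\<^sup>+y. f y \<partial>lborel) \<partial>lborel)"
    by (simp add: nn_integral_cmult nn_integral_lborel_translate)
  also have "\<dots> = (\<integral>\<^sup>+y. f y \<partial>lborel) * V"
    unfolding V_def by (subst nn_integral_multc) (auto simp: mult.commute)
  finally show ?thesis using V0 by (simp add: ennreal_mult_cancel_left mult.commute[of _ V])
qed

lemma emeasure_lborel_orthogonal_vimage:
  fixes T :: "'a::euclidean_space \<Rightarrow> 'a"
  assumes T: "orthogonal_transformation T" and B: "B \<in> sets borel"
  shows "emeasure lborel (T -` B) = emeasure lborel B"
proof -
  have Tb: "T \<in> borel \<rightarrow>\<^sub>M borel"
    using orthogonal_transformation_linear[OF T]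
    by (simp add: borel_measurable_continuous_onI linear_continuous_on linear_conv_bounded_linear)
  then have "T -` B \<in> sets borel" using B measurable_sets[of T borel borel B] by simp
  then show ?thesis
    using nn_integral_lborel_orthogonal[OF T, of "indicator B"] B
    by (simp add: indicator_vimage[symmetric, unfolded comp_def])
qed

text \<open>The surface measure of A is D times the volume of the truncated cone over A. An
  orthogonal map commutes with normalisation, so it pulls cones back to cones, and volume is
  invariant.\<close>

lemma distr_sphere_measure_orthogonal:
  fixes T :: "real^'n \<Rightarrow> real^'n"
  assumes T: "orthogonal_transformation T"
  shows "distr sphere_measure sphere_measure T = sphere_measure"
    and "T \<in> sphere_measure \<rightarrow>\<^sub>M sphere_measure"
proof -
  have Tb: "T \<in> borel \<rightarrow>\<^sub>M borel"
    using orthogonal_transformation_linear[OF T]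
    by (simp add: borel_measurable_continuous_onI linear_continuous_on linear_conv_bounded_linear)
  have nT: "norm (T x) = norm x" for x using T by (simp add: orthogonal_transformation_norm)
  have scal: "T (c *\<^sub>R x) = c *\<^sub>R T x" for c x
    using T by (simp add: linear_cmul orthogonal_transformation_linear)
  show m: "T \<in> sphere_measure \<rightarrow>\<^sub>M sphere_measure"
    unfolding measurable_cong_sets[OF sets_sphere_measure sets_sphere_measure]
    by (intro measurable_restrict_space2 measurable_restrict_space1 Tb) (auto simp: space_restrict_space nT)
  show "distr sphere_measure sphere_measure T = sphere_measure"
  proof (rule measure_eqI)
    fix A assume A: "A \<in> sets (distr sphere_measure sphere_measure T)"
    then have A': "A \<in> sets (restrict_space borel (sphere 0 1))" by (simp add: sets_sphere_measure)
    have A'': "T -` A \<inter> sphere 0 1 \<in> sets (restrict_space borel (sphere 0 1))"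
      using measurable_sets[OF m, of A] A by (simp add: space_sphere_measure sets_sphere_measure)
    let ?B = "{x \<in> ball 0 1 - {0}. x /\<^sub>R norm x \<in> A}"
    have "emeasure (distr sphere_measure sphere_measure T) A = emeasure sphere_measure (T -` A \<inter> sphere 0 1)"
      using A m by (simp add: emeasure_distr space_sphere_measure)
    also have "\<dots> = of_nat DIM(real^'n) * emeasure lborel {x \<in> ball 0 1 - {0}. x /\<^sub>R norm x \<in> T -` A \<inter> sphere 0 1}"
      by (rule emeasure_sphere_measure[OF A''])
    also have "{x \<in> ball 0 1 - {0}. x /\<^sub>R norm x \<in> T -` A \<inter> sphere 0 1} = T -` ?B"
    proof (rule set_eqI)
      fix x
      have "T x = 0 \<longleftrightarrow> x = 0" using nT[of x] by (metis norm_eq_zero)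
      moreover have "T (x /\<^sub>R norm x) = T x /\<^sub>R norm (T x)" by (simp add: scal nT)
      ultimately show "x \<in> {x \<in> ball 0 1 - {0}. x /\<^sub>R norm x \<in> T -` A \<inter> sphere 0 1} \<longleftrightarrow> x \<in> T -` ?B"
        by (cases "x = 0") (simp_all add: nT)
    qed
    also have "emeasure lborel (T -` ?B) = emeasure lborel ?B"
    proof (rule emeasure_lborel_orthogonal_vimage[OF T])
      have "?B = (\<lambda>x. x /\<^sub>R norm x) -` A \<inter> space (restrict_space lborel (ball 0 1 - {0}))"
        by (auto simp: space_restrict_space)
      then have "?B \<in> sets (restrict_space lborel (ball 0 1 - {0}))"
        using measurable_sets[OF normalize_measurable_sphere A'] by simp
      then show "?B \<in> sets borel" by (subst (asm) sets_restrict_space_iff) auto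
    qed
    also have "of_nat DIM(real^'n) * emeasure lborel ?B = emeasure sphere_measure A"
      by (rule emeasure_sphere_measure[OF A', symmetric])
    finally show "emeasure (distr sphere_measure sphere_measure T) A = emeasure sphere_measure A" .
  qed simp
qed

lemma nn_integral_sphere_orthogonal:
  fixes T :: "real^'n \<Rightarrow> real^'n" and f :: "real^'n \<Rightarrow> ennreal"
  assumes T: "orthogonal_transformation T" and f: "f \<in> borel_measurable (completion sphere_measure)"
  shows "(\<integral>\<^sup>+\<omega>. f (T \<omega>) \<partial>sphere_measure) = (\<integral>\<^sup>+\<omega>. f \<omega> \<partial>sphere_measure)"
proof -
  obtain g where g[measurable]: "g \<in> borel_measurable sphere_measure" and fg: "AE x in sphere_measure. f x = g x"
    using completion_ex_borel_measurable[OF f] by blast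
  note D = distr_sphere_measure_orthogonal[OF T]
  have "AE x in distr sphere_measure sphere_measure T. f x = g x" using fg unfolding D(1) .
  then have "AE x in sphere_measure. f (T x) = g (T x)" by (rule AE_distrD[OF D(2)])
  then have "(\<integral>\<^sup>+\<omega>. f (T \<omega>) \<partial>sphere_measure) = (\<integral>\<^sup>+\<omega>. g (T \<omega>) \<partial>sphere_measure)"
    by (rule nn_integral_cong_AE)
  also have "\<dots> = (\<integral>\<^sup>+\<omega>. g \<omega> \<partial>distr sphere_measure sphere_measure T)"
    by (subst nn_integral_distr) (use D(2) g in auto)
  also have "\<dots> = (\<integral>\<^sup>+\<omega>. f \<omega> \<partial>sphere_measure)"
    using fg by (auto simp: D(1) intro!: nn_integral_cong_AE)
  finally show ?thesis .
qed

text \<open>The \<open>itself\<close> argument records the dimension: the value depends on it, but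
  not on the unit vector.\<close>

definition total_angular_mass :: "(real \<Rightarrow> real) \<Rightarrow> 'n::finite itself \<Rightarrow> real" where
  "total_angular_mass bhat _ = angular_mass bhat (SOME n::real^'n. norm n = 1)"

lemma nn_integral_angular:
  fixes b :: "real^'n \<Rightarrow> real^'n \<Rightarrow> real" and n :: "real^'n"
  assumes sep: "separated_form \<beta> bhat b" and n: "norm n = 1"
  shows "(\<integral>\<^sup>+\<omega>. ennreal (bhat (\<omega> \<bullet> n)) \<partial>sphere_measure) = ennreal (total_angular_mass bhat TYPE('n))"
proof -
  define m :: "real^'n" where "m = (SOME n. norm n = 1)"
  have m: "norm m = 1" unfolding m_def using someI[of "\<lambda>n :: real^'n. norm n = 1", OF n] .
  \<comment> \<open>An orthogonal map carries n to the unit vector chosen in the definition, and the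
    surface measure does not notice.\<close>
  obtain T where T: "orthogonal_transformation T" "T n = m"
    using n m by (metis orthogonal_transformation_exists)
  have int: "integrable (completion sphere_measure) (\<lambda>\<omega>. bhat (\<omega> \<bullet> m))"
    using sep m by (auto simp: separated_form_def)
  have "T \<omega> \<bullet> m = \<omega> \<bullet> n" for \<omega>
    using T by (auto simp: orthogonal_transformation_def)
  then have "(\<integral>\<^sup>+\<omega>. ennreal (bhat (\<omega> \<bullet> n)) \<partial>sphere_measure) = (\<integral>\<^sup>+\<omega>. ennreal (bhat (T \<omega> \<bullet> m)) \<partial>sphere_measure)"
    by simp
  also have "\<dots> = (\<integral>\<^sup>+\<omega>. ennreal (bhat (\<omega> \<bullet> m)) \<partial>completion sphere_measure)"
    unfolding nn_integral_completion using int
    by (intro nn_integral_sphere_orthogonal[OF T(1), of "\<lambda>\<omega>. ennreal (bhat (\<omega> \<bullet> m))"]) auto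
  also have "\<dots> = ennreal (\<integral>\<omega>. bhat (\<omega> \<bullet> m) \<partial>completion sphere_measure)"
  proof (rule nn_integral_eq_integral[OF int], rule AE_I2)
    fix \<omega> :: "real^'n" assume "\<omega> \<in> space (completion sphere_measure)"
    then have "norm \<omega> = 1" by (simp add: space_sphere_measure)
    then have "\<omega> \<bullet> m \<in> {-1..1}" using Cauchy_Schwarz_ineq2[of \<omega> m] m by (auto simp: abs_le_iff)
    then show "0 \<le> bhat (\<omega> \<bullet> m)" using sep by (auto simp: separated_form_def)
  qed
  finally show ?thesis by (simp add: total_angular_mass_def m_def angular_mass_def)
qed

section \<open>Almost-everywhere statements in the collision variables\<close>

lemma AE_sphere_lborel_swap:
  fixes Q :: "'a::euclidean_space \<times> 'b::euclidean_space \<Rightarrow> bool"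
  assumes "AE p in sphere_measure \<Otimes>\<^sub>M lborel. Q p"
  shows "AE w in lborel. AE \<omega> in sphere_measure. Q (\<omega>, w)"
proof -
  \<comment> \<open>Q may describe a non-measurable set, while exchanging the two quantifiers
    requires a measurable one; avoiding a measurable null set replaces Q.\<close>
  obtain N where N: "N \<in> null_sets (sphere_measure \<Otimes>\<^sub>M (lborel :: 'b measure))" 
    "{p \<in> space (sphere_measure \<Otimes>\<^sub>M lborel). \<not> Q p} \<subseteq> N"
    using assms unfolding eventually_ae_filter by auto
  have "{p \<in> space (sphere_measure \<Otimes>\<^sub>M (lborel :: 'b measure)). (fst p, snd p) \<notin> N}
      = space (sphere_measure \<Otimes>\<^sub>M lborel) - N" by auto
  also have "\<dots> \<in> sets (sphere_measure \<Otimes>\<^sub>M (lborel :: 'b measure))" using N(1) by blast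
  finally have S: "{p \<in> space (sphere_measure \<Otimes>\<^sub>M (lborel :: 'b measure)). (fst p, snd p) \<notin> N}
      \<in> sets (sphere_measure \<Otimes>\<^sub>M (lborel :: 'b measure))" .
  have "AE \<omega> in sphere_measure. AE w in (lborel :: 'b measure). (\<omega>, w) \<notin> N"
    using AE_not_in[OF N(1)] by (rule sphere_lborel.AE_pair)
  then have "AE w in (lborel :: 'b measure). AE \<omega> in sphere_measure. (\<omega>, w) \<notin> N"
    by (subst (asm) sphere_lborel.AE_commute[OF S])
  then show ?thesis
  proof eventually_elim
    case (elim w)
    then show ?case using AE_space by eventually_elim (use N(2) in \<open>auto simp: space_pair_measure\<close>)
  qed
qed

text \<open>The bounding kernel is not assumed measurable in (\<omega>, w) jointly, so Tonelli is
  applied to a measurable version of h instead. The kernel enters only afterwards, at fixed w, where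
  its angular integral is known.\<close>

lemma nn_integral_kernel_bound:
  fixes b :: "real^'n \<Rightarrow> real^'n \<Rightarrow> real"
  assumes sep: "separated_form \<beta> bhat b"
    and h: "integrable (completion (sphere_measure \<Otimes>\<^sub>M lborel)) h"
    and K[measurable]: "K \<in> borel_measurable borel"
    and bd: "AE p in sphere_measure \<Otimes>\<^sub>M lborel.
               ennreal \<bar>h p\<bar> \<le> K (snd p) * ennreal (b (v - snd p) (fst p))"
  shows "ennreal \<bar>\<integral>p. h p \<partial>completion (sphere_measure \<Otimes>\<^sub>M lborel)\<bar>
     \<le> ennreal (total_angular_mass bhat TYPE('n)) * (\<integral>\<^sup>+w. K w * ennreal (norm (v - w) powr \<beta>) \<partial>lborel)"
proof -
  let ?P = "sphere_measure \<Otimes>\<^sub>M lborel :: ((real^'n) \<times> (real^'n)) measure"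
  obtain h' where h'[measurable]: "h' \<in> borel_measurable ?P" and hh': "AE p in ?P. h p = h' p"
    using completion_ex_borel_measurable_real[OF borel_measurable_integrable[OF h]] by blast
  have bd': "AE w in lborel. AE \<omega> in sphere_measure.
      ennreal \<bar>h' (\<omega>, w)\<bar> \<le> K w * ennreal (b (v - w) \<omega>)"
    using AE_sphere_lborel_swap[OF AE_conjI[OF bd hh']]
  proof eventually_elim
    case (elim w)
    then show ?case by eventually_elim auto
  qed
  have "ennreal \<bar>\<integral>p. h p \<partial>completion ?P\<bar> \<le> (\<integral>\<^sup>+p. ennreal \<bar>h p\<bar> \<partial>completion ?P)"
    using integral_norm_bound_ennreal[OF h] by simp
  also have "\<dots> = (\<integral>\<^sup>+p. ennreal \<bar>h' p\<bar> \<partial>?P)"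
    unfolding nn_integral_completion using hh' by (intro nn_integral_cong_AE) auto
  also have "\<dots> = (\<integral>\<^sup>+w. \<integral>\<^sup>+\<omega>. ennreal \<bar>h' (\<omega>, w)\<bar> \<partial>sphere_measure \<partial>lborel)"
    by (subst sphere_lborel.nn_integral_snd[symmetric]) auto
  also have "\<dots> \<le> (\<integral>\<^sup>+w. ennreal (total_angular_mass bhat TYPE('n)) * (K w * ennreal (norm (v - w) powr \<beta>)) \<partial>lborel)"
  proof (rule nn_integral_mono_AE)
    show "AE w in lborel. (\<integral>\<^sup>+\<omega>. ennreal \<bar>h' (\<omega>, w)\<bar> \<partial>sphere_measure)
        \<le> ennreal (total_angular_mass bhat TYPE('n)) * (K w * ennreal (norm (v - w) powr \<beta>))"
      using bd' AE_lborel_singleton[of v]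
    proof eventually_elim
      case (elim w)
      define n where "n = (v - w) /\<^sub>R norm (v - w)"
      have n: "norm n = 1" using elim(2) by (simp add: n_def)
      have int: "integrable (completion sphere_measure) (\<lambda>\<omega>. bhat (\<omega> \<bullet> n))"
        using sep n by (auto simp: separated_form_def)
      have "(\<integral>\<^sup>+\<omega>. ennreal \<bar>h' (\<omega>, w)\<bar> \<partial>sphere_measure)
          \<le> (\<integral>\<^sup>+\<omega>. (K w * ennreal (norm (v - w) powr \<beta>)) * ennreal (bhat (\<omega> \<bullet> n)) \<partial>sphere_measure)"
      proof (rule nn_integral_mono_AE)
        show "AE \<omega> in sphere_measure. ennreal \<bar>h' (\<omega>, w)\<bar>
            \<le> (K w * ennreal (norm (v - w) powr \<beta>)) * ennreal (bhat (\<omega> \<bullet> n))"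
          using elim(1) AE_space
        proof eventually_elim
          case (elim \<omega>)
          then have "b (v - w) \<omega> = norm (v - w) powr \<beta> * bhat (\<omega> \<bullet> n)"
            using sep \<open>w \<noteq> v\<close> by (auto simp: separated_form_def space_sphere_measure n_def)
          then show ?case using elim(1) by (simp add: ennreal_mult'' mult_ac)
        qed
      qed
      \<comment> \<open>At fixed w the kernel is measurable for the completed surface measure, which
        is what pulling out the constant needs.\<close>
      also have "\<dots> = (\<integral>\<^sup>+\<omega>. (K w * ennreal (norm (v - w) powr \<beta>)) * ennreal (bhat (\<omega> \<bullet> n)) \<partial>completion sphere_measure)"
        by (simp only: nn_integral_completion)
      also have "\<dots> = (K w * ennreal (norm (v - w) powr \<beta>)) * (\<integral>\<^sup>+\<omega>. ennreal (bhat (\<omega> \<bullet> n)) \<partial>completion sphere_measure)"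
        using int by (intro nn_integral_cmult) auto
      also have "\<dots> = ennreal (total_angular_mass bhat TYPE('n)) * (K w * ennreal (norm (v - w) powr \<beta>))"
        by (simp only: nn_integral_completion nn_integral_angular[OF sep n] mult.commute)
      finally show ?case .
    qed
  qed
  also have "\<dots> = ennreal (total_angular_mass bhat TYPE('n)) * (\<integral>\<^sup>+w. K w * ennreal (norm (v - w) powr \<beta>) \<partial>lborel)"
    by (intro nn_integral_cmult) auto
  finally show ?thesis .
qed

text \<open>For every \<omega> the map \<open>g \<omega>\<close> is a differentiable involution of
  the (z, w) space and so preserves null sets. Fubini moves the quantifier over \<omega> inside,
  which is where joint measurability of the first component enters.\<close>

lemma AE_collision:
  fixes g :: "real^'n \<Rightarrow> 'a::euclidean_space \<times> 'b::euclidean_space \<Rightarrow> 'a \<times> 'b"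
  assumes P: "AE y in lebesgue. P y"
    and diff: "\<And>\<omega>. norm \<omega> = 1 \<Longrightarrow> g \<omega> differentiable_on UNIV"
    and invol: "\<And>\<omega> z. norm \<omega> = 1 \<Longrightarrow> g \<omega> (g \<omega> z) = z"
    and meas: "(\<lambda>(\<omega>, z). fst (g \<omega> z)) \<in> borel_measurable (sphere_measure \<Otimes>\<^sub>M borel)"
  shows "AE z in lebesgue. AE p in sphere_measure \<Otimes>\<^sub>M lborel. P (fst (g (fst p) (z, snd p)))"
proof -
  obtain N where N: "N \<in> null_sets lborel" "{y. \<not> P y} \<subseteq> N"
    using P[unfolded AE_completion_iff] unfolding eventually_ae_filter by auto
  have [measurable]: "N \<in> sets borel" using N(1) by auto
  have notN: "AE y in lebesgue. y \<notin> N" using AE_not_in[OF N(1)] by (simp add: AE_completion_iff)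
  have m[measurable]: "(\<lambda>p. fst (g (fst p) (snd p))) \<in> borel_measurable (sphere_measure \<Otimes>\<^sub>M lborel)"
    using meas by (simp add: split_beta measurable_cong_sets[OF sets_pair_measure_cong[OF refl sets_lborel] refl])
  have S: "{p \<in> space (sphere_measure \<Otimes>\<^sub>M lborel). fst (g (fst p) (snd p)) \<notin> N} \<in> sets (sphere_measure \<Otimes>\<^sub>M lborel)"
    by measurable
  have "AE \<omega> in sphere_measure. AE zw in lborel. fst (g \<omega> zw) \<notin> N"
    using AE_space
  proof eventually_elim
    case (elim \<omega>)
    then have \<omega>: "norm \<omega> = 1" by (simp add: space_sphere_measure)
    have "AE zw in (lebesgue :: ('a \<times> 'b) measure). fst zw \<notin> N" by (rule AE_lebesgue_fst[OF notN])
    from AE_lebesgue_compose[OF this diff[OF \<omega>] invol[OF \<omega>]]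
    show ?case by (simp add: AE_completion_iff)
  qed
  then have "AE zw in lborel. AE \<omega> in sphere_measure. fst (g \<omega> zw) \<notin> N"
    by (subst (asm) sphere_lborel.AE_commute[OF S])
  then have "AE z in lborel. AE w in lborel. AE \<omega> in sphere_measure. fst (g \<omega> (z, w)) \<notin> N"
    unfolding lborel_prod[symmetric] by (rule lborel_pair.AE_pair)
  then have "AE z in lborel. AE p in sphere_measure \<Otimes>\<^sub>M lborel. fst (g (fst p) (z, snd p)) \<notin> N"
  proof eventually_elim
    case (elim z)
    have "(\<lambda>p. (fst p, (z, snd p))) \<in> sphere_measure \<Otimes>\<^sub>M lborel \<rightarrow>\<^sub>M sphere_measure \<Otimes>\<^sub>M (lborel \<Otimes>\<^sub>M lborel)"
      by measurable
    from measurable_compose[OF this[unfolded lborel_prod] m]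
    have [measurable]: "(\<lambda>p. fst (g (fst p) (z, snd p))) \<in> borel_measurable (sphere_measure \<Otimes>\<^sub>M lborel)"
      by simp
    have S': "{p \<in> space (sphere_measure \<Otimes>\<^sub>M lborel). fst (g (fst p) (z, snd p)) \<notin> N}
        \<in> sets (sphere_measure \<Otimes>\<^sub>M lborel)"
      by measurable
    have "AE \<omega> in sphere_measure. AE w in lborel. fst (g \<omega> (z, w)) \<notin> N"
      using elim by (subst sphere_lborel.AE_commute[OF S'])
    then show ?case by (intro sphere_lborel.AE_pair_measure[OF S']) simp
  qed
  then show ?thesis
    unfolding AE_completion_iff
    by (elim eventually_mono) (use N(2) in \<open>auto elim!: eventually_mono\<close>)
qed

section \<open>Differences of collision integrals\<close>

lemma L1_loc_UNIV_borel_measurable: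
  fixes f :: "'a::euclidean_space \<Rightarrow> real"
  assumes "L1_loc UNIV f"
  shows "f \<in> borel_measurable lebesgue"
proof (rule borel_measurable_LIMSEQ_real)
  fix n :: nat
  have "set_integrable lebesgue (cball 0 (real n)) f"
    using assms by (simp add: L1_loc_def)
  then show "(\<lambda>x. indicat_real (cball 0 (real n)) x *\<^sub>R f x) \<in> borel_measurable lebesgue"
    unfolding set_integrable_def by (rule borel_measurable_integrable)
next
  fix x :: 'a
  have "eventually (\<lambda>n. indicat_real (cball 0 (real n)) x *\<^sub>R f x = f x) sequentially"
    using eventually_ge_at_top[of "nat \<lceil>norm x\<rceil>"] by eventually_elim (auto simp: indicator_def nat_le_iff ceiling_le_iff)
  then show "(\<lambda>n. indicat_real (cball 0 (real n)) x *\<^sub>R f x) \<longlonglongrightarrow> f x"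
    by (rule tendsto_eventually)
qed

section \<open>Free transport and null sets\<close>

lemma differentiable_shear:
  "(\<lambda>z :: 'a::euclidean_space \<times> 'a \<times> real. (fst z, fst (snd z) + (c * snd (snd z)) *\<^sub>R fst z, snd (snd z)))
     differentiable_on UNIV"
proof -
  have "(\<lambda>z :: 'a \<times> 'a \<times> real. (fst z, fst (snd z) + (c * snd (snd z)) *\<^sub>R fst z, snd (snd z))) differentiable at y" for y
    by (intro differentiableI) (rule derivative_eq_intros refl)+
  then show ?thesis by (simp add: differentiable_on_def differentiable_at_withinI)
qed

text \<open>c = 1 passes to characteristics and c = -1 undoes it; the shears for c and -c are
  inverse to each other.\<close>

lemma AE_shear:
  fixes P :: "'a::euclidean_space \<times> 'a \<times> real \<Rightarrow> bool"
  assumes "AE z in lebesgue. P z"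
  shows "AE z in lebesgue. P (fst z, fst (snd z) + (c * snd (snd z)) *\<^sub>R fst z, snd (snd z))"
  by (rule AE_lebesgue_compose[OF assms differentiable_shear[of "- c"]]) (auto simp: algebra_simps)

lemma AE_characteristics:
  fixes P :: "'a::euclidean_space \<times> 'a \<times> real \<Rightarrow> bool"
  assumes "AE z in lebesgue. P z"
  shows "AE p in lebesgue. AE t in lebesgue. P (fst p, snd p + t *\<^sub>R fst p, t)"
  using AE_lebesgue_prod[OF AE_lebesgue_assoc[OF AE_shear[OF assms, of 1]]] by simp

text \<open>A characteristic is itself a null set, so Lebesgue measurability of f says nothing about
  one particular line. A Borel version is measurable on all of them and agrees with f almost
  everywhere on almost all of them.\<close>

lemma measurable_characteristics:
  fixes f :: "'a::euclidean_space \<times> 'a \<times> real \<Rightarrow> real"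
  assumes "f \<in> borel_measurable lebesgue"
  shows "AE p in lebesgue. (\<lambda>t. f (fst p, snd p + t *\<^sub>R fst p, t)) \<in> borel_measurable lebesgue"
proof -
  obtain f' where f'[measurable]: "f' \<in> borel_measurable borel" and eq: "AE z in lborel. f z = f' z"
    using completion_ex_borel_measurable_real[OF assms] by auto
  have "AE z in lebesgue. f z = f' z" using eq by (simp add: AE_completion_iff)
  from AE_characteristics[OF this] show ?thesis
  proof eventually_elim
    case (elim p)
    have "(\<lambda>t. f' (fst p, snd p + t *\<^sub>R fst p, t)) \<in> borel_measurable borel" by measurable
    then have "(\<lambda>t. f' (fst p, snd p + t *\<^sub>R fst p, t)) \<in> borel_measurable lebesgue"
      by (intro measurable_completion) simp
    then show ?case
      by (rule borel_measurable_AE) (use elim in \<open>auto elim!: eventually_mono\<close>)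
  qed
qed

text \<open>From A1 B1 - A2 B2 = (A1 - A2) B1 + A2 (B1 - B2); this is the first factor 2 of the
  constant 4.\<close>

lemma prod_difference_bound:
  assumes "\<bar>A1\<bar> \<le> m" "\<bar>A2\<bar> \<le> m" "\<bar>B1\<bar> \<le> n" "\<bar>B2\<bar> \<le> n"
    and A: "ennreal \<bar>A1 - A2\<bar> \<le> g * ennreal m" and B: "ennreal \<bar>B1 - B2\<bar> \<le> g * ennreal n"
  shows "ennreal \<bar>A1 * B1 - A2 * B2\<bar> \<le> 2 * g * ennreal (m * n)"
proof -
  have mn: "0 \<le> m" "0 \<le> n" using assms by auto
  have "A1 * B1 - A2 * B2 = (A1 - A2) * B1 + A2 * (B1 - B2)" by algebra
  then have "\<bar>A1 * B1 - A2 * B2\<bar> \<le> \<bar>A1 - A2\<bar> * \<bar>B1\<bar> + \<bar>A2\<bar> * \<bar>B1 - B2\<bar>"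
    by (metis abs_mult abs_triangle_ineq)
  also have "\<dots> \<le> \<bar>A1 - A2\<bar> * n + m * \<bar>B1 - B2\<bar>"
    using assms by (intro add_mono mult_mono) auto
  finally have "ennreal \<bar>A1 * B1 - A2 * B2\<bar> \<le> ennreal \<bar>A1 - A2\<bar> * ennreal n + ennreal m * ennreal \<bar>B1 - B2\<bar>"
    using mn by (simp add: ennreal_mult[symmetric] ennreal_plus[symmetric] ennreal_leI del: ennreal_plus)
  also have "\<dots> \<le> (g * ennreal m) * ennreal n + ennreal m * (g * ennreal n)"
    using A B by (intro add_mono mult_mono) auto
  also have "\<dots> = 2 * g * ennreal (m * n)"
    using mn by (simp add: ennreal_mult mult_ac flip: mult_2)
  finally show ?thesis .
qed

text \<open>A collision reverses the \<omega>-component of the relative velocity, so that a second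
  one undoes it. The last two identities serve the map that lists the starred velocity
  first.\<close>

lemma collide_involution:
  assumes "norm \<omega> = 1"
  shows "collide (collide v w \<omega>) (collide_star v w \<omega>) \<omega> = v"
    and "collide_star (collide v w \<omega>) (collide_star v w \<omega>) \<omega> = w"
    and "collide (collide_star v w \<omega>) (collide v w \<omega>) \<omega> = w"
    and "collide_star (collide_star v w \<omega>) (collide v w \<omega>) \<omega> = v"
proof -
  have "\<omega> \<bullet> \<omega> = 1" using assms by (simp add: norm_eq_1)
  moreover have "collide v w \<omega> \<bullet> \<omega> = v \<bullet> \<omega> - (v - w) \<bullet> \<omega> * (\<omega> \<bullet> \<omega>)"
      "collide_star v w \<omega> \<bullet> \<omega> = w \<bullet> \<omega> + (v - w) \<bullet> \<omega> * (\<omega> \<bullet> \<omega>)"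
    by (simp_all only: collide_def collide_star_def inner_diff_left inner_add_left inner_scaleR_left)
  ultimately have "(collide v w \<omega> - collide_star v w \<omega>) \<bullet> \<omega> = - ((v - w) \<bullet> \<omega>)"
      "(collide_star v w \<omega> - collide v w \<omega>) \<bullet> \<omega> = (v - w) \<bullet> \<omega>"
    by (simp_all add: inner_diff_left)
  then show "collide (collide v w \<omega>) (collide_star v w \<omega>) \<omega> = v"
    "collide_star (collide v w \<omega>) (collide_star v w \<omega>) \<omega> = w"
    "collide (collide_star v w \<omega>) (collide v w \<omega>) \<omega> = w"
    "collide_star (collide_star v w \<omega>) (collide v w \<omega>) \<omega> = v"
    by (simp_all only: collide_def[of "collide _ _ _"] collide_def[of "collide_star _ _ _"]
        collide_star_def[of "collide _ _ _"] collide_star_def[of "collide_star _ _ _"])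
      (simp_all add: collide_def collide_star_def)
qed

text \<open>Bounds on F hold only almost everywhere, yet the collision integral evaluates F at three
  further velocities. Each of them is the first component of an involution of (v, w): the collision,
  the collision with its outputs exchanged, and the exchange of v and w.\<close>

lemma AE_at_collision_velocities:
  fixes P :: "(real^'n) \<times> (real^'n) \<times> real \<Rightarrow> bool"
  assumes P: "AE z in lebesgue. P z"
  shows "AE z in lebesgue. AE p in sphere_measure \<Otimes>\<^sub>M lborel. case z of (v, x, t) \<Rightarrow> case p of (\<omega>, w) \<Rightarrow>
     P (collide v w \<omega>, x, t) \<and> P (collide_star v w \<omega>, x, t) \<and> P (w, x, t)"
proof -
  let ?S = "sphere_measure \<Otimes>\<^sub>M (borel :: (((real^'n) \<times> (real^'n) \<times> real) \<times> (real^'n)) measure)"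
  have [measurable]: "(\<lambda>p. fst p) \<in> borel_measurable ?S"
    by (rule measurable_compose[OF measurable_fst measurable_id_sphere_measure])
  have [measurable]: "(\<lambda>p. fst (fst (snd p))) \<in> borel_measurable ?S" "(\<lambda>p. snd (fst (snd p))) \<in> borel_measurable ?S"
    "(\<lambda>p. snd (snd p)) \<in> borel_measurable ?S"
    by (auto intro!: measurable_compose[OF measurable_snd] borel_measurable_continuous_onI continuous_intros)
  have m: "(\<lambda>p. collide (fst (fst (snd p))) (snd (snd p)) (fst p)) \<in> borel_measurable ?S"
    "(\<lambda>p. collide_star (fst (fst (snd p))) (snd (snd p)) (fst p)) \<in> borel_measurable ?S"
    unfolding collide_def collide_star_def by measurable
  have 1: "AE z in lebesgue. AE p in sphere_measure \<Otimes>\<^sub>M lborel. P (collide (fst z) (snd p) (fst p), snd z)"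
  proof -
    define h where "h = (\<lambda>\<omega> (y :: ((real^'n) \<times> (real^'n) \<times> real) \<times> (real^'n)).
      ((collide (fst (fst y)) (snd y) \<omega>, snd (fst y)), collide_star (fst (fst y)) (snd y) \<omega>))"
    have "AE z in lebesgue. AE p in sphere_measure \<Otimes>\<^sub>M lborel. P (fst (h (fst p) (z, snd p)))"
    proof (rule AE_collision[OF P])
      show "h \<omega> differentiable_on UNIV" for \<omega>
        by (intro linear_imp_differentiable_on linearI) (simp_all add: h_def collide_def collide_star_def algebra_simps)
      show "(\<lambda>(\<omega>, z). fst (h \<omega> z)) \<in> borel_measurable (sphere_measure \<Otimes>\<^sub>M borel)"
        unfolding h_def split_beta fst_conv by (intro borel_measurable_Pair m) measurable
    qed (simp add: h_def collide_involution)
    then show ?thesis by (simp add: h_def)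
  qed
  have 2: "AE z in lebesgue. AE p in sphere_measure \<Otimes>\<^sub>M lborel. P (collide_star (fst z) (snd p) (fst p), snd z)"
  proof -
    define h where "h = (\<lambda>\<omega> (y :: ((real^'n) \<times> (real^'n) \<times> real) \<times> (real^'n)).
      ((collide_star (fst (fst y)) (snd y) \<omega>, snd (fst y)), collide (fst (fst y)) (snd y) \<omega>))"
    have "AE z in lebesgue. AE p in sphere_measure \<Otimes>\<^sub>M lborel. P (fst (h (fst p) (z, snd p)))"
    proof (rule AE_collision[OF P])
      show "h \<omega> differentiable_on UNIV" for \<omega>
        by (intro linear_imp_differentiable_on linearI) (simp_all add: h_def collide_def collide_star_def algebra_simps)
      show "(\<lambda>(\<omega>, z). fst (h \<omega> z)) \<in> borel_measurable (sphere_measure \<Otimes>\<^sub>M borel)"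
        unfolding h_def split_beta fst_conv by (intro borel_measurable_Pair m) measurable
    qed (simp add: h_def collide_involution)
    then show ?thesis by (simp add: h_def)
  qed
  have 3: "AE z in (lebesgue :: ((real^'n) \<times> (real^'n) \<times> real) measure).
      AE p in (sphere_measure :: (real^'n) measure) \<Otimes>\<^sub>M lborel. P (snd p, snd z)"
  proof -
    define h where "h = (\<lambda>(\<omega> :: real^'n) (y :: ((real^'n) \<times> (real^'n) \<times> real) \<times> (real^'n)). ((snd y, snd (fst y)), fst (fst y)))"
    have "AE z in lebesgue. AE p in sphere_measure \<Otimes>\<^sub>M lborel. P (fst (h (fst p) (z, snd p)))"
    proof (rule AE_collision[OF P])
      show "h \<omega> differentiable_on UNIV" for \<omega>
        by (intro linear_imp_differentiable_on linearI) (simp_all add: h_def)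
      show "(\<lambda>(\<omega>, z). fst (h \<omega> z)) \<in> borel_measurable (sphere_measure \<Otimes>\<^sub>M borel)"
        unfolding h_def split_beta fst_conv by measurable
    qed (simp add: h_def)
    then show ?thesis by (simp add: h_def)
  qed
  show ?thesis
    using 1 2 3
  proof eventually_elim
    case (elim z)
    then show ?case by eventually_elim (auto simp: split_beta)
  qed
qed

text \<open>Collects what both cases for v0 share. The weight \<open>a\<close> stands for the
  supremum norm of the attenuation, and the attenuation is written as an \<open>ennreal\<close>
  integral so that divergence cannot be hidden by a default value.\<close>

locale dominated_collisions =
  fixes \<beta> :: real and bhat :: "real \<Rightarrow> real" and b :: "real^'n \<Rightarrow> real^'n \<Rightarrow> real"
    and M :: "real^'n \<Rightarrow> real^'n \<Rightarrow> real \<Rightarrow> real" and a :: "real \<Rightarrow> ennreal"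
  assumes sep: "separated_form \<beta> bhat b"
    and M_borel: "(\<lambda>(v, x, t). M v x t) \<in> borel_measurable borel"
    and M_pos: "0 < M v x t"
    and M_collide: "norm \<omega> = 1 \<Longrightarrow> M (collide v w \<omega>) x t * M (collide_star v w \<omega>) x t = M v x t * M w x t"
    and a_borel[measurable]: "a \<in> borel_measurable borel"
    and a_integral: "(\<integral>\<^sup>+t. a t \<partial>lborel) < top"
    and attenuation_le: "AE (v, x, t) in lebesgue.
          ennreal (total_angular_mass bhat TYPE('n)) * (\<integral>\<^sup>+w. ennreal (M w x t) * ennreal (norm (v - w) powr \<beta>) \<partial>lborel) \<le> a t"
begin

lemma M_nonneg: "0 \<le> M v x t"
  using M_pos by (rule less_imp_le)

lemma kernel_nonneg: "z \<noteq> 0 \<Longrightarrow> norm \<omega> = 1 \<Longrightarrow> 0 \<le> b z \<omega>"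
proof -
  assume z: "z \<noteq> 0" "norm \<omega> = 1"
  have "\<bar>\<omega> \<bullet> (z /\<^sub>R norm z)\<bar> \<le> 1"
    using Cauchy_Schwarz_ineq2[of \<omega> "z /\<^sub>R norm z"] z by simp
  then have "\<omega> \<bullet> (z /\<^sub>R norm z) \<in> {-1..1}" by (auto simp: abs_le_iff simp del: inner_scaleR_right)
  then have "0 \<le> bhat (\<omega> \<bullet> (z /\<^sub>R norm z))" using sep unfolding separated_form_def by blast
  moreover have "b z \<omega> = norm z powr \<beta> * bhat (\<omega> \<bullet> (z /\<^sub>R norm z))" using sep z unfolding separated_form_def by blast
  ultimately show ?thesis by simp
qed

text \<open>At fixed (v, x, t) the factors g(t) and M(v) are constants, so what remains under the
  integral in w and \<omega> is M(w) times the kernel, that is, the attenuation of M.\<close>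

lemma collision_integral_difference:
  assumes F: "AE (v, x, t) in lebesgue. \<bar>F1 v x t\<bar> \<le> M v x t" "AE (v, x, t) in lebesgue. \<bar>F2 v x t\<bar> \<le> M v x t"
    and int: "AE (v, x, t) in lebesgue. integrable (completion (sphere_measure \<Otimes>\<^sub>M lborel)) (collision_integrand b F1 v x t)"
      "AE (v, x, t) in lebesgue. integrable (completion (sphere_measure \<Otimes>\<^sub>M lborel)) (collision_integrand b F2 v x t)"
    and g: "AE (v, x, t) in lebesgue. ennreal \<bar>F1 v x t - F2 v x t\<bar> \<le> g t * ennreal (M v x t)"
  shows "AE (v, x, t) in lebesgue. ennreal \<bar>collision_integral b F1 v x t - collision_integral b F2 v x t\<bar>
           \<le> 4 * a t * g t * ennreal (M v x t)"
proof -
  define P where "P = (\<lambda>(v, x, t). \<bar>F1 v x t\<bar> \<le> M v x t \<and> \<bar>F2 v x t\<bar> \<le> M v x t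
      \<and> ennreal \<bar>F1 v x t - F2 v x t\<bar> \<le> g t * ennreal (M v x t))"
  have P: "AE z in lebesgue. P z"
    using F g by eventually_elim (auto simp: P_def)
  show ?thesis
    using AE_at_collision_velocities[OF P] P int attenuation_le
  proof eventually_elim
    case (elim z)
    obtain v x t where z: "z = (v, x, t)" by (cases z)
    let ?P = "sphere_measure \<Otimes>\<^sub>M lborel :: ((real^'n) \<times> (real^'n)) measure"
    let ?h = "\<lambda>p. collision_integrand b F1 v x t p - collision_integrand b F2 v x t p"
    define K where "K = (\<lambda>w. (4 * g t * ennreal (M v x t)) * ennreal (M w x t))"
    have Mw[measurable]: "(\<lambda>w. M w x t) \<in> borel_measurable borel"
      using measurable_compose[of "\<lambda>w. (w, x, t)" borel borel, OF _ M_borel] by simp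
    \<comment> \<open>At zero relative velocity nothing is known about b, not even its sign.\<close>
    have "AE p in ?P. snd p \<noteq> v"
    proof (rule sphere_lborel.AE_pair_measure)
      show "{p \<in> space ?P. snd p \<noteq> v} \<in> sets ?P" by measurable
    qed (simp add: AE_lborel_singleton)
    then have bd: "AE p in ?P. ennreal \<bar>?h p\<bar> \<le> K (snd p) * ennreal (b (v - snd p) (fst p))"
      using elim(1) AE_space
    proof eventually_elim
      case (elim p)
      obtain \<omega> w where p: "p = (\<omega>, w)" by (cases p)
      have \<omega>: "norm \<omega> = 1" using elim(3) by (simp add: p space_pair_measure space_sphere_measure)
      have b0: "0 \<le> b (v - w) \<omega>" using elim(1) \<omega> by (intro kernel_nonneg) (auto simp: p)
      let ?v = "collide v w \<omega>" and ?w = "collide_star v w \<omega>"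
      have 1: "ennreal \<bar>F1 ?v x t * F1 ?w x t - F2 ?v x t * F2 ?w x t\<bar> \<le> 2 * g t * ennreal (M ?v x t * M ?w x t)"
        using elim(2) by (intro prod_difference_bound) (auto simp: p z P_def)
      have 2: "ennreal \<bar>F1 v x t * F1 w x t - F2 v x t * F2 w x t\<bar> \<le> 2 * g t * ennreal (M v x t * M w x t)"
        using elim(2) \<open>P z\<close> by (intro prod_difference_bound) (auto simp: p z P_def)
      let ?d = "(F1 ?v x t * F1 ?w x t - F2 ?v x t * F2 ?w x t) - (F1 v x t * F1 w x t - F2 v x t * F2 w x t)"
      have "ennreal \<bar>?d\<bar> \<le> ennreal \<bar>F1 ?v x t * F1 ?w x t - F2 ?v x t * F2 ?w x t\<bar> + ennreal \<bar>F1 v x t * F1 w x t - F2 v x t * F2 w x t\<bar>"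
        by (simp add: ennreal_plus[symmetric] ennreal_leI abs_triangle_ineq4 del: ennreal_plus)
      \<comment> \<open>Collision invariance of the product of Maxwellians makes the gain bound
        equal to the loss bound; this is the second factor 2.\<close>
      also have "\<dots> \<le> 2 * g t * ennreal (M v x t * M w x t) + 2 * g t * ennreal (M v x t * M w x t)"
        using 1 2 M_collide[OF \<omega>, of v w x t] by (intro add_mono) auto
      also have "\<dots> = K w"
        by (simp add: K_def ennreal_mult M_nonneg mult_ac flip: distrib_left mult_2)
      finally have "ennreal \<bar>?d\<bar> * ennreal (b (v - w) \<omega>) \<le> K w * ennreal (b (v - w) \<omega>)"
        by (rule mult_right_mono) simp
      moreover have "?h p = ?d * b (v - w) \<omega>"
        by (simp add: p collision_integrand_def algebra_simps)
      ultimately show ?case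
        using b0 by (simp add: p abs_mult ennreal_mult)
    qed
    have "ennreal \<bar>collision_integral b F1 v x t - collision_integral b F2 v x t\<bar>
        = ennreal \<bar>\<integral>p. ?h p \<partial>completion ?P\<bar>"
      using elim(3,4) by (simp add: z collision_integral_def Bochner_Integration.integral_diff)
    also have "\<dots> \<le> ennreal (total_angular_mass bhat TYPE('n)) * (\<integral>\<^sup>+w. K w * ennreal (norm (v - w) powr \<beta>) \<partial>lborel)"
      using elim(3,4) bd by (intro nn_integral_kernel_bound[OF sep]) (auto simp: z K_def)
    also have "(\<integral>\<^sup>+w. K w * ennreal (norm (v - w) powr \<beta>) \<partial>lborel)
        = (4 * g t * ennreal (M v x t)) * (\<integral>\<^sup>+w. ennreal (M w x t) * ennreal (norm (v - w) powr \<beta>) \<partial>lborel)"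
      unfolding K_def by (subst nn_integral_cmult[symmetric]) (auto simp: mult_ac)
    also have "ennreal (total_angular_mass bhat TYPE('n)) * \<dots> =
        (4 * g t * ennreal (M v x t)) * (ennreal (total_angular_mass bhat TYPE('n)) * (\<integral>\<^sup>+w. ennreal (M w x t) * ennreal (norm (v - w) powr \<beta>) \<partial>lborel))"
      by (simp add: mult_ac)
    also have "\<dots> \<le> (4 * g t * ennreal (M v x t)) * a t"
      using elim(5) by (intro mult_left_mono) (auto simp: z)
    finally show ?case by (simp add: z mult_ac)
  qed
qed

end

text \<open>Kept apart from the bounds above: invariance along characteristics is available for v0 =
  0, and the L1 argument for v0 \<noteq> 0 has to do without it.\<close>

locale transported_dominated_collisions = dominated_collisions \<beta> bhat b M a
  for \<beta> bhat and b :: "real^'n \<Rightarrow> real^'n \<Rightarrow> real" and M a +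
  assumes M_transport: "M v (x + t *\<^sub>R v) t = M v x 0"

section \<open>The Gronwall estimate for mild solutions\<close>

lemma mild_solutionD:
  assumes "mild_solution b UNIV F"
  shows "(\<lambda>(v, x, t). F v x t) \<in> borel_measurable lebesgue"
    and "(\<lambda>(v, x). F v x t) \<in> borel_measurable lebesgue"
    and "AE (v, x, t) in lebesgue. integrable (completion (sphere_measure \<Otimes>\<^sub>M lborel)) (collision_integrand b F v x t)"
    and "(\<lambda>(v, x, t). collision_integral b F v x t) \<in> borel_measurable lebesgue"
    and "AE (v, x) in lebesgue. \<forall>r t. F v (x + t *\<^sub>R v) t
          = F v (x + r *\<^sub>R v) r + (LINT s=r..t|lebesgue. collision_integral b F v (x + s *\<^sub>R v) s)"
proof -
  note F = assms[unfolded mild_solution_def]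
  show "(\<lambda>(v, x, t). F v x t) \<in> borel_measurable lebesgue"
    using F by (intro L1_loc_UNIV_borel_measurable) simp
  show "(\<lambda>(v, x). F v x t) \<in> borel_measurable lebesgue"
    using F by (intro L1_loc_UNIV_borel_measurable) (simp add: continuous_L1_loc_def)
  show "AE (v, x, t) in lebesgue. integrable (completion (sphere_measure \<Otimes>\<^sub>M lborel)) (collision_integrand b F v x t)"
    using F by simp
  show "(\<lambda>(v, x, t). collision_integral b F v x t) \<in> borel_measurable lebesgue"
    using F by (intro L1_loc_UNIV_borel_measurable) simp
  have "AE (v, x) in lebesgue. \<forall>t1\<in>UNIV. \<forall>t2\<in>UNIV.
        free_transport t2 (\<lambda>v x. F v x t2) v x
          = free_transport t1 (\<lambda>v x. F v x t1) v x
            + (LINT s=t1..t2|lebesgue. free_transport s (\<lambda>v x. collision_integral b F v x s) v x)"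
    using F by blast
  then show "AE (v, x) in lebesgue. \<forall>r t. F v (x + t *\<^sub>R v) t
          = F v (x + r *\<^sub>R v) r + (LINT s=r..t|lebesgue. collision_integral b F v (x + s *\<^sub>R v) s)"
    by eventually_elim (auto simp: free_transport_def)
qed

text \<open>Orientation contributes only a sign, which absolute values remove, so one set of times
  serves t of either sign.\<close>

lemma interval_integral_tspan:
  "(LINT s=0..ereal t|lebesgue. f s) = (if 0 \<le> t then 1 else - 1) * (LINT s:tspan t|lebesgue. (f s :: real))"
proof -
  have "einterval 0 (ereal t) = tspan t" if "0 \<le> t"
    using that by (auto simp: einterval_def tspan_iff min_def max_def)
  moreover have "einterval (ereal t) 0 = tspan t" if "\<not> 0 \<le> t"
    using that by (auto simp: einterval_def tspan_iff min_def max_def)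
  ultimately show ?thesis by (simp add: interval_lebesgue_integral_def)
qed

lemma interval_integral_difference_bound:
  fixes f g :: "real \<Rightarrow> real"
  assumes "integrable lebesgue f" "integrable lebesgue g"
    and bd: "AE s in lebesgue. ennreal \<bar>f s - g s\<bar> \<le> h s"
  shows "ennreal \<bar>(LINT s=0..ereal t|lebesgue. f s) - (LINT s=0..ereal t|lebesgue. g s)\<bar> \<le> span_integral tspan h t"
proof -
  have I: "set_integrable lebesgue (tspan t) f" "set_integrable lebesgue (tspan t) g"
    unfolding set_integrable_def by (rule integrable_mult_indicator[OF _ assms(1)] integrable_mult_indicator[OF _ assms(2)], simp)+
  then have J: "integrable lebesgue (\<lambda>s. indicat_real (tspan t) s *\<^sub>R (f s - g s))"
    using set_integral_diff(1)[OF I] by (simp add: set_integrable_def)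
  have "\<bar>(LINT s=0..ereal t|lebesgue. f s) - (LINT s=0..ereal t|lebesgue. g s)\<bar>
      = \<bar>LINT s:tspan t|lebesgue. f s - g s\<bar>"
    unfolding interval_integral_tspan using I by (simp add: set_integral_diff abs_minus_commute)
  then have "ennreal \<bar>(LINT s=0..ereal t|lebesgue. f s) - (LINT s=0..ereal t|lebesgue. g s)\<bar>
      \<le> (\<integral>\<^sup>+s. ennreal (norm (indicat_real (tspan t) s *\<^sub>R (f s - g s))) \<partial>lebesgue)"
    using integral_norm_bound_ennreal[OF J] by (simp add: set_lebesgue_integral_def)
  also have "\<dots> \<le> (\<integral>\<^sup>+s. h s * indicator (tspan t) s \<partial>lebesgue)"
    using bd by (intro nn_integral_mono_AE) (auto elim!: eventually_mono simp: indicator_def)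
  finally show ?thesis by (simp add: span_integral_def nn_integral_completion)
qed

context transported_dominated_collisions
begin

text \<open>Comparison with the zero function, with g = 1, bounds the collision integral by 4 a M.
  Along a characteristic M is constant and \<open>a\<close> is integrable, so integrability holds on
  the whole time axis.\<close>

lemma collision_integral_integrable:
  assumes F: "mild_solution b UNIV F" "AE (v, x, t) in lebesgue. \<bar>F v x t\<bar> \<le> M v x t"
  shows "AE (v, x) in lebesgue. integrable lebesgue (\<lambda>s. collision_integral b F v (x + s *\<^sub>R v) s)"
proof -
  have "AE (v, x, t) in lebesgue. ennreal \<bar>collision_integral b F v x t - collision_integral b (\<lambda>v x t. 0) v x t\<bar>
           \<le> 4 * a t * 1 * ennreal (M v x t)"
  proof (rule collision_integral_difference[OF F(2) _ mild_solutionD(3)[OF F(1)]])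
    show "AE (v, x, t) in lebesgue. integrable (completion (sphere_measure \<Otimes>\<^sub>M lborel)) (collision_integrand b (\<lambda>v x t. 0) v x t)"
    proof -
      have "collision_integrand b (\<lambda>v x t. 0) v x t = (\<lambda>p. 0)" for v x t
        by (simp add: collision_integrand_def fun_eq_iff)
      then show ?thesis by simp
    qed
    show "AE (v, x, t) in lebesgue. \<bar>0\<bar> \<le> M v x t" by (auto simp: M_nonneg)
    show "AE (v, x, t) in lebesgue. ennreal \<bar>F v x t - 0\<bar> \<le> 1 * ennreal (M v x t)"
      using F(2) by eventually_elim (auto intro: ennreal_leI)
  qed
  then have bd: "AE z in lebesgue. ennreal \<bar>(\<lambda>(v, x, t). collision_integral b F v x t) z\<bar> \<le> 4 * a (snd (snd z)) * ennreal ((\<lambda>(v, x, t). M v x t) z)"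
    by eventually_elim (auto simp: collision_integral_def collision_integrand_def split_beta)
  show ?thesis
    using AE_characteristics[OF bd] measurable_characteristics[OF mild_solutionD(4)[OF F(1)]]
  proof eventually_elim
    case (elim p)
    obtain v x where p: "p = (v, x)" by (cases p)
    have "(\<integral>\<^sup>+s. ennreal (norm (collision_integral b F v (x + s *\<^sub>R v) s)) \<partial>lebesgue)
        \<le> (\<integral>\<^sup>+s. (4 * ennreal (M v x 0)) * a s \<partial>lebesgue)"
      using elim(1) by (intro nn_integral_mono_AE) (auto simp: p M_transport mult_ac elim!: eventually_mono)
    also have "\<dots> = (4 * ennreal (M v x 0)) * (\<integral>\<^sup>+s. a s \<partial>lborel)"
      unfolding nn_integral_completion by (intro nn_integral_cmult) auto
    also have "\<dots> < \<infinity>"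
      using a_integral by (simp add: ennreal_mult_less_top)
    finally show ?case
      using elim(2) by (simp add: p integrable_iff_bounded)
  qed
qed

context
  fixes F1 F2 :: "real^'n \<Rightarrow> real^'n \<Rightarrow> real \<Rightarrow> real"
  assumes F1: "mild_solution b UNIV F1" "AE (v, x, t) in lebesgue. \<bar>F1 v x t\<bar> \<le> M v x t"
    and F2: "mild_solution b UNIV F2" "AE (v, x, t) in lebesgue. \<bar>F2 v x t\<bar> \<le> M v x t"
begin

text \<open>Since M is constant along a characteristic, it factors out of the time integral of the
  collision terms and the bound reproduces itself with the same weight.\<close>

lemma mild_difference_step:
  assumes init: "AE (v, x) in lebesgue. ennreal \<bar>F1 v x 0 - F2 v x 0\<bar> \<le> \<phi> * ennreal (M v x 0)"
    and g[measurable]: "g \<in> borel_measurable borel"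
    and bd: "AE (v, x, t) in lebesgue. ennreal \<bar>F1 v x t - F2 v x t\<bar> \<le> g t * ennreal (M v x t)"
  shows "AE (v, x, t) in lebesgue. ennreal \<bar>F1 v x t - F2 v x t\<bar>
           \<le> (\<phi> + span_integral tspan (\<lambda>s. g s * (4 * a s)) t) * ennreal (M v x t)"
proof -
  let ?G = "\<lambda>t. \<phi> + span_integral tspan (\<lambda>s. g s * (4 * a s)) t"
  let ?Q = "\<lambda>v x t. ennreal \<bar>F1 v (x + t *\<^sub>R v) t - F2 v (x + t *\<^sub>R v) t\<bar> \<le> ?G t * ennreal (M v (x + t *\<^sub>R v) t)"
  have "AE z in lebesgue. ennreal \<bar>(\<lambda>(v, x, t). collision_integral b F1 v x t - collision_integral b F2 v x t) z\<bar>
      \<le> 4 * a (snd (snd z)) * g (snd (snd z)) * ennreal ((\<lambda>(v, x, t). M v x t) z)"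
    using collision_integral_difference[OF F1(2) F2(2) mild_solutionD(3)[OF F1(1)] mild_solutionD(3)[OF F2(1)] bd]
    by eventually_elim (auto simp: split_beta)
  note AE_characteristics[OF this]
  then have "AE p in lebesgue. \<forall>t. ?Q (fst p) (snd p) t"
    using init mild_solutionD(5)[OF F1(1)] mild_solutionD(5)[OF F2(1)]
      collision_integral_integrable[OF F1] collision_integral_integrable[OF F2]
  proof eventually_elim
    case (elim p)
    obtain v x where p: "p = (v, x)" by (cases p)
    let ?C1 = "\<lambda>s. collision_integral b F1 v (x + s *\<^sub>R v) s" and ?C2 = "\<lambda>s. collision_integral b F2 v (x + s *\<^sub>R v) s"
    show ?case
    proof
      fix t :: real
      have "F1 v (x + t *\<^sub>R v) t - F2 v (x + t *\<^sub>R v) t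
          = (F1 v x 0 - F2 v x 0) + ((LINT s=0..ereal t|lebesgue. ?C1 s) - (LINT s=0..ereal t|lebesgue. ?C2 s))"
        using elim(3,4)[unfolded p split, rule_format, of t 0] by (simp add: zero_ereal_def)
      then have "ennreal \<bar>F1 v (x + t *\<^sub>R v) t - F2 v (x + t *\<^sub>R v) t\<bar>
          \<le> ennreal \<bar>F1 v x 0 - F2 v x 0\<bar> + ennreal \<bar>(LINT s=0..ereal t|lebesgue. ?C1 s) - (LINT s=0..ereal t|lebesgue. ?C2 s)\<bar>"
        by (simp add: ennreal_plus[symmetric] ennreal_leI abs_triangle_ineq del: ennreal_plus)
      also have "\<dots> \<le> \<phi> * ennreal (M v x 0) + span_integral tspan (\<lambda>s. ennreal (M v x 0) * (g s * (4 * a s))) t"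
        using elim(1,2,5,6)
        by (intro add_mono interval_integral_difference_bound)
           (auto simp: p M_transport mult_ac elim!: eventually_mono)
      also have "\<dots> = ?G t * ennreal (M v (x + t *\<^sub>R v) t)"
        by (subst tspan.span_integral_cmult) (auto simp: M_transport distrib_left mult.commute)
      finally show "?Q (fst p) (snd p) t" by (simp add: p)
    qed
  qed
  \<comment> \<open>The bound holds for all t on almost every characteristic, so the exceptional set
    lies in a null set times the time axis.\<close>
  then have "AE z in lebesgue. (\<lambda>(v, x, t). ?Q v x t) (fst (fst z), snd (fst z), snd z)"
    using AE_lebesgue_fst by fastforce
  then have "AE z in lebesgue. (\<lambda>(v, x, t). ?Q v x t) z"
    by (rule AE_lebesgue_unassoc)
  from AE_shear[OF this, of "- 1"] show ?thesis
    by eventually_elim (auto simp: split_beta)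
qed

abbreviation (input) "A \<equiv> span_integral tspan (\<lambda>s. 4 * a s)"

text \<open>The \<open>n\<close>-th Picard iterate, started from the trivial bound \<open>\<bar>F1 - F2\<bar> \<le> 2 M\<close>.\<close>

lemma mild_difference_iterate:
  assumes init: "AE (v, x) in lebesgue. ennreal \<bar>F1 v x 0 - F2 v x 0\<bar> \<le> \<phi> * ennreal (M v x 0)"
  shows "AE (v, x, t) in lebesgue. ennreal \<bar>F1 v x t - F2 v x t\<bar>
     \<le> (\<phi> * (\<Sum>k<n. ennreal (inverse (fact k)) * A t ^ k) + 2 * (ennreal (inverse (fact n)) * A t ^ n)) * ennreal (M v x t)"
proof (induction n)
  case 0
  show ?case
    using F1(2) F2(2)
  proof eventually_elim
    case (elim z)
    obtain v x t where z: "z = (v, x, t)" by (cases z)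
    have "\<bar>F1 v x t - F2 v x t\<bar> \<le> 2 * M v x t" using elim by (simp add: z)
    then have "ennreal \<bar>F1 v x t - F2 v x t\<bar> \<le> ennreal (2 * M v x t)" by (rule ennreal_leI)
    then show ?case by (simp add: z ennreal_mult M_nonneg)
  qed
next
  case (Suc n)
  have e: "(\<lambda>s. 4 * a s) \<in> borel_measurable borel" by measurable
  show ?case
    unfolding tspan.span_integral_exponential_iterate[OF e, symmetric]
    by (rule mild_difference_step[OF init _ Suc.IH]) measurable
qed

text \<open>With \<open>A t\<close> at most R for all t, the n-th bound is at most r times the
  truncated series of exp R plus 2 R^n / n!. The countably many exceptional sets are united first,
  and the limit is taken pointwise.\<close>

lemma mild_difference_bound:
  assumes init: "AE (v, x) in lebesgue. \<bar>F1 v x 0 - F2 v x 0\<bar> \<le> r * M v x 0" and r: "0 \<le> r"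
  shows "AE (v, x, t) in lebesgue. \<bar>F1 v x t - F2 v x t\<bar> \<le> r * exp (4 * enn2real (\<integral>\<^sup>+s. a s \<partial>lborel)) * M v x t"
proof -
  define R where "R = 4 * enn2real (\<integral>\<^sup>+s. a s \<partial>lborel)"
  have A_le: "A t \<le> ennreal R" for t
  proof -
    have "A t \<le> (\<integral>\<^sup>+s. 4 * a s \<partial>lborel)"
      unfolding span_integral_def by (intro nn_integral_mono) (auto simp: indicator_def)
    also have "\<dots> = 4 * (\<integral>\<^sup>+s. a s \<partial>lborel)" by (intro nn_integral_cmult) simp
    also have "\<dots> = ennreal R" using a_integral by (simp add: R_def ennreal_mult)
    finally show ?thesis .
  qed
  have R: "0 \<le> R" by (simp add: R_def)
  have "AE (v, x) in lebesgue. ennreal \<bar>F1 v x 0 - F2 v x 0\<bar> \<le> ennreal r * ennreal (M v x 0)"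
    using init by eventually_elim (use r in \<open>auto simp: ennreal_mult[symmetric] M_nonneg intro: ennreal_leI\<close>)
  from mild_difference_iterate[OF this]
  have "AE z in lebesgue. \<forall>n. (\<lambda>(v, x, t). ennreal \<bar>F1 v x t - F2 v x t\<bar>
     \<le> (ennreal r * (\<Sum>k<n. ennreal (inverse (fact k)) * A t ^ k) + 2 * (ennreal (inverse (fact n)) * A t ^ n)) * ennreal (M v x t)) z"
    by (simp add: AE_all_countable)
  then show ?thesis
  proof eventually_elim
    case (elim z)
    obtain v x t where z: "z = (v, x, t)" by (cases z)
    let ?e = "\<lambda>n. r * (\<Sum>k<n. inverse (fact k) * R ^ k) + 2 * (inverse (fact n) * R ^ n)"
    have le: "\<bar>F1 v x t - F2 v x t\<bar> \<le> ?e n * M v x t" for n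
    proof -
      have "ennreal \<bar>F1 v x t - F2 v x t\<bar> \<le>
        (ennreal r * (\<Sum>k<n. ennreal (inverse (fact k)) * A t ^ k) + 2 * (ennreal (inverse (fact n)) * A t ^ n)) * ennreal (M v x t)"
        using elim by (simp add: z)
      also have "\<dots> \<le> (ennreal r * (\<Sum>k<n. ennreal (inverse (fact k)) * ennreal R ^ k) + 2 * (ennreal (inverse (fact n)) * ennreal R ^ n)) * ennreal (M v x t)"
        by (intro mult_right_mono add_mono mult_left_mono sum_mono power_mono A_le) auto
      also have "\<dots> = ennreal (?e n * M v x t)"
      proof -
        have nn: "0 \<le> r * (\<Sum>k<n. inverse (fact k) * R ^ k)" "0 \<le> 2 * (inverse (fact n) * R ^ n)"
          using r R by (auto intro!: mult_nonneg_nonneg sum_nonneg)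
        have "(\<Sum>k<n. ennreal (inverse (fact k)) * ennreal R ^ k) = ennreal (\<Sum>k<n. inverse (fact k) * R ^ k)"
          using R by (subst sum_ennreal[symmetric]) (auto simp: ennreal_power ennreal_mult)
        then show ?thesis
          using r R nn M_nonneg by (simp add: ennreal_mult ennreal_plus ennreal_power sum_nonneg)
      qed
      finally show ?thesis
        using r R M_nonneg[of v x t] by (subst (asm) ennreal_le_iff) (auto intro!: mult_nonneg_nonneg add_nonneg_nonneg sum_nonneg)
    qed
    have s: "(\<lambda>n. inverse (fact n) * R ^ n) sums exp R"
      using exp_converges[of R] by simp
    have "?e \<longlonglongrightarrow> r * exp R + 2 * 0"
      using s summable_LIMSEQ_zero[OF sums_summable[OF s]] unfolding sums_def
      by (intro tendsto_intros)
    then have "(\<lambda>n. ?e n * M v x t) \<longlonglongrightarrow> r * exp R * M v x t"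
      by (intro tendsto_mult) auto
    from LIMSEQ_le_const[OF this] show ?case
      using le by (auto simp: z R_def)
  qed
qed

end

end

section \<open>A Borel version of the angular kernel\<close>

text \<open>After rotating n to a coordinate axis the indicator becomes a product over the
  coordinates with a single nontrivial factor.\<close>

lemma null_sets_inner_vimage:
  fixes n :: "real^'n"
  assumes N: "N \<in> null_sets lborel" and n: "norm n = 1"
  shows "{u. u \<bullet> n \<in> N} \<in> null_sets lborel"
proof -
  have Nb[measurable]: "N \<in> sets borel" using N by auto
  obtain i :: "real^'n" where i: "i \<in> Basis" using nonempty_Basis by blast
  obtain T where T: "orthogonal_transformation T" "T n = i"
    using n i by (metis orthogonal_transformation_exists norm_Basis)
  have "(\<integral>\<^sup>+u. indicator {u. u \<bullet> n \<in> N} u \<partial>lborel) = (\<integral>\<^sup>+u. indicator {u. u \<bullet> i \<in> N} (T u) \<partial>lborel)"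
    using T by (intro nn_integral_cong) (auto simp: indicator_def orthogonal_transformation_def)
  also have "\<dots> = (\<integral>\<^sup>+u. indicator {u. u \<bullet> i \<in> N} u \<partial>lborel)"
    by (rule nn_integral_lborel_orthogonal[OF T(1)]) measurable
  also have "\<dots> = (\<integral>\<^sup>+u. (\<Prod>j\<in>Basis. (if j = i then indicator N else (\<lambda>_. 1)) (u \<bullet> j)) \<partial>lborel)"
  proof (rule nn_integral_cong)
    fix u :: "real^'n"
    have "(\<Prod>j\<in>Basis. (if j = i then indicator N else (\<lambda>_. 1)) (u \<bullet> j)) = (\<Prod>j\<in>Basis. if j = i then indicator N (u \<bullet> i) else (1::ennreal))"
      by (intro prod.cong) auto
    then show "indicator {u. u \<bullet> i \<in> N} u = (\<Prod>j\<in>Basis. (if j = i then indicator N else (\<lambda>_. 1 :: ennreal)) (u \<bullet> j))"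
      using i by (simp add: prod.delta indicator_def)
  qed
  also have "\<dots> = (\<Prod>j\<in>(Basis :: (real^'n) set). \<integral>\<^sup>+s. (if j = i then indicator N else (\<lambda>_. 1)) s \<partial>lborel)"
    by (rule nn_integral_lborel_prod) auto
  \<comment> \<open>The other factors integrate to infinity, but zero times infinity is zero in
    \<open>ennreal\<close>.\<close>
  also have "\<dots> = 0"
    using i N by (auto intro!: prod_zero bexI[of _ i] simp: nn_integral_indicator)
  finally have "emeasure lborel {u. u \<bullet> n \<in> N} = 0"
    by (simp add: nn_integral_indicator)
  then show ?thesis by (intro null_setsI) auto
qed

text \<open>Off the axis \<open>\<real> n\<close>, the set in question is the image of \<open>{u. u \<bullet> n \<in> N}\<close> under the differentiable
  map that keeps the component orthogonal to \<open>n\<close> and turns the cosine \<open>u \<bullet> n\<close> into a length.\<close>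

lemma negligible_cosine_vimage:
  fixes n :: "real^'n"
  assumes N: "N \<in> null_sets lborel" and n: "norm n = 1" and D: "2 \<le> CARD('n)"
  shows "negligible {z. (z /\<^sub>R norm z) \<bullet> n \<in> N}"
proof -
  define y where "y = (\<lambda>u. u - (u \<bullet> n) *\<^sub>R n)"
  define G where "G = (\<lambda>u. y u + (sqrt ((y u \<bullet> y u) / (1 - (u \<bullet> n)\<^sup>2)) * (u \<bullet> n)) *\<^sub>R n)"
  define U where "U = {u. u \<bullet> n \<in> N \<and> \<bar>u \<bullet> n\<bar> < 1 \<and> y u \<noteq> 0}"
  have nn: "n \<bullet> n = 1" using n by (simp add: norm_eq_1)
  have "negligible U"
    using null_sets_inner_vimage[OF N n]
    by (intro negligible_subset[of "{u. u \<bullet> n \<in> N}" U]) (auto simp: U_def negligible_iff_null_sets null_sets_completionI)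
  moreover have "G differentiable_on U"
  proof -
    have "G differentiable at u" if "u \<in> U" for u
    proof -
      have 1: "0 < y u \<bullet> y u" using that by (simp add: U_def)
      have 2: "0 < 1 - (u \<bullet> n)\<^sup>2" using that by (simp add: U_def abs_square_less_1)
      have "0 < (y u \<bullet> y u) / (1 - (u \<bullet> n)\<^sup>2)" using 1 2 by simp
      then show ?thesis
        unfolding G_def y_def
        by (intro differentiableI) (rule derivative_eq_intros refl | use 2 in simp)+
    qed
    then show ?thesis by (simp add: differentiable_on_def differentiable_at_withinI)
  qed
  ultimately have "negligible (G ` U)"
    by (intro negligible_differentiable_image_negligible) auto
  \<comment> \<open>D \<ge> 2 enters here: a line must be a null set.\<close>
  moreover have "negligible (span {n})"
    using D by (intro negligible_lowdim) (auto intro: le_less_trans[OF dim_le_card'[of "{n}"]])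
  moreover have "{z. (z /\<^sub>R norm z) \<bullet> n \<in> N} \<subseteq> G ` U \<union> span {n}"
  proof
    fix z assume z: "z \<in> {z. (z /\<^sub>R norm z) \<bullet> n \<in> N}"
    show "z \<in> G ` U \<union> span {n}"
    proof (cases "y z = 0")
      case True
      then have "z = (z \<bullet> n) *\<^sub>R n" by (simp add: y_def)
      then show ?thesis by (metis UnI2 span_base span_scale singletonI)
    next
      case False
      then have z0: "z \<noteq> 0" by (auto simp: y_def)
      define c where "c = (z \<bullet> n) / norm z"
      \<comment> \<open>u keeps the part of z orthogonal to n and has the cosine c as its component
        along n. The length of z is recovered from |y z|^2 = |z|^2 (1 - c^2), which is the square
        root in G; hence \<open>G u = z\<close>.\<close>
      define u where "u = y z + c *\<^sub>R n"
      have yn: "y z \<bullet> n = 0" by (simp add: y_def inner_diff_left nn)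
      have un: "u \<bullet> n = c" by (simp add: u_def inner_add_left yn nn)
      have yu: "y u = y z"
      proof -
        have "y u = u - (u \<bullet> n) *\<^sub>R n" by (simp add: y_def)
        then show ?thesis unfolding un by (simp add: u_def)
      qed
      have yy: "y z \<bullet> y z = (norm z)\<^sup>2 * (1 - c\<^sup>2)"
      proof -
        have "y z \<bullet> y z = y z \<bullet> (z - (z \<bullet> n) *\<^sub>R n)" by (simp add: y_def)
        also have "\<dots> = y z \<bullet> z" by (simp add: inner_diff_right yn)
        also have "\<dots> = (norm z)\<^sup>2 - (z \<bullet> n)\<^sup>2"
          by (simp add: y_def inner_diff_left power2_norm_eq_inner inner_commute[of n] power2_eq_square[of "z \<bullet> n"])
        finally show ?thesis using z0 by (simp add: c_def power_divide right_diff_distrib)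
      qed
      have c1: "c\<^sup>2 < 1"
      proof -
        have "0 < (norm z)\<^sup>2 * (1 - c\<^sup>2)" using False yy by (metis inner_gt_zero_iff)
        then show ?thesis using z0 by (simp add: zero_less_mult_iff)
      qed
      have "sqrt ((y u \<bullet> y u) / (1 - (u \<bullet> n)\<^sup>2)) = norm z"
        using c1 by (simp add: yu un yy)
      then have "G u = y z + (norm z * c) *\<^sub>R n"
        unfolding G_def by (simp only: yu un)
      also have "norm z * c = z \<bullet> n" using z0 by (simp add: c_def)
      finally have "G u = z" by (simp add: y_def)
      moreover have "u \<in> U"
        using z c1 False by (auto simp: U_def un yu c_def abs_square_less_1 divide_inverse mult.commute)
      ultimately show ?thesis by blast
    qed
  qed
  ultimately show ?thesis by (meson negligible_Un negligible_subset)
qed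

text \<open>The set of directions is measured by its cone, which is null by the preceding lemma. In
  dimension one this fails, as the cosines 1 and -1 are atoms.\<close>

lemma AE_sphere_measure_cosine:
  fixes n :: "real^'n"
  assumes N: "N \<in> null_sets lborel" and n: "norm n = 1" and D: "2 \<le> CARD('n)"
  shows "AE \<omega> in sphere_measure. \<omega> \<bullet> n \<notin> N"
proof -
  have [measurable]: "N \<in> sets borel" using N by auto
  have m: "{\<omega> \<in> sphere 0 1. \<omega> \<bullet> n \<in> N} \<in> sets (restrict_space borel (sphere 0 1))"
    by (auto simp: sets_restrict_space_iff intro!: sets.Int)
  have "emeasure sphere_measure {\<omega> \<in> sphere 0 1. \<omega> \<bullet> n \<in> N}
      = of_nat DIM(real^'n) * emeasure lborel {x \<in> ball 0 1 - {0}. x /\<^sub>R norm x \<in> {\<omega> \<in> sphere 0 1. \<omega> \<bullet> n \<in> N}}"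
    by (rule emeasure_sphere_measure[OF m])
  also have "{x \<in> ball 0 1 - {0}. x /\<^sub>R norm x \<in> {\<omega> \<in> sphere 0 1. \<omega> \<bullet> n \<in> N}} = {x \<in> ball 0 1 - {0}. (x /\<^sub>R norm x) \<bullet> n \<in> N}"
    by auto
  also have "emeasure lborel \<dots> = 0"
  proof -
    have "{x \<in> ball 0 1 - {0}. (x /\<^sub>R norm x) \<bullet> n \<in> N} \<in> sets borel" by measurable
    moreover have "negligible {x \<in> ball 0 1 - {0}. (x /\<^sub>R norm x) \<bullet> n \<in> N}"
      by (rule negligible_subset[OF negligible_cosine_vimage[OF N n D]]) auto
    ultimately show ?thesis
      by (auto simp: negligible_iff_null_sets null_sets_completion_iff)
  qed
  finally have "{\<omega> \<in> sphere 0 1. \<omega> \<bullet> n \<in> N} \<in> null_sets sphere_measure"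
    using m by (intro null_setsI) (simp_all add: sets_sphere_measure)
  then show ?thesis
    by (rule AE_I') (auto simp: space_sphere_measure)
qed

text \<open>A Borel function that agrees with \<open>bhat\<close> off a null set of cosines cannot
  be distinguished from it by the surface measure, whatever the axis n. It makes the kernel jointly
  measurable in all velocities.\<close>

lemma separated_form_borel_version:
  fixes b :: "real^'n \<Rightarrow> real^'n \<Rightarrow> real"
  assumes sep: "separated_form \<beta> bhat b" and D: "2 \<le> CARD('n)"
  obtains h :: "real \<Rightarrow> ennreal" where "h \<in> borel_measurable borel"
    "\<And>n :: real^'n. norm n = 1 \<Longrightarrow> AE \<omega> in sphere_measure. ennreal (bhat (\<omega> \<bullet> n)) = h (\<omega> \<bullet> n)"
    "\<And>n :: real^'n. norm n = 1 \<Longrightarrow> (\<integral>\<^sup>+\<omega>. h (\<omega> \<bullet> n) \<partial>sphere_measure) = ennreal (total_angular_mass bhat TYPE('n))"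
proof -
  have "(\<lambda>s. if s \<in> {-1..1} then bhat s else 0) \<in> borel_measurable lebesgue"
    using sep by (subst borel_measurable_if) (auto simp: separated_form_def)
  then obtain g where g[measurable]: "g \<in> borel_measurable borel"
    and "AE s in lborel. (if s \<in> {-1..1} then bhat s else 0) = g s"
    using completion_ex_borel_measurable_real by fastforce
  then obtain N where N: "N \<in> null_sets lborel" "{s. \<not> (if s \<in> {-1..1} then bhat s else 0) = g s} \<subseteq> N"
    unfolding eventually_ae_filter by auto
  have AE: "AE \<omega> in sphere_measure. ennreal (bhat (\<omega> \<bullet> n)) = ennreal (g (\<omega> \<bullet> n))" if n: "norm n = 1" for n :: "real^'n"
    using AE_sphere_measure_cosine[OF N(1) n D] AE_space
  proof eventually_elim
    case (elim \<omega>)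
    have "\<omega> \<bullet> n \<in> {-1..1}"
      using Cauchy_Schwarz_ineq2[of \<omega> n] n elim(2) by (auto simp: space_sphere_measure abs_le_iff)
    then have "bhat (\<omega> \<bullet> n) = g (\<omega> \<bullet> n)" using N(2) elim(1) by force
    then show ?case by simp
  qed
  show ?thesis
  proof (rule that[of "\<lambda>s. ennreal (g s)"])
    show "(\<integral>\<^sup>+\<omega>. ennreal (g (\<omega> \<bullet> n)) \<partial>sphere_measure) = ennreal (total_angular_mass bhat TYPE('n))"
      if n: "norm n = 1" for n :: "real^'n"
      using nn_integral_cong_AE[OF AE[OF n]] nn_integral_angular[OF sep n] by simp
  qed (use AE in auto)
qed

section \<open>Gain and loss in \<open>L\<^sup>1\<close>\<close>

text \<open>On pairs of velocities the collision is the reflection in the hyperplane orthogonal to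
  (\<omega>, -\<omega>).\<close>

lemma orthogonal_transformation_collision:
  fixes \<omega> :: "real^'n"
  assumes "norm \<omega> = 1"
  shows "orthogonal_transformation (\<lambda>p. (collide (fst p) (snd p) \<omega>, collide_star (fst p) (snd p) \<omega>))"
  unfolding orthogonal_transformation_def
proof (intro conjI allI)
  show "linear (\<lambda>p. (collide (fst p) (snd p) \<omega>, collide_star (fst p) (snd p) \<omega>))"
    by (intro linearI) (simp_all add: collide_def collide_star_def algebra_simps)
  have \<omega>: "\<omega> \<bullet> \<omega> = 1" using assms by (simp add: norm_eq_1)
  fix p q :: "(real^'n) \<times> (real^'n)"
  obtain v w where p: "p = (v, w)" by (cases p)
  obtain v' w' where q: "q = (v', w')" by (cases q)
  have "(v - c *\<^sub>R \<omega>) \<bullet> (v' - d *\<^sub>R \<omega>) + (w + c *\<^sub>R \<omega>) \<bullet> (w' + d *\<^sub>R \<omega>)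
      = v \<bullet> v' + w \<bullet> w' - d * ((v - w) \<bullet> \<omega>) - c * ((v' - w') \<bullet> \<omega>) + (c * d + c * d) * (\<omega> \<bullet> \<omega>)" for c d
    by (simp only: inner_diff_left inner_diff_right inner_add_left inner_add_right inner_scaleR_left inner_scaleR_right
          inner_commute[of \<omega> v'] inner_commute[of \<omega> w']) algebra
  from this[of "(v - w) \<bullet> \<omega>" "(v' - w') \<bullet> \<omega>"]
  show "(collide (fst p) (snd p) \<omega>, collide_star (fst p) (snd p) \<omega>) \<bullet> (collide (fst q) (snd q) \<omega>, collide_star (fst q) (snd q) \<omega>) = p \<bullet> q"
    by (simp add: p q collide_def collide_star_def \<omega>)
qed

text \<open>The relative velocity is reflected in the hyperplane orthogonal to \<omega>, since the
  collision subtracts twice its \<omega>-component.\<close>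

lemma relative_velocity_collision:
  assumes "norm \<omega> = 1"
  shows "norm (collide v w \<omega> - collide_star v w \<omega>) = norm (v - w)"
    and "\<omega> \<bullet> (collide v w \<omega> - collide_star v w \<omega>) = - (\<omega> \<bullet> (v - w))"
proof -
  have \<omega>: "\<omega> \<bullet> \<omega> = 1" using assms by (simp add: norm_eq_1)
  define c where "c = (v - w) \<bullet> \<omega>"
  have d: "collide v w \<omega> - collide_star v w \<omega> = (v - w) - (c + c) *\<^sub>R \<omega>"
    by (simp only: collide_def collide_star_def c_def[symmetric] scaleR_add_left) (simp add: algebra_simps)
  have "((v - w) - (c + c) *\<^sub>R \<omega>) \<bullet> ((v - w) - (c + c) *\<^sub>R \<omega>)
      = (v - w) \<bullet> (v - w) - 2 * (c + c) * ((v - w) \<bullet> \<omega>) + (c + c) * (c + c) * (\<omega> \<bullet> \<omega>)"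
    by (simp only: inner_diff_left[of "v - w"] inner_diff_right[of _ "v - w"] inner_scaleR_left inner_scaleR_right inner_commute[of \<omega> "v - w"])
      (simp add: algebra_simps)
  then show "norm (collide v w \<omega> - collide_star v w \<omega>) = norm (v - w)"
    unfolding d norm_eq by (simp add: \<omega> c_def[symmetric])
  show "\<omega> \<bullet> (collide v w \<omega> - collide_star v w \<omega>) = - (\<omega> \<bullet> (v - w))"
    unfolding d by (simp only: inner_diff_right[of _ "v - w"] inner_scaleR_right \<omega>) (simp add: c_def inner_commute)
qed

text \<open>The surface measure seen on the whole space: its measurable sets are the Borel sets, so
  products with \<open>lborel\<close> need no restriction to the sphere.\<close>

definition borel_sphere_measure :: "'a::euclidean_space measure" where
  "borel_sphere_measure = distr sphere_measure borel (\<lambda>x. x)"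

lemma sets_borel_sphere_measure[measurable_cong, simp]: "sets borel_sphere_measure = sets borel"
  by (simp add: borel_sphere_measure_def)

interpretation borel_sphere_measure: finite_measure "borel_sphere_measure :: 'a::euclidean_space measure"
  unfolding borel_sphere_measure_def
  by (rule sphere_measure.finite_measure_distr[OF measurable_id_sphere_measure])

interpretation borel_sphere_lborel: pair_sigma_finite "borel_sphere_measure :: 'a::euclidean_space measure" "lborel :: 'b::euclidean_space measure" ..

lemma nn_integral_borel_sphere_measure:
  "f \<in> borel_measurable borel \<Longrightarrow> (\<integral>\<^sup>+\<omega>. f \<omega> \<partial>borel_sphere_measure) = (\<integral>\<^sup>+\<omega>. f \<omega> \<partial>sphere_measure)"
  unfolding borel_sphere_measure_def by (subst nn_integral_distr[OF measurable_id_sphere_measure]) auto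

lemma AE_borel_sphere_measure: "AE \<omega> in borel_sphere_measure. norm \<omega> = 1"
  unfolding borel_sphere_measure_def
  by (subst AE_distr_iff) (auto simp: measurable_id_sphere_measure space_sphere_measure)

lemma nn_integral_sphere_lborel:
  fixes f :: "'a::euclidean_space \<times> 'b::euclidean_space \<Rightarrow> ennreal"
  assumes f[measurable]: "f \<in> borel_measurable borel"
  shows "(\<integral>\<^sup>+p. f p \<partial>(sphere_measure \<Otimes>\<^sub>M lborel)) = (\<integral>\<^sup>+w. \<integral>\<^sup>+\<omega>. f (\<omega>, w) \<partial>borel_sphere_measure \<partial>lborel)"
proof -
  have "(\<lambda>p. (fst p, snd p)) \<in> sphere_measure \<Otimes>\<^sub>M lborel \<rightarrow>\<^sub>M borel"
    by (rule borel_measurable_Pair[OF measurable_compose[OF measurable_fst measurable_id_sphere_measure]]) simp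
  from measurable_compose[OF this f]
  have "f \<in> borel_measurable (sphere_measure \<Otimes>\<^sub>M lborel)" by simp
  then have "(\<integral>\<^sup>+p. f p \<partial>(sphere_measure \<Otimes>\<^sub>M lborel)) = (\<integral>\<^sup>+w. \<integral>\<^sup>+\<omega>. f (\<omega>, w) \<partial>sphere_measure \<partial>lborel)"
    by (rule sphere_lborel.nn_integral_snd[symmetric])
  also have "\<dots> = (\<integral>\<^sup>+w. \<integral>\<^sup>+\<omega>. f (\<omega>, w) \<partial>borel_sphere_measure \<partial>lborel)"
    by (intro nn_integral_cong nn_integral_borel_sphere_measure[symmetric]) measurable
  finally show ?thesis .
qed

text \<open>The kernel b with \<open>bhat\<close> replaced by its Borel version h, in
  \<open>ennreal\<close> because it occurs only under Tonelli.\<close>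

definition borel_kernel :: "real \<Rightarrow> (real \<Rightarrow> ennreal) \<Rightarrow> real^'n \<Rightarrow> real^'n \<Rightarrow> ennreal" where
  "borel_kernel \<beta> h z \<omega> = ennreal (norm z powr \<beta>) * h (\<omega> \<bullet> (z /\<^sub>R norm z))"

lemma borel_measurable_borel_kernel[measurable (raw)]:
  assumes [measurable]: "h \<in> borel_measurable borel" "f \<in> borel_measurable M" "g \<in> borel_measurable M"
  shows "(\<lambda>x. borel_kernel \<beta> h (f x) (g x)) \<in> borel_measurable M"
  unfolding borel_kernel_def by measurable

lemma borel_measurable_collide[measurable (raw)]:
  assumes [measurable]: "f \<in> borel_measurable M" "g \<in> borel_measurable M" "k \<in> borel_measurable M"
  shows "(\<lambda>x. collide (f x) (g x) (k x)) \<in> borel_measurable M" "(\<lambda>x. collide_star (f x) (g x) (k x)) \<in> borel_measurable M"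
  unfolding collide_def collide_star_def by measurable

text \<open>The gain and the loss term have the same mass, because the collision map is orthogonal on
  \<open>\<real>\<^sup>D \<times> \<real>\<^sup>D\<close> for every \<open>\<omega>\<close>; it reverses \<open>\<omega> \<bullet> (v - w)\<close>, which does not change the angular mass.\<close>

lemma nn_integral_gain_loss:
  fixes \<Phi> :: "real^'n \<Rightarrow> ennreal"
  assumes [measurable]: "\<Phi> \<in> borel_measurable borel" "h \<in> borel_measurable borel"
    and C: "\<And>n :: real^'n. norm n = 1 \<Longrightarrow> (\<integral>\<^sup>+\<omega>. h (\<omega> \<bullet> n) \<partial>sphere_measure) = C"
  shows "(\<integral>\<^sup>+v. \<integral>\<^sup>+p. (\<Phi> (collide v (snd p) (fst p)) * \<Phi> (collide_star v (snd p) (fst p)) + \<Phi> v * \<Phi> (snd p))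
      * borel_kernel \<beta> h (v - snd p) (fst p) \<partial>(sphere_measure \<Otimes>\<^sub>M lborel) \<partial>lborel)
    = 2 * (\<integral>\<^sup>+v. \<Phi> v * (C * (\<integral>\<^sup>+w. \<Phi> w * ennreal (norm (v - w) powr \<beta>) \<partial>lborel)) \<partial>lborel)"
proof -
  let ?k = "borel_kernel \<beta> h" and ?\<sigma> = "borel_sphere_measure :: (real^'n) measure"
  let ?I = "\<integral>\<^sup>+v. \<Phi> v * (C * (\<integral>\<^sup>+w. \<Phi> w * ennreal (norm (v - w) powr \<beta>) \<partial>lborel)) \<partial>lborel"
  \<comment> \<open>The sign s is 1 for the loss term and -1 for the gain term after the collision
    substitution. At z = 0 both sides vanish because \<open>0 powr \<beta> = 0\<close>.\<close>
  have angular: "(\<integral>\<^sup>+\<omega>. ennreal (norm z powr \<beta>) * h (\<omega> \<bullet> (s *\<^sub>R (z /\<^sub>R norm z))) \<partial>?\<sigma>) = ennreal (norm z powr \<beta>) * C"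
    if "\<bar>s\<bar> = 1" for z s
  proof (cases "z = 0")
    case False
    then have "norm (s *\<^sub>R (z /\<^sub>R norm z)) = 1" using that by (simp add: abs_mult)
    from C[OF this] show ?thesis
      by (simp add: nn_integral_cmult nn_integral_borel_sphere_measure)
  qed simp
  have mass: "(\<integral>\<^sup>+v. \<integral>\<^sup>+w. \<integral>\<^sup>+\<omega>. \<Phi> v * \<Phi> w * (ennreal (norm (v - w) powr \<beta>) * h (\<omega> \<bullet> (s *\<^sub>R ((v - w) /\<^sub>R norm (v - w))))) \<partial>?\<sigma> \<partial>lborel \<partial>lborel) = ?I"
    if s: "\<bar>s\<bar> = 1" for s
  proof (rule nn_integral_cong)
    fix v :: "real^'n"
    have "(\<integral>\<^sup>+w. \<integral>\<^sup>+\<omega>. \<Phi> v * \<Phi> w * (ennreal (norm (v - w) powr \<beta>) * h (\<omega> \<bullet> (s *\<^sub>R ((v - w) /\<^sub>R norm (v - w))))) \<partial>?\<sigma> \<partial>lborel)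
        = (\<integral>\<^sup>+w. \<Phi> v * \<Phi> w * (ennreal (norm (v - w) powr \<beta>) * C) \<partial>lborel)"
      by (intro nn_integral_cong) (subst nn_integral_cmult, measurable, simp only: angular[OF s])
    also have "\<dots> = (\<integral>\<^sup>+w. \<Phi> v * C * (\<Phi> w * ennreal (norm (v - w) powr \<beta>)) \<partial>lborel)"
      by (simp add: mult_ac)
    also have "\<dots> = \<Phi> v * C * (\<integral>\<^sup>+w. \<Phi> w * ennreal (norm (v - w) powr \<beta>) \<partial>lborel)"
      by (intro nn_integral_cmult) measurable
    finally show "(\<integral>\<^sup>+w. \<integral>\<^sup>+\<omega>. \<Phi> v * \<Phi> w * (ennreal (norm (v - w) powr \<beta>) * h (\<omega> \<bullet> (s *\<^sub>R ((v - w) /\<^sub>R norm (v - w))))) \<partial>?\<sigma> \<partial>lborel)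
        = \<Phi> v * (C * (\<integral>\<^sup>+w. \<Phi> w * ennreal (norm (v - w) powr \<beta>) \<partial>lborel))"
      by (simp add: mult.assoc)
  qed
  \<comment> \<open>Brings \<omega> to the outside, so that the collision map can act on (v, w) with
    \<omega> frozen.\<close>
  have swap: "(\<integral>\<^sup>+v. \<integral>\<^sup>+w. \<integral>\<^sup>+\<omega>. f \<omega> (v, w) \<partial>?\<sigma> \<partial>lborel \<partial>lborel) = (\<integral>\<^sup>+\<omega>. \<integral>\<^sup>+y. f \<omega> y \<partial>lborel \<partial>?\<sigma>)"
    if f[measurable]: "(\<lambda>(\<omega>, y). f \<omega> y) \<in> borel_measurable borel" for f :: "real^'n \<Rightarrow> (real^'n) \<times> (real^'n) \<Rightarrow> ennreal"
  proof -
    have [measurable]: "(\<lambda>p. f (fst p) (snd p)) \<in> borel_measurable (?\<sigma> \<Otimes>\<^sub>M lborel)"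
      "(\<lambda>y. \<integral>\<^sup>+\<omega>. f \<omega> y \<partial>?\<sigma>) \<in> borel_measurable borel"
    proof -
      have "(\<lambda>p. (\<lambda>(\<omega>, y). f \<omega> y) (fst p, snd p)) \<in> borel_measurable (?\<sigma> \<Otimes>\<^sub>M lborel)" by measurable
      then show 1: "(\<lambda>p. f (fst p) (snd p)) \<in> borel_measurable (?\<sigma> \<Otimes>\<^sub>M lborel)" by simp
      have "(\<lambda>p. (\<lambda>(\<omega>, y). f \<omega> y) (snd p, fst p)) \<in> borel_measurable (lborel \<Otimes>\<^sub>M ?\<sigma>)" by measurable
      then show "(\<lambda>y. \<integral>\<^sup>+\<omega>. f \<omega> y \<partial>?\<sigma>) \<in> borel_measurable borel"
        using borel_sphere_measure.borel_measurable_nn_integral[of "\<lambda>y \<omega>. f \<omega> y" lborel] by (simp add: split_beta)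
    qed
    have "(\<integral>\<^sup>+v. \<integral>\<^sup>+w. \<integral>\<^sup>+\<omega>. f \<omega> (v, w) \<partial>?\<sigma> \<partial>lborel \<partial>lborel) = (\<integral>\<^sup>+y. \<integral>\<^sup>+\<omega>. f \<omega> y \<partial>?\<sigma> \<partial>(lborel \<Otimes>\<^sub>M lborel))"
      by (rule lborel.nn_integral_fst) (simp add: lborel_prod)
    also have "\<dots> = (\<integral>\<^sup>+y. \<integral>\<^sup>+\<omega>. f \<omega> y \<partial>?\<sigma> \<partial>lborel)" by (simp only: lborel_prod)
    also have "\<dots> = (\<integral>\<^sup>+\<omega>. \<integral>\<^sup>+y. f \<omega> y \<partial>lborel \<partial>?\<sigma>)"
      by (rule borel_sphere_lborel.Fubini') (simp add: split_beta)
    finally show ?thesis .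
  qed
  have loss: "(\<integral>\<^sup>+v. \<integral>\<^sup>+w. \<integral>\<^sup>+\<omega>. \<Phi> v * \<Phi> w * ?k (v - w) \<omega> \<partial>?\<sigma> \<partial>lborel \<partial>lborel) = ?I"
    using mass[of 1] by (simp add: borel_kernel_def)
  have gain: "(\<integral>\<^sup>+v. \<integral>\<^sup>+w. \<integral>\<^sup>+\<omega>. \<Phi> (collide v w \<omega>) * \<Phi> (collide_star v w \<omega>) * ?k (v - w) \<omega> \<partial>?\<sigma> \<partial>lborel \<partial>lborel) = ?I"
  proof -
    \<comment> \<open>The loss integrand with the angle reversed. A collision preserves the relative
      speed and reverses its \<omega>-component, so composing this with the collision map
      \<open>?T\<close> gives the gain integrand.\<close>
    let ?g = "\<lambda>\<omega> y. \<Phi> (fst y) * \<Phi> (snd y) * (ennreal (norm (fst y - snd y) powr \<beta>) * h (\<omega> \<bullet> (- 1 *\<^sub>R ((fst y - snd y) /\<^sub>R norm (fst y - snd y)))))"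
    let ?T = "\<lambda>\<omega> y. (collide (fst y) (snd y) \<omega>, collide_star (fst y) (snd y) \<omega>)"
    have "(\<integral>\<^sup>+v. \<integral>\<^sup>+w. \<integral>\<^sup>+\<omega>. \<Phi> (collide v w \<omega>) * \<Phi> (collide_star v w \<omega>) * ?k (v - w) \<omega> \<partial>?\<sigma> \<partial>lborel \<partial>lborel)
        = (\<integral>\<^sup>+\<omega>. \<integral>\<^sup>+y. \<Phi> (collide (fst y) (snd y) \<omega>) * \<Phi> (collide_star (fst y) (snd y) \<omega>) * ?k (fst y - snd y) \<omega> \<partial>lborel \<partial>?\<sigma>)"
      by (subst swap[symmetric], unfold split_beta borel_prod[symmetric]) measurable
    also have "\<dots> = (\<integral>\<^sup>+\<omega>. \<integral>\<^sup>+y. ?g \<omega> (?T \<omega> y) \<partial>lborel \<partial>?\<sigma>)"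
    proof (rule nn_integral_cong_AE)
      show "AE \<omega> in ?\<sigma>. (\<integral>\<^sup>+y. \<Phi> (collide (fst y) (snd y) \<omega>) * \<Phi> (collide_star (fst y) (snd y) \<omega>) * ?k (fst y - snd y) \<omega> \<partial>lborel)
          = (\<integral>\<^sup>+y. ?g \<omega> (?T \<omega> y) \<partial>lborel)"
        using AE_borel_sphere_measure
      proof eventually_elim
        case (elim \<omega>)
        then show ?case
          by (intro nn_integral_cong)
             (simp add: borel_kernel_def relative_velocity_collision[OF elim] del: inner_diff_right)
      qed
    qed
    also have "\<dots> = (\<integral>\<^sup>+\<omega>. \<integral>\<^sup>+y. ?g \<omega> y \<partial>lborel \<partial>?\<sigma>)"
    proof (rule nn_integral_cong_AE)
      show "AE \<omega> in ?\<sigma>. (\<integral>\<^sup>+y. ?g \<omega> (?T \<omega> y) \<partial>lborel) = (\<integral>\<^sup>+y. ?g \<omega> y \<partial>lborel)"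
        using AE_borel_sphere_measure
      proof eventually_elim
        case (elim \<omega>)
        have "?g \<omega> \<in> borel_measurable borel" unfolding borel_prod[symmetric] by measurable
        then show ?case by (rule nn_integral_lborel_orthogonal[OF orthogonal_transformation_collision[OF elim]])
      qed
    qed
    also have "\<dots> = (\<integral>\<^sup>+v. \<integral>\<^sup>+w. \<integral>\<^sup>+\<omega>. ?g \<omega> (v, w) \<partial>?\<sigma> \<partial>lborel \<partial>lborel)"
      by (subst swap, unfold split_beta borel_prod[symmetric]) measurable
    also have "\<dots> = ?I" using mass[of "- 1"] by simp
    finally show ?thesis .
  qed
  have "(\<integral>\<^sup>+v. \<integral>\<^sup>+p. (\<Phi> (collide v (snd p) (fst p)) * \<Phi> (collide_star v (snd p) (fst p)) + \<Phi> v * \<Phi> (snd p))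
      * ?k (v - snd p) (fst p) \<partial>(sphere_measure \<Otimes>\<^sub>M lborel) \<partial>lborel)
    = (\<integral>\<^sup>+v. \<integral>\<^sup>+w. \<integral>\<^sup>+\<omega>. \<Phi> (collide v w \<omega>) * \<Phi> (collide_star v w \<omega>) * ?k (v - w) \<omega> + \<Phi> v * \<Phi> w * ?k (v - w) \<omega> \<partial>?\<sigma> \<partial>lborel \<partial>lborel)"
    by (intro nn_integral_cong, subst nn_integral_sphere_lborel, unfold borel_prod[symmetric], measurable) (simp add: distrib_right)
  also have "\<dots> = (\<integral>\<^sup>+v. \<integral>\<^sup>+w. (\<integral>\<^sup>+\<omega>. \<Phi> (collide v w \<omega>) * \<Phi> (collide_star v w \<omega>) * ?k (v - w) \<omega> \<partial>?\<sigma>) + (\<integral>\<^sup>+\<omega>. \<Phi> v * \<Phi> w * ?k (v - w) \<omega> \<partial>?\<sigma>) \<partial>lborel \<partial>lborel)"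
    by (intro nn_integral_cong nn_integral_add) measurable
  also have "\<dots> = (\<integral>\<^sup>+v. (\<integral>\<^sup>+w. \<integral>\<^sup>+\<omega>. \<Phi> (collide v w \<omega>) * \<Phi> (collide_star v w \<omega>) * ?k (v - w) \<omega> \<partial>?\<sigma> \<partial>lborel) + (\<integral>\<^sup>+w. \<integral>\<^sup>+\<omega>. \<Phi> v * \<Phi> w * ?k (v - w) \<omega> \<partial>?\<sigma> \<partial>lborel) \<partial>lborel)"
    by (intro nn_integral_cong nn_integral_add) measurable
  also have "\<dots> = ?I + ?I"
    unfolding gain[symmetric] by (subst nn_integral_add) (measurable, simp add: gain loss)
  finally show ?thesis by (simp add: mult_2)
qed

lemma nn_integral_lborel_pair:
  fixes f :: "'a::euclidean_space \<times> 'b::euclidean_space \<Rightarrow> ennreal"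
  assumes "f \<in> borel_measurable borel"
  shows "(\<integral>\<^sup>+z. f z \<partial>lborel) = (\<integral>\<^sup>+x. \<integral>\<^sup>+y. f (x, y) \<partial>lborel \<partial>lborel)"
proof -
  have "f \<in> borel_measurable (lborel \<Otimes>\<^sub>M lborel)" unfolding lborel_prod using assms by simp
  from lborel.nn_integral_fst[OF this] show ?thesis by (simp only: lborel_prod)
qed

lemma AE_lebesgue_rev:
  fixes P :: "'a::euclidean_space \<times> 'b::euclidean_space \<times> real \<Rightarrow> bool"
  assumes "AE z in lebesgue. P z"
  shows "AE t in lborel. AE x in lborel. AE v in lborel. P (v, x, t)"
    and "AE t in lborel. AE v in lborel. AE x in lborel. P (v, x, t)"
proof -
  have "AE y in lebesgue. P (snd (snd y), fst (snd y), fst y)"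
    by (rule AE_lebesgue_compose[where k = "\<lambda>(v, x, t). (t, x, v)", OF assms])
       (auto simp: split_beta intro!: linear_imp_differentiable_on linearI)
  from AE_lebesgue_prod[OF this]
  have "AE t in lborel. AE y in lebesgue. P (snd y, fst y, t)" by (simp add: AE_completion_iff)
  then show "AE t in lborel. AE x in lborel. AE v in lborel. P (v, x, t)"
  proof eventually_elim
    case (elim t)
    from AE_lebesgue_prod[OF elim] show ?case by (simp add: AE_completion_iff)
  qed
  have "AE y in lebesgue. P (fst (snd y), snd (snd y), fst y)"
    by (rule AE_lebesgue_compose[where k = "\<lambda>(v, x, t). (t, v, x)", OF assms])
       (auto simp: split_beta intro!: linear_imp_differentiable_on linearI)
  from AE_lebesgue_prod[OF this]
  have "AE t in lborel. AE y in lebesgue. P (fst y, snd y, t)" by (simp add: AE_completion_iff)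
  then show "AE t in lborel. AE v in lborel. AE x in lborel. P (v, x, t)"
  proof eventually_elim
    case (elim t)
    from AE_lebesgue_prod[OF elim] show ?case by (simp add: AE_completion_iff)
  qed
qed

context dominated_collisions
begin

text \<open>After integration in v gain and loss have equal mass, hence the factor 2. In the
  quadratic expression only one factor is estimated by M, so that the bound stays linear in the L1
  norm and can be iterated. The Borel representative f makes that norm a measurable function of
  time.\<close>

lemma collision_integral_L1:
  assumes D: "2 \<le> CARD('n)"
    and F: "AE (v, x, t) in lebesgue. \<bar>F v x t\<bar> \<le> M v x t"
      "AE (v, x, t) in lebesgue. integrable (completion (sphere_measure \<Otimes>\<^sub>M lborel)) (collision_integrand b F v x t)"
    and f[measurable]: "f \<in> borel_measurable borel" and Ff: "AE z in lebesgue. (\<lambda>(v, x, t). F v x t) z = f z"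
  shows "AE t in lborel. (\<integral>\<^sup>+x. \<integral>\<^sup>+v. ennreal \<bar>collision_integral b F v x t\<bar> \<partial>lborel \<partial>lborel)
    \<le> 2 * a t * (\<integral>\<^sup>+x. \<integral>\<^sup>+v. ennreal \<bar>f (v, x, t)\<bar> \<partial>lborel \<partial>lborel)"
proof -
  define C where "C = ennreal (total_angular_mass bhat TYPE('n))"
  obtain h where h[measurable]: "h \<in> borel_measurable borel"
    and hb: "\<And>n :: real^'n. norm n = 1 \<Longrightarrow> AE \<omega> in sphere_measure. ennreal (bhat (\<omega> \<bullet> n)) = h (\<omega> \<bullet> n)"
    and hC: "\<And>n :: real^'n. norm n = 1 \<Longrightarrow> (\<integral>\<^sup>+\<omega>. h (\<omega> \<bullet> n) \<partial>sphere_measure) = C"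
    by (rule separated_form_borel_version[OF sep D, folded C_def]) (rule that, assumption+)
  let ?k = "borel_kernel \<beta> h"
  let ?G = "\<lambda>v x t \<omega> w. (ennreal \<bar>f (collide v w \<omega>, x, t)\<bar> * ennreal \<bar>f (collide_star v w \<omega>, x, t)\<bar>
      + ennreal \<bar>f (v, x, t)\<bar> * ennreal \<bar>f (w, x, t)\<bar>) * ?k (v - w) \<omega>"
  have "AE (v, x, t) in lebesgue. ennreal \<bar>collision_integral b F v x t\<bar>
      \<le> (\<integral>\<^sup>+p. ?G v x t (fst p) (snd p) \<partial>(sphere_measure \<Otimes>\<^sub>M lborel))"
    using F(2) Ff AE_at_collision_velocities[OF Ff]
  proof eventually_elim
    case (elim z)
    obtain v x t where z: "z = (v, x, t)" by (cases z)
    let ?P = "sphere_measure \<Otimes>\<^sub>M lborel :: ((real^'n) \<times> (real^'n)) measure"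
    let ?H = "collision_integrand b F v x t"
    have H: "integrable (completion ?P) ?H" using elim(1) by (simp add: z)
    obtain H' where H'[measurable]: "H' \<in> borel_measurable ?P" and HH': "AE p in ?P. ?H p = H' p"
      using completion_ex_borel_measurable_real[OF borel_measurable_integrable[OF H]] by blast
    have G[measurable]: "(\<lambda>p. ?G v x t (fst p) (snd p)) \<in> borel_measurable borel"
      unfolding borel_prod[symmetric] by measurable
    have "AE p in ?P. ?H p = H' p \<and> F (collide v (snd p) (fst p)) x t = f (collide v (snd p) (fst p), x, t)
        \<and> F (collide_star v (snd p) (fst p)) x t = f (collide_star v (snd p) (fst p), x, t) \<and> F (snd p) x t = f (snd p, x, t)"
      using HH' elim(3) by eventually_elim (simp add: z split_beta)
    from AE_sphere_lborel_swap[OF this]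
    have bd: "AE w in lborel. AE \<omega> in sphere_measure. ?H (\<omega>, w) = H' (\<omega>, w) \<and> F (collide v w \<omega>) x t = f (collide v w \<omega>, x, t)
        \<and> F (collide_star v w \<omega>) x t = f (collide_star v w \<omega>, x, t) \<and> F w x t = f (w, x, t)"
      by simp
    have "ennreal \<bar>collision_integral b F v x t\<bar> \<le> (\<integral>\<^sup>+p. ennreal \<bar>?H p\<bar> \<partial>completion ?P)"
      using integral_norm_bound_ennreal[OF H] by (simp add: collision_integral_def)
    also have "\<dots> = (\<integral>\<^sup>+p. ennreal \<bar>H' p\<bar> \<partial>?P)"
      unfolding nn_integral_completion using HH' by (intro nn_integral_cong_AE) auto
    also have "\<dots> = (\<integral>\<^sup>+w. \<integral>\<^sup>+\<omega>. ennreal \<bar>H' (\<omega>, w)\<bar> \<partial>sphere_measure \<partial>lborel)"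
      by (subst sphere_lborel.nn_integral_snd[symmetric]) auto
    also have "\<dots> \<le> (\<integral>\<^sup>+w. \<integral>\<^sup>+\<omega>. ?G v x t \<omega> w \<partial>sphere_measure \<partial>lborel)"
    proof (rule nn_integral_mono_AE)
      show "AE w in lborel. (\<integral>\<^sup>+\<omega>. ennreal \<bar>H' (\<omega>, w)\<bar> \<partial>sphere_measure) \<le> (\<integral>\<^sup>+\<omega>. ?G v x t \<omega> w \<partial>sphere_measure)"
        using bd AE_lborel_singleton[of v]
      proof eventually_elim
        case (elim w)
        define n where "n = (v - w) /\<^sub>R norm (v - w)"
        have n: "norm n = 1" using elim(2) by (simp add: n_def)
        have Fv: "F v x t = f (v, x, t)" using \<open>(\<lambda>(v, x, t). F v x t) z = f z\<close> by (simp add: z)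
        have "AE \<omega> in sphere_measure. ennreal \<bar>H' (\<omega>, w)\<bar> \<le> ?G v x t \<omega> w"
          using elim(1) hb[OF n] AE_space
        proof eventually_elim
          case (elim \<omega>)
          have \<omega>: "norm \<omega> = 1" using elim(3) by (simp add: space_sphere_measure)
          have "b (v - w) \<omega> = norm (v - w) powr \<beta> * bhat (\<omega> \<bullet> n)"
            using sep \<omega> \<open>w \<noteq> v\<close> by (auto simp: separated_form_def n_def)
          then have b: "ennreal (b (v - w) \<omega>) = ?k (v - w) \<omega>"
            using elim(2) by (simp add: borel_kernel_def ennreal_mult' n_def)
          have b0: "0 \<le> b (v - w) \<omega>" using \<omega> \<open>w \<noteq> v\<close> by (intro kernel_nonneg) auto
          let ?a = "f (collide v w \<omega>, x, t) * f (collide_star v w \<omega>, x, t)" and ?c = "f (v, x, t) * f (w, x, t)"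
          have "H' (\<omega>, w) = (?a - ?c) * b (v - w) \<omega>"
            using elim(1) Fv by (auto simp: collision_integrand_def)
          then have "\<bar>H' (\<omega>, w)\<bar> \<le> (\<bar>?a\<bar> + \<bar>?c\<bar>) * b (v - w) \<omega>"
            using mult_right_mono[OF abs_triangle_ineq4[of ?a ?c] b0] b0 by (simp add: abs_mult)
          then have "ennreal \<bar>H' (\<omega>, w)\<bar> \<le> ennreal ((\<bar>?a\<bar> + \<bar>?c\<bar>) * b (v - w) \<omega>)"
            by (rule ennreal_leI)
          also have "\<dots> = ?G v x t \<omega> w"
            using b0 by (simp add: ennreal_mult b abs_mult)
          finally show ?case .
        qed
        then show ?case by (rule nn_integral_mono_AE)
      qed
    qed
    also have "\<dots> = (\<integral>\<^sup>+w. \<integral>\<^sup>+\<omega>. ?G v x t \<omega> w \<partial>borel_sphere_measure \<partial>lborel)"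
      by (intro nn_integral_cong nn_integral_borel_sphere_measure[symmetric]) measurable
    also have "\<dots> = (\<integral>\<^sup>+p. ?G v x t (fst p) (snd p) \<partial>?P)"
      by (simp add: nn_integral_sphere_lborel[OF G])
    finally show ?case by (simp add: z)
  qed
  note AE_lebesgue_rev(1)[OF this] AE_lebesgue_rev(1)[OF F(1)] AE_lebesgue_rev(1)[OF Ff] AE_lebesgue_rev(1)[OF attenuation_le]
  then show ?thesis
  proof eventually_elim
    case (elim t)
    have "(\<integral>\<^sup>+x. \<integral>\<^sup>+v. ennreal \<bar>collision_integral b F v x t\<bar> \<partial>lborel \<partial>lborel)
        \<le> (\<integral>\<^sup>+x. 2 * a t * (\<integral>\<^sup>+v. ennreal \<bar>f (v, x, t)\<bar> \<partial>lborel) \<partial>lborel)"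
    proof (rule nn_integral_mono_AE)
      show "AE x in lborel. (\<integral>\<^sup>+v. ennreal \<bar>collision_integral b F v x t\<bar> \<partial>lborel) \<le> 2 * a t * (\<integral>\<^sup>+v. ennreal \<bar>f (v, x, t)\<bar> \<partial>lborel)"
        using elim
      proof eventually_elim
        case (elim x)
        have \<Phi>: "(\<lambda>v. ennreal \<bar>f (v, x, t)\<bar>) \<in> borel_measurable borel" by measurable
        have fM: "AE w in lborel. ennreal \<bar>f (w, x, t)\<bar> \<le> ennreal (M w x t)"
          using elim(2,3) by eventually_elim (auto intro: ennreal_leI)
        have "(\<integral>\<^sup>+v. ennreal \<bar>collision_integral b F v x t\<bar> \<partial>lborel)
            \<le> (\<integral>\<^sup>+v. \<integral>\<^sup>+p. ?G v x t (fst p) (snd p) \<partial>(sphere_measure \<Otimes>\<^sub>M lborel) \<partial>lborel)"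
          using elim(1) by (intro nn_integral_mono_AE) simp
        also have "\<dots> = 2 * (\<integral>\<^sup>+v. ennreal \<bar>f (v, x, t)\<bar> * (C * (\<integral>\<^sup>+w. ennreal \<bar>f (w, x, t)\<bar> * ennreal (norm (v - w) powr \<beta>) \<partial>lborel)) \<partial>lborel)"
          by (rule nn_integral_gain_loss[OF \<Phi> h hC])
        also have "\<dots> \<le> 2 * (\<integral>\<^sup>+v. a t * ennreal \<bar>f (v, x, t)\<bar> \<partial>lborel)"
        proof (intro mult_left_mono nn_integral_mono_AE)
          show "AE v in lborel. ennreal \<bar>f (v, x, t)\<bar> * (C * (\<integral>\<^sup>+w. ennreal \<bar>f (w, x, t)\<bar> * ennreal (norm (v - w) powr \<beta>) \<partial>lborel))
              \<le> a t * ennreal \<bar>f (v, x, t)\<bar>"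
            using elim(4)
          proof eventually_elim
            case (elim v)
            \<comment> \<open>The inner factor is replaced by M and yields the weight; the outer
              factor at v is kept.\<close>
            have "C * (\<integral>\<^sup>+w. ennreal \<bar>f (w, x, t)\<bar> * ennreal (norm (v - w) powr \<beta>) \<partial>lborel)
                \<le> C * (\<integral>\<^sup>+w. ennreal (M w x t) * ennreal (norm (v - w) powr \<beta>) \<partial>lborel)"
              using fM by (intro mult_left_mono nn_integral_mono_AE) (auto elim!: eventually_mono intro: mult_right_mono)
            also have "\<dots> \<le> a t" using elim by (simp add: C_def)
            finally show ?case by (simp add: mult_left_mono mult.commute[of "a t"])
          qed
        qed simp
        also have "\<dots> = 2 * a t * (\<integral>\<^sup>+v. ennreal \<bar>f (v, x, t)\<bar> \<partial>lborel)"
          by (subst nn_integral_cmult) (auto simp: mult.assoc)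
        finally show ?case .
      qed
    qed
    also have "\<dots> = 2 * a t * (\<integral>\<^sup>+x. \<integral>\<^sup>+v. ennreal \<bar>f (v, x, t)\<bar> \<partial>lborel \<partial>lborel)"
      by (intro nn_integral_cmult) measurable
    finally show ?case .
  qed
qed

text \<open>Decay of M in the past removes the initial datum, so the solution is bounded by the
  collision terms alone. K, a bound on the mass of M valid at all times, starts the iteration; with
  no initial term the iterates are K A^k / k! and tend to 0.\<close>

lemma mild_solution_vanishes:
  assumes D: "2 \<le> CARD('n)"
    and F: "mild_solution b UNIV F" "AE (v, x, t) in lebesgue. \<bar>F v x t\<bar> \<le> M v x t"
    and mass: "\<And>t. (\<integral>\<^sup>+x. \<integral>\<^sup>+v. ennreal (M v x t) \<partial>lborel \<partial>lborel) \<le> ennreal K"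
    and decay: "\<And>v x. ((\<lambda>t. M v (x + t *\<^sub>R v) t) \<longlongrightarrow> 0) at_bot"
  shows "AE (v, x, t) in lebesgue. F v x t = 0"
proof -
  note mild = mild_solutionD[OF F(1)]
  obtain f where f[measurable]: "f \<in> borel_measurable borel" and "AE z in lborel. (\<lambda>(v, x, t). F v x t) z = f z"
    using completion_ex_borel_measurable_real[OF mild(1)] by auto
  then have Ff: "AE z in lebesgue. (\<lambda>(v, x, t). F v x t) z = f z" by (simp add: AE_completion_iff)
  obtain B where B[measurable]: "B \<in> borel_measurable borel" and "AE z in lborel. (\<lambda>(v, x, t). collision_integral b F v x t) z = B z"
    using completion_ex_borel_measurable_real[OF mild(4)] by auto
  then have FB: "AE z in lebesgue. (\<lambda>(v, x, t). collision_integral b F v x t) z = B z" by (simp add: AE_completion_iff)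
  define n where "n = (\<lambda>t. \<integral>\<^sup>+x. \<integral>\<^sup>+v. ennreal \<bar>f (v, x, t)\<bar> \<partial>lborel \<partial>lborel)"
  have [measurable]: "n \<in> borel_measurable borel" unfolding n_def by measurable
  let ?e = "\<lambda>t. 2 * a t"
  have e[measurable]: "?e \<in> borel_measurable borel" by measurable
  have BL1: "AE t in lborel. (\<integral>\<^sup>+x. \<integral>\<^sup>+v. ennreal \<bar>B (v, x, t)\<bar> \<partial>lborel \<partial>lborel) \<le> ?e t * n t"
    using collision_integral_L1[OF D F(2) mild(3) f Ff] AE_lebesgue_rev(1)[OF FB]
  proof eventually_elim
    case (elim t)
    have "(\<integral>\<^sup>+x. \<integral>\<^sup>+v. ennreal \<bar>B (v, x, t)\<bar> \<partial>lborel \<partial>lborel) = (\<integral>\<^sup>+x. \<integral>\<^sup>+v. ennreal \<bar>collision_integral b F v x t\<bar> \<partial>lborel \<partial>lborel)"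
      using elim(2) by (intro nn_integral_cong_AE) (auto elim!: eventually_mono intro!: nn_integral_cong_AE)
    then show ?case using elim(1) by (simp add: n_def)
  qed
  have "AE p in lebesgue. \<forall>t. ennreal \<bar>F (fst p) (snd p + t *\<^sub>R fst p) t\<bar>
      \<le> (\<integral>\<^sup>+r. ennreal \<bar>B (fst p, snd p + r *\<^sub>R fst p, r)\<bar> * indicator {..<t} r \<partial>lborel)"
    using mild(5) AE_characteristics[OF F(2)] AE_characteristics[OF FB]
  proof eventually_elim
    case (elim p)
    obtain v x where p: "p = (v, x)" by (cases p)
    let ?C = "\<lambda>s. collision_integral b F v (x + s *\<^sub>R v) s"
    have FM: "AE s in lborel. \<bar>F v (x + s *\<^sub>R v) s\<bar> \<le> M v (x + s *\<^sub>R v) s"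
      using elim(2) by (simp add: p AE_completion_iff)
    have CB: "AE s in lebesgue. ?C s = B (v, x + s *\<^sub>R v, s)" using elim(3) by (simp add: p)
    show ?case
    proof
      fix t :: real
      let ?I = "\<integral>\<^sup>+r. ennreal \<bar>B (v, x + r *\<^sub>R v, r)\<bar> * indicator {..<t} r \<partial>lborel"
      have eps: "ennreal \<bar>F v (x + t *\<^sub>R v) t\<bar> \<le> ?I + ennreal \<epsilon>" if \<epsilon>: "0 < \<epsilon>" for \<epsilon>
      proof -
        have "\<forall>\<^sub>F s in at_bot. M v (x + s *\<^sub>R v) s < \<epsilon>" using decay \<epsilon> by (rule order_tendstoD)
        then obtain S where S: "\<And>s. s \<le> S \<Longrightarrow> M v (x + s *\<^sub>R v) s < \<epsilon>"
          by (auto simp: eventually_at_bot_linorder)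
        \<comment> \<open>The bound by M holds only for almost every time on the characteristic;
          since a half-line has positive measure, a suitable time exists arbitrarily far
          back.\<close>
        have "\<exists>s. s \<le> min S t \<and> \<bar>F v (x + s *\<^sub>R v) s\<bar> \<le> M v (x + s *\<^sub>R v) s"
        proof (rule ccontr)
          assume "\<not> ?thesis"
          then have "AE s in lborel. s \<notin> {..min S t}" using FM by (auto elim!: eventually_mono)
          then have "emeasure lborel {..min S t} = 0"
            using AE_iff_null_sets[of "{..min S t}" lborel] by auto
          moreover have "emeasure lborel {min S t - 1..min S t} \<le> emeasure lborel {..min S t}"
            by (rule emeasure_mono) auto
          moreover have "emeasure lborel {min S t - 1..min S t} = ennreal 1"
            by (subst emeasure_lborel_Icc) (linarith, simp)
          ultimately show False by simp
        qed
        then obtain s where s: "s \<le> S" "s \<le> t" "\<bar>F v (x + s *\<^sub>R v) s\<bar> \<le> M v (x + s *\<^sub>R v) s" by auto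
        then have Fs: "\<bar>F v (x + s *\<^sub>R v) s\<bar> \<le> \<epsilon>" using S[of s] by simp
        have "F v (x + t *\<^sub>R v) t = F v (x + s *\<^sub>R v) s + (LINT r=s..t|lebesgue. ?C r)"
          using elim(1) by (simp add: p)
        then have "ennreal \<bar>F v (x + t *\<^sub>R v) t\<bar> \<le> ennreal (\<bar>F v (x + s *\<^sub>R v) s\<bar> + \<bar>LINT r=s..t|lebesgue. ?C r\<bar>)"
          by (intro ennreal_leI) simp
        also have "\<dots> \<le> ennreal \<epsilon> + ennreal \<bar>LINT r=s..t|lebesgue. ?C r\<bar>"
          using Fs by (simp add: ennreal_plus add_right_mono ennreal_leI)
        also have "ennreal \<bar>LINT r=s..t|lebesgue. ?C r\<bar> \<le> ?I"
        proof -
          have "ennreal \<bar>LINT r=s..t|lebesgue. ?C r\<bar> = ennreal (norm (LINT r|lebesgue. indicat_real {s<..<t} r *\<^sub>R ?C r))"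
            using s(2) by (simp add: interval_lebesgue_integral_def set_lebesgue_integral_def einterval_eq)
          also have "\<dots> \<le> (\<integral>\<^sup>+r. ennreal (norm (indicat_real {s<..<t} r *\<^sub>R ?C r)) \<partial>lebesgue)"
          \<comment> \<open>Integrability along the characteristic is not known here. If it fails,
            the Bochner integral is 0 and the bound is trivial.\<close>
          proof (cases "integrable lebesgue (\<lambda>r. indicat_real {s<..<t} r *\<^sub>R ?C r)")
            case True
            then show ?thesis by (rule integral_norm_bound_ennreal)
          next
            case False
            from not_integrable_integral_eq[OF this] show ?thesis by (simp only: norm_zero ennreal_0 zero_le)
          qed
          also have "\<dots> \<le> (\<integral>\<^sup>+r. ennreal \<bar>B (v, x + r *\<^sub>R v, r)\<bar> * indicator {..<t} r \<partial>lebesgue)"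
            using CB by (intro nn_integral_mono_AE) (auto elim!: eventually_mono simp: indicator_def)
          finally show ?thesis by (simp only: nn_integral_completion)
        qed
        finally show ?thesis by (simp add: add.commute)
      qed
      show "ennreal \<bar>F (fst p) (snd p + t *\<^sub>R fst p) t\<bar>
          \<le> (\<integral>\<^sup>+r. ennreal \<bar>B (fst p, snd p + r *\<^sub>R fst p, r)\<bar> * indicator {..<t} r \<partial>lborel)"
        unfolding p fst_conv snd_conv by (rule ennreal_le_epsilon, rule eps)
    qed
  qed
  then have "AE p in lebesgue. ennreal \<bar>F (fst p) (snd p + t *\<^sub>R fst p) t\<bar>
      \<le> (\<integral>\<^sup>+r. ennreal \<bar>B (fst p, snd p + r *\<^sub>R fst p, r)\<bar> * indicator {..<t} r \<partial>lborel)" for t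
    by (auto elim!: eventually_mono)
  note AE_lebesgue_prod[OF this]
  then have "AE t in lborel. AE v in lborel. AE y in lborel. ennreal \<bar>F v (y + t *\<^sub>R v) t\<bar>
      \<le> (\<integral>\<^sup>+r. ennreal \<bar>B (v, y + r *\<^sub>R v, r)\<bar> * indicator {..<t} r \<partial>lborel)"
    by - (rule AE_I2, simp add: AE_completion_iff)
  moreover have "AE t in lborel. AE v in lborel. AE y in lborel. F v (y + t *\<^sub>R v) t = f (v, y + t *\<^sub>R v, t)"
    using AE_lebesgue_rev(2)[OF AE_shear[OF Ff, of 1]] by simp
  ultimately have step: "AE t in lborel. n t \<le> span_integral lessThan (\<lambda>r. ?e r * n r) t"
  proof eventually_elim
    case (elim t)
    have "n t = (\<integral>\<^sup>+v. \<integral>\<^sup>+x. ennreal \<bar>f (v, x, t)\<bar> \<partial>lborel \<partial>lborel)"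
      unfolding n_def by (rule lborel_pair.Fubini') measurable
    \<comment> \<open>At fixed v free transport is a translation in position. It is introduced here
      to reach the characteristics and removed below, at each earlier time r, by the opposite
      translation.\<close>
    also have "\<dots> = (\<integral>\<^sup>+v. \<integral>\<^sup>+y. ennreal \<bar>f (v, t *\<^sub>R v + y, t)\<bar> \<partial>lborel \<partial>lborel)"
      by (intro nn_integral_cong nn_integral_lborel_translate[symmetric]) measurable
    also have "\<dots> \<le> (\<integral>\<^sup>+v. \<integral>\<^sup>+y. \<integral>\<^sup>+r. ennreal \<bar>B (v, r *\<^sub>R v + y, r)\<bar> * indicator {..<t} r \<partial>lborel \<partial>lborel \<partial>lborel)"
    proof (rule nn_integral_mono_AE)
      show "AE v in lborel. (\<integral>\<^sup>+y. ennreal \<bar>f (v, t *\<^sub>R v + y, t)\<bar> \<partial>lborel)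
          \<le> (\<integral>\<^sup>+y. \<integral>\<^sup>+r. ennreal \<bar>B (v, r *\<^sub>R v + y, r)\<bar> * indicator {..<t} r \<partial>lborel \<partial>lborel)"
        using elim
      proof eventually_elim
        case (elim v)
        have "AE y in lborel. ennreal \<bar>f (v, t *\<^sub>R v + y, t)\<bar>
            \<le> (\<integral>\<^sup>+r. ennreal \<bar>B (v, r *\<^sub>R v + y, r)\<bar> * indicator {..<t} r \<partial>lborel)"
          using elim by eventually_elim (simp add: add.commute)
        then show ?case by (rule nn_integral_mono_AE)
      qed
    qed
    also have "\<dots> = (\<integral>\<^sup>+v. \<integral>\<^sup>+r. \<integral>\<^sup>+y. ennreal \<bar>B (v, r *\<^sub>R v + y, r)\<bar> * indicator {..<t} r \<partial>lborel \<partial>lborel \<partial>lborel)"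
      by (intro nn_integral_cong lborel_pair.Fubini') measurable
    also have "\<dots> = (\<integral>\<^sup>+v. \<integral>\<^sup>+r. \<integral>\<^sup>+x. ennreal \<bar>B (v, x, r)\<bar> * indicator {..<t} r \<partial>lborel \<partial>lborel \<partial>lborel)"
      by (intro nn_integral_cong nn_integral_lborel_translate[of "\<lambda>x. ennreal \<bar>B (_, x, _)\<bar> * indicator {..<t} _"]) measurable
    also have "\<dots> = (\<integral>\<^sup>+r. \<integral>\<^sup>+v. \<integral>\<^sup>+x. ennreal \<bar>B (v, x, r)\<bar> * indicator {..<t} r \<partial>lborel \<partial>lborel \<partial>lborel)"
      by (rule lborel_pair.Fubini') measurable
    also have "\<dots> = (\<integral>\<^sup>+r. \<integral>\<^sup>+x. \<integral>\<^sup>+v. ennreal \<bar>B (v, x, r)\<bar> * indicator {..<t} r \<partial>lborel \<partial>lborel \<partial>lborel)"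
      by (intro nn_integral_cong lborel_pair.Fubini') measurable
    also have "\<dots> = (\<integral>\<^sup>+r. (\<integral>\<^sup>+x. \<integral>\<^sup>+v. ennreal \<bar>B (v, x, r)\<bar> \<partial>lborel \<partial>lborel) * indicator {..<t} r \<partial>lborel)"
      by (simp add: nn_integral_multc)
    also have "\<dots> \<le> span_integral lessThan (\<lambda>r. ?e r * n r) t"
      unfolding span_integral_def using BL1
      by (intro nn_integral_mono_AE) (auto elim!: eventually_mono intro: mult_right_mono)
    finally show ?case .
  qed
  define A where "A = span_integral lessThan ?e"
  have iter: "AE t in lborel. n t \<le> ennreal K * (ennreal (inverse (fact k)) * A t ^ k)" for k
  proof (induction k)
    case 0
    show ?case
      using AE_lebesgue_rev(1)[OF F(2)] AE_lebesgue_rev(1)[OF Ff]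
    proof eventually_elim
      case (elim t)
      have "n t \<le> (\<integral>\<^sup>+x. \<integral>\<^sup>+v. ennreal (M v x t) \<partial>lborel \<partial>lborel)"
        unfolding n_def
      proof (rule nn_integral_mono_AE)
        show "AE x in lborel. (\<integral>\<^sup>+v. ennreal \<bar>f (v, x, t)\<bar> \<partial>lborel) \<le> (\<integral>\<^sup>+v. ennreal (M v x t) \<partial>lborel)"
          using elim
        proof eventually_elim
          case (elim x)
          then have "AE v in lborel. ennreal \<bar>f (v, x, t)\<bar> \<le> ennreal (M v x t)"
            by eventually_elim (simp add: ennreal_leI)
          then show ?case by (rule nn_integral_mono_AE)
        qed
      qed
      then show ?case using mass[of t] by simp
    qed
  next
    case (Suc k)
    have "span_integral lessThan (\<lambda>r. ?e r * n r) t
        \<le> ennreal K * (ennreal (inverse (fact (Suc k))) * A t ^ Suc k)" for t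
    proof -
      have "span_integral lessThan (\<lambda>r. ?e r * n r) t
          \<le> span_integral lessThan (\<lambda>r. (ennreal K * (ennreal (inverse (fact k)) * A r ^ k)) * ?e r) t"
        unfolding span_integral_def using Suc.IH
        by (intro nn_integral_mono_AE) (auto elim!: eventually_mono intro!: mult_right_mono simp: mult.commute[of "2 * a _"])
      \<comment> \<open>The exponential iterate with \<phi> = 0.\<close>
      also have "\<dots> = ennreal K * (ennreal (inverse (fact (Suc k))) * A t ^ Suc k)"
        using past.span_integral_exponential_iterate[OF e, of 0 k "ennreal K" t] by (simp add: A_def)
      finally show ?thesis .
    qed
    then show ?case using step by (auto elim!: eventually_mono intro: order_trans)
  qed
  define R where "R = 2 * enn2real (\<integral>\<^sup>+s. a s \<partial>lborel)"
  have R: "0 \<le> R" by (simp add: R_def)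
  have A_le: "A t \<le> ennreal R" for t
  proof -
    have "A t \<le> (\<integral>\<^sup>+s. 2 * a s \<partial>lborel)"
      unfolding A_def span_integral_def by (intro nn_integral_mono) (auto simp: indicator_def)
    also have "\<dots> = 2 * (\<integral>\<^sup>+s. a s \<partial>lborel)" by (intro nn_integral_cmult) simp
    also have "\<dots> = ennreal R" using a_integral by (simp add: R_def ennreal_mult)
    finally show ?thesis .
  qed
  have n0: "AE t in lborel. n t = 0"
  proof -
    have "AE t in lborel. \<forall>k. n t \<le> ennreal K * (ennreal (inverse (fact k)) * A t ^ k)"
      using iter by (simp add: AE_all_countable)
    then show ?thesis
    proof eventually_elim
      case (elim t)
      have "n t \<le> ennreal K * ennreal (inverse (fact k) * R ^ k)" for k
      proof -
        have "n t \<le> ennreal K * (ennreal (inverse (fact k)) * A t ^ k)" using elim by blast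
        also have "\<dots> \<le> ennreal K * (ennreal (inverse (fact k)) * ennreal R ^ k)"
          by (intro mult_left_mono power_mono A_le) auto
        finally show ?thesis using R by (simp add: ennreal_power ennreal_mult)
      qed
      moreover have "(\<lambda>k. ennreal K * ennreal (inverse (fact k) * R ^ k)) \<longlonglongrightarrow> ennreal K * ennreal 0"
        using summable_LIMSEQ_zero[OF sums_summable[OF exp_converges[of R]]]
        by (intro ennreal_tendsto_cmult tendsto_ennrealI) auto
      ultimately have "n t \<le> ennreal K * ennreal 0" by (intro LIMSEQ_le_const) auto
      then show ?case by simp
    qed
  qed
  have "(\<integral>\<^sup>+z. ennreal \<bar>f z\<bar> \<partial>lborel) = (\<integral>\<^sup>+v. \<integral>\<^sup>+y. ennreal \<bar>f (v, y)\<bar> \<partial>lborel \<partial>lborel)"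
    by (rule nn_integral_lborel_pair) measurable
  also have "\<dots> = (\<integral>\<^sup>+v. \<integral>\<^sup>+x. \<integral>\<^sup>+t. ennreal \<bar>f (v, x, t)\<bar> \<partial>lborel \<partial>lborel \<partial>lborel)"
    by (intro nn_integral_cong nn_integral_lborel_pair) measurable
  also have "\<dots> = (\<integral>\<^sup>+v. \<integral>\<^sup>+t. \<integral>\<^sup>+x. ennreal \<bar>f (v, x, t)\<bar> \<partial>lborel \<partial>lborel \<partial>lborel)"
    by (intro nn_integral_cong lborel_pair.Fubini') measurable
  also have "\<dots> = (\<integral>\<^sup>+t. \<integral>\<^sup>+v. \<integral>\<^sup>+x. ennreal \<bar>f (v, x, t)\<bar> \<partial>lborel \<partial>lborel \<partial>lborel)"
    by (rule lborel_pair.Fubini') measurable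
  also have "\<dots> = (\<integral>\<^sup>+t. n t \<partial>lborel)"
    unfolding n_def by (intro nn_integral_cong lborel_pair.Fubini') measurable
  also have "\<dots> = 0" using n0 by (simp add: nn_integral_0_iff_AE)
  finally have "AE z in lborel. f z = 0"
    by (simp add: nn_integral_0_iff_AE)
  then have "AE z in lebesgue. f z = 0" by (simp add: AE_completion_iff)
  then show ?thesis using Ff by eventually_elim auto
qed

end

section \<open>Gaussian integrals with a power weight\<close>

lemma nn_integral_even:
  fixes f :: "real \<Rightarrow> ennreal"
  assumes [measurable]: "f \<in> borel_measurable borel"
  shows "(\<integral>\<^sup>+s. f \<bar>s\<bar> \<partial>lborel) = 2 * (\<integral>\<^sup>+s. f s * indicator {0..} s \<partial>lborel)"
proof -
  have "(\<integral>\<^sup>+s. f \<bar>s\<bar> \<partial>lborel) = (\<integral>\<^sup>+s. f s * indicator {0..} s + f (- s) * indicator {0..} (- s) \<partial>lborel)"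
    using AE_lborel_singleton[of "0::real"]
    by (intro nn_integral_cong_AE) (auto elim!: eventually_mono simp: indicator_def)
  also have "\<dots> = (\<integral>\<^sup>+s. f s * indicator {0..} s \<partial>lborel) + (\<integral>\<^sup>+s. f (- s) * indicator {0..} (- s) \<partial>lborel)"
    by (intro nn_integral_add) auto
  also have "(\<integral>\<^sup>+s. f (- s) * indicator {0..} (- s) \<partial>lborel) = (\<integral>\<^sup>+s. f s * indicator {0..} s \<partial>lborel)"
    by (rule nn_integral_lborel_orthogonal[of "uminus"])
       (auto simp: orthogonal_transformation_def intro!: linearI)
  finally show ?thesis by (simp add: mult_2)
qed

lemma nn_integral_powr_near_0:
  assumes "-1 < \<gamma>" "0 \<le> \<rho>"
  shows "(\<integral>\<^sup>+s. ennreal (\<bar>s\<bar> powr \<gamma>) * indicator {..\<rho>} \<bar>s\<bar> \<partial>lborel) = ennreal (2 * (\<rho> powr (\<gamma> + 1) / (\<gamma> + 1)))"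
proof -
  have "(\<integral>\<^sup>+s. ennreal (\<bar>s\<bar> powr \<gamma>) * indicator {..\<rho>} \<bar>s\<bar> \<partial>lborel)
      = 2 * (\<integral>\<^sup>+s. ennreal (s powr \<gamma>) * indicator {..\<rho>} s * indicator {0..} s \<partial>lborel)"
    by (rule nn_integral_even) measurable
  also have "(\<integral>\<^sup>+s. ennreal (s powr \<gamma>) * indicator {..\<rho>} s * indicator {0..} s \<partial>lborel)
      = (\<integral>\<^sup>+s. ennreal (indicator {0..\<rho>} s * s powr \<gamma>) \<partial>lborel)"
    by (intro nn_integral_cong) (auto simp: indicator_def)
  also have "\<dots> = ennreal (\<rho> powr (\<gamma> + 1) / (\<gamma> + 1))"
    by (rule nn_integral_has_integral_lebesgue[OF _ has_integral_powr_from_0[OF assms]]) simp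
  finally show ?thesis using assms by (simp add: ennreal_mult[symmetric] flip: ennreal_numeral)
qed

lemma nn_integral_powr_at_infinity:
  assumes "1 < r"
  shows "(\<integral>\<^sup>+s. ennreal (\<bar>s\<bar> powr - r) * indicator {1..} \<bar>s\<bar> \<partial>lborel) = ennreal (2 / (r - 1))"
proof -
  have "(\<integral>\<^sup>+s. ennreal (\<bar>s\<bar> powr - r) * indicator {1..} \<bar>s\<bar> \<partial>lborel)
      = 2 * (\<integral>\<^sup>+s. ennreal (s powr - r) * indicator {1..} s * indicator {0..} s \<partial>lborel)"
    by (rule nn_integral_even) measurable
  also have "(\<integral>\<^sup>+s. ennreal (s powr - r) * indicator {1..} s * indicator {0..} s \<partial>lborel)
      = (\<integral>\<^sup>+s. ennreal (indicator {1..} s * s powr - r) \<partial>lborel)"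
    by (intro nn_integral_cong) (auto simp: indicator_def)
  also have "\<dots> = ennreal (- (1 powr (- r + 1)) / (- r + 1))"
    using assms by (intro nn_integral_has_integral_lebesgue[OF _ has_integral_powr_to_inf]) auto
  also have "- (1 powr (- r + 1)) / (- r + 1) = 1 / (r - 1)"
    using assms by (simp add: field_simps)
  finally show ?thesis using assms by (simp add: ennreal_mult[symmetric] flip: ennreal_numeral)
qed

lemma nn_integral_gaussian:
  assumes k: "0 < k"
  shows "(\<integral>\<^sup>+s. ennreal (exp (- k * (s - u)\<^sup>2 / 2)) \<partial>lborel) = ennreal (sqrt (2 * pi / k))"
proof -
  let ?n = "normal_density u (1 / sqrt k)"
  have e: "exp (- k * (s - u)\<^sup>2 / 2) = sqrt (2 * pi / k) * ?n s" for s
    using k by (simp add: normal_density_def power_divide real_sqrt_divide real_sqrt_mult)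
  have "(\<integral>\<^sup>+s. ennreal (?n s) \<partial>lborel) = ennreal 1"
    using k by (subst nn_integral_eq_integral) auto
  then show ?thesis
    using k by (simp only: e) (simp add: ennreal_mult nn_integral_cmult)
qed

text \<open>The split is at distance 1 / sqrt k from p, the width of the Gaussian. Inside, the
  exponential is at most 1 and the singularity is integrated; outside, the power is at most its
  value at the split. Both parts then scale like the same power of k, uniformly in u and p.\<close>

lemma nn_integral_gaussian_powr_real:
  assumes k: "0 < k" and \<gamma>: "-1 < \<gamma>" "\<gamma> \<le> 0"
  shows "(\<integral>\<^sup>+s. ennreal (exp (- k * (s - u)\<^sup>2 / 2) * \<bar>p - s\<bar> powr \<gamma>) \<partial>lborel)
    \<le> ennreal ((2 / (\<gamma> + 1) + sqrt (2 * pi)) * k powr (- (\<gamma> + 1) / 2))"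
proof -
  define \<rho> where "\<rho> = 1 / sqrt k"
  have \<rho>: "0 < \<rho>" using k by (simp add: \<rho>_def)
  have "ennreal (exp (- k * (s - u)\<^sup>2 / 2) * \<bar>p - s\<bar> powr \<gamma>)
      \<le> ennreal (\<bar>s - p\<bar> powr \<gamma>) * indicator {..\<rho>} \<bar>s - p\<bar> + ennreal (\<rho> powr \<gamma>) * ennreal (exp (- k * (s - u)\<^sup>2 / 2))" for s
  proof (cases "\<bar>s - p\<bar> \<le> \<rho>")
    case True
    have "exp (- k * (s - u)\<^sup>2 / 2) \<le> 1" using k by simp
    then have "exp (- k * (s - u)\<^sup>2 / 2) * \<bar>p - s\<bar> powr \<gamma> \<le> 1 * \<bar>s - p\<bar> powr \<gamma>"
      by (intro mult_mono) (auto simp: abs_minus_commute)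
    then show ?thesis using True by (auto intro!: add_increasing2 ennreal_leI)
  next
    case False
    then have "\<bar>p - s\<bar> powr \<gamma> \<le> \<rho> powr \<gamma>"
      using \<gamma> \<rho> by (intro powr_mono2') (auto simp: abs_minus_commute)
    then show ?thesis using False
      by (simp add: ennreal_mult[symmetric] ennreal_leI mult.commute mult_right_mono)
  qed
  then have "(\<integral>\<^sup>+s. ennreal (exp (- k * (s - u)\<^sup>2 / 2) * \<bar>p - s\<bar> powr \<gamma>) \<partial>lborel)
      \<le> (\<integral>\<^sup>+s. ennreal (\<bar>s - p\<bar> powr \<gamma>) * indicator {..\<rho>} \<bar>s - p\<bar> + ennreal (\<rho> powr \<gamma>) * ennreal (exp (- k * (s - u)\<^sup>2 / 2)) \<partial>lborel)"
    by (intro nn_integral_mono)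
  also have "\<dots> = (\<integral>\<^sup>+s. ennreal (\<bar>s - p\<bar> powr \<gamma>) * indicator {..\<rho>} \<bar>s - p\<bar> \<partial>lborel)
      + ennreal (\<rho> powr \<gamma>) * (\<integral>\<^sup>+s. ennreal (exp (- k * (s - u)\<^sup>2 / 2)) \<partial>lborel)"
    by (subst nn_integral_add) (auto simp: nn_integral_cmult)
  also have "(\<integral>\<^sup>+s. ennreal (\<bar>s - p\<bar> powr \<gamma>) * indicator {..\<rho>} \<bar>s - p\<bar> \<partial>lborel)
      = (\<integral>\<^sup>+s. ennreal (\<bar>s\<bar> powr \<gamma>) * indicator {..\<rho>} \<bar>s\<bar> \<partial>lborel)"
    using nn_integral_lborel_translate[of "\<lambda>s. ennreal (\<bar>s\<bar> powr \<gamma>) * indicator {..\<rho>} \<bar>s\<bar>" "- p"] by simp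
  also have "\<dots> + ennreal (\<rho> powr \<gamma>) * (\<integral>\<^sup>+s. ennreal (exp (- k * (s - u)\<^sup>2 / 2)) \<partial>lborel)
      = ennreal (2 * (\<rho> powr (\<gamma> + 1) / (\<gamma> + 1)) + \<rho> powr \<gamma> * sqrt (2 * pi / k))"
    using \<gamma> \<rho> k by (subst nn_integral_gaussian[OF k], subst nn_integral_powr_near_0) (auto simp: ennreal_mult)
  also have "2 * (\<rho> powr (\<gamma> + 1) / (\<gamma> + 1)) + \<rho> powr \<gamma> * sqrt (2 * pi / k) = (2 / (\<gamma> + 1) + sqrt (2 * pi)) * \<rho> powr (\<gamma> + 1)"
  proof -
    have "\<rho> powr (\<gamma> + 1) = \<rho> powr \<gamma> * \<rho>" using \<rho> by (simp add: powr_add)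
    moreover have "sqrt (2 * pi / k) = sqrt (2 * pi) * \<rho>" by (simp add: \<rho>_def real_sqrt_divide)
    ultimately show ?thesis by (simp add: algebra_simps)
  qed
  also have "\<rho> powr (\<gamma> + 1) = k powr (- (\<gamma> + 1) / 2)"
  proof -
    have "\<rho> = k powr (- 1 / 2)" using k by (simp add: \<rho>_def powr_minus powr_half_sqrt inverse_eq_divide)
    then have "\<rho> powr (\<gamma> + 1) = k powr ((- 1 / 2) * (\<gamma> + 1))" by (simp only: powr_powr)
    also have "(- 1 / 2) * (\<gamma> + 1) = - (\<gamma> + 1) / 2" by (simp only: times_divide_eq_left mult_minus1)
    finally show ?thesis .
  qed
  finally show ?thesis .
qed

text \<open>\<open>\<bar>z\<bar>\<^sup>\<beta>\<close> is at most the product of the \<open>\<bar>z\<^sub>j\<bar>\<^bsup>\<beta>/D\<^esup>\<close>, which reduces the bound to dimension one.\<close>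

lemma nn_integral_gaussian_powr:
  fixes u v :: "real^'n" and \<beta> :: real
  assumes k: "0 < k" and \<beta>: "- real CARD('n) < \<beta>" "\<beta> \<le> 0"
  shows "(\<integral>\<^sup>+w. ennreal (exp (- k * (norm (w - u))\<^sup>2 / 2)) * ennreal (norm (v - w) powr \<beta>) \<partial>lborel)
    \<le> ennreal ((2 / (\<beta> / CARD('n) + 1) + sqrt (2 * pi)) ^ CARD('n) * k powr (- (CARD('n) + \<beta>) / 2))"
proof -
  \<comment> \<open>Sharing the exponent equally keeps each one-dimensional exponent above -1,
    because \<beta> > -D.\<close>
  define \<gamma> where "\<gamma> = \<beta> / CARD('n)"
  have D: "0 < real CARD('n)" by simp
  have \<gamma>: "- 1 < \<gamma>" "\<gamma> \<le> 0" using \<beta> D by (auto simp: \<gamma>_def field_simps)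
  let ?g = "\<lambda>j s. ennreal (exp (- k * (s - u \<bullet> j)\<^sup>2 / 2) * \<bar>v \<bullet> j - s\<bar> powr \<gamma>)"
  let ?K = "(2 / (\<gamma> + 1) + sqrt (2 * pi)) * k powr (- (\<gamma> + 1) / 2)"
  \<comment> \<open>On these hyperplanes \<open>0 powr \<gamma> = 0\<close> would make the product
    vanish and break the comparison.\<close>
  have "AE w in lborel. w \<bullet> j \<noteq> v \<bullet> j" if "j \<in> Basis" for j :: "real^'n"
  proof -
    have "{v \<bullet> j} \<in> null_sets lborel" by (auto intro: null_setsI)
    from AE_not_in[OF null_sets_inner_vimage[OF this norm_Basis[OF that]]] show ?thesis by simp
  qed
  then have "AE w in lborel. \<forall>j\<in>Basis. w \<bullet> j \<noteq> v \<bullet> j"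
    by (intro AE_finite_allI) auto
  then have "(\<integral>\<^sup>+w. ennreal (exp (- k * (norm (w - u))\<^sup>2 / 2)) * ennreal (norm (v - w) powr \<beta>) \<partial>lborel)
      \<le> (\<integral>\<^sup>+w. (\<Prod>j\<in>Basis. ?g j (w \<bullet> j)) \<partial>lborel)"
  proof (intro nn_integral_mono_AE, eventually_elim)
    case (elim w)
    have "(norm (w - u))\<^sup>2 = (\<Sum>j\<in>Basis. (w \<bullet> j - u \<bullet> j)\<^sup>2)"
      by (simp only: power2_norm_eq_inner, subst euclidean_inner) (simp add: inner_diff_left power2_eq_square)
    then have 1: "exp (- k * (norm (w - u))\<^sup>2 / 2) = (\<Prod>j\<in>Basis. exp (- k * (w \<bullet> j - u \<bullet> j)\<^sup>2 / 2))"
      by (simp add: exp_sum[symmetric] sum_distrib_left sum_divide_distrib sum_negf)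
    have "norm (v - w) powr \<beta> = (\<Prod>j\<in>(Basis :: (real^'n) set). norm (v - w) powr \<gamma>)"
    proof -
      have "norm (v - w) \<noteq> 0" using elim nonempty_Basis by auto
      from powr_power[OF this]
      have "(norm (v - w) powr \<gamma>) ^ CARD('n) = norm (v - w) powr (CARD('n) * \<gamma>)" .
      also have "CARD('n) * \<gamma> = \<beta>" using D by (simp add: \<gamma>_def)
      finally show ?thesis by simp
    qed
    also have "\<dots> \<le> (\<Prod>j\<in>Basis. \<bar>v \<bullet> j - w \<bullet> j\<bar> powr \<gamma>)"
    proof (intro prod_mono conjI)
      fix j :: "real^'n" assume j: "j \<in> Basis"
      then show "norm (v - w) powr \<gamma> \<le> \<bar>v \<bullet> j - w \<bullet> j\<bar> powr \<gamma>"
        using elim Basis_le_norm[OF j, of "v - w"] \<gamma> by (intro powr_mono2') (auto simp: inner_diff_left)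
    qed simp
    finally have "exp (- k * (norm (w - u))\<^sup>2 / 2) * norm (v - w) powr \<beta>
        \<le> (\<Prod>j\<in>Basis. exp (- k * (w \<bullet> j - u \<bullet> j)\<^sup>2 / 2) * \<bar>v \<bullet> j - w \<bullet> j\<bar> powr \<gamma>)"
      unfolding 1 prod.distrib by (intro mult_left_mono) (auto intro: prod_nonneg)
    then show ?case
      by (simp add: ennreal_mult[symmetric] prod_ennreal ennreal_leI)
  qed
  also have "\<dots> = (\<Prod>j\<in>(Basis :: (real^'n) set). \<integral>\<^sup>+s. ?g j s \<partial>lborel)"
    by (rule nn_integral_lborel_prod) auto
  also have "\<dots> \<le> (\<Prod>j\<in>(Basis :: (real^'n) set). ennreal ?K)"
    by (intro prod_mono_ennreal nn_integral_gaussian_powr_real k \<gamma>)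
  also have "\<dots> = ennreal (?K ^ CARD('n))"
    using \<gamma> by (simp add: ennreal_power)
  also have "?K ^ CARD('n) = (2 / (\<gamma> + 1) + sqrt (2 * pi)) ^ CARD('n) * k powr (- (CARD('n) + \<beta>) / 2)"
  proof -
    have "(k powr (- (\<gamma> + 1) / 2)) ^ CARD('n) = k powr (CARD('n) * (- (\<gamma> + 1) / 2))"
      using k by (simp add: powr_power)
    also have "CARD('n) * (- (\<gamma> + 1) / 2) = - (CARD('n) + \<beta>) / 2"
      using D by (simp add: \<gamma>_def field_simps)
    finally show ?thesis by (simp add: power_mult_distrib)
  qed
  finally show ?thesis unfolding \<gamma>_def .
qed

text \<open>For |s| \<le> 1 the constant d alone bounds the power, beyond that the quadratic term
  does, with tail |s|^-r. It is applied with r = D + \<beta>, which exceeds 1.\<close>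

lemma nn_integral_quadratic_powr:
  assumes d: "0 < d" and a: "0 < a" and r: "1 < r"
  shows "(\<integral>\<^sup>+t. ennreal ((a * (t - \<tau>)\<^sup>2 + d) powr (- r / 2)) \<partial>lborel) < top"
proof -
  let ?f = "\<lambda>s. ennreal (d powr (- r / 2)) * indicator {..1} \<bar>s\<bar> + ennreal (a powr (- r / 2)) * (ennreal (\<bar>s\<bar> powr - r) * indicator {1..} \<bar>s\<bar>)"
  have "ennreal ((a * s\<^sup>2 + d) powr (- r / 2)) \<le> ?f s" for s
  proof (cases "\<bar>s\<bar> \<le> 1")
    case True
    have "(a * s\<^sup>2 + d) powr (- r / 2) \<le> d powr (- r / 2)"
      using d a r by (intro powr_mono2') auto
    then show ?thesis using True by (auto intro!: add_increasing2 ennreal_leI)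
  next
    case False
    have "(a * s\<^sup>2 + d) powr (- r / 2) \<le> (a * s\<^sup>2) powr (- r / 2)"
      using d a r False by (intro powr_mono2') auto
    also have "\<dots> = a powr (- r / 2) * (\<bar>s\<bar> powr 2) powr (- r / 2)"
    proof -
      have "\<bar>s\<bar> powr 2 = s\<^sup>2" using False by (subst powr_numeral) auto
      then show ?thesis using a by (simp add: powr_mult)
    qed
    also have "(\<bar>s\<bar> powr 2) powr (- r / 2) = \<bar>s\<bar> powr - r"
      by (simp only: powr_powr) simp
    finally show ?thesis using False by (simp add: ennreal_mult[symmetric] ennreal_leI)
  qed
  then have "(\<integral>\<^sup>+s. ennreal ((a * s\<^sup>2 + d) powr (- r / 2)) \<partial>lborel) \<le> (\<integral>\<^sup>+s. ?f s \<partial>lborel)"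
    by (intro nn_integral_mono)
  also have "\<dots> = ennreal (d powr (- r / 2)) * (\<integral>\<^sup>+s. indicator {..1} \<bar>s :: real\<bar> \<partial>lborel)
      + ennreal (a powr (- r / 2)) * (\<integral>\<^sup>+s. ennreal (\<bar>s\<bar> powr - r) * indicator {1..} \<bar>s\<bar> \<partial>lborel)"
    by (subst nn_integral_add) (auto simp: nn_integral_cmult)
  also have "(\<integral>\<^sup>+s. indicator {..1} \<bar>s :: real\<bar> \<partial>lborel) = (\<integral>\<^sup>+s. indicator {-1..1::real} s \<partial>lborel)"
    by (intro nn_integral_cong) (auto simp: indicator_def)
  also have "ennreal (d powr (- r / 2)) * \<dots> + ennreal (a powr (- r / 2)) * (\<integral>\<^sup>+s. ennreal (\<bar>s\<bar> powr - r) * indicator {1..} \<bar>s\<bar> \<partial>lborel) < top"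
    unfolding nn_integral_powr_at_infinity[OF r] by (simp add: ennreal_mult_less_top)
  finally show ?thesis
    using nn_integral_lborel_translate[of "\<lambda>s. ennreal ((a * s\<^sup>2 + d) powr (- r / 2))" "- \<tau>"] by simp
qed

section \<open>Global Maxwellians\<close>

text \<open>The essential supremum is at most y exactly when the slice where \<open>g t\<close>
  exceeds y is null, and the measure of a slice depends measurably on t. This makes the norm of the
  attenuation a Borel weight in time.\<close>

lemma borel_measurable_esssup:
  fixes g :: "real \<Rightarrow> 'a::euclidean_space \<Rightarrow> ereal"
  assumes g: "(\<lambda>p. g (fst p) (snd p)) \<in> borel_measurable (borel \<Otimes>\<^sub>M borel)"
  shows "(\<lambda>t. esssup lebesgue (g t)) \<in> borel_measurable borel"
proof (rule borel_measurableI_le)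
  fix y :: ereal
  have [measurable]: "g t \<in> borel_measurable borel" for t
    using measurable_compose[OF _ g, of "\<lambda>x. (t, x)" borel] by simp
  have [measurable]: "{p. y < g (fst p) (snd p)} \<in> sets (borel \<Otimes>\<^sub>M lborel)"
  proof -
    have "Measurable.pred (borel \<Otimes>\<^sub>M lborel) (\<lambda>p. y < g (fst p) (snd p))"
      using g by measurable
    then show ?thesis by (simp add: pred_def space_pair_measure)
  qed
  have "(esssup lebesgue (g t) \<le> y) = ((\<integral>\<^sup>+x. indicator {p. y < g (fst p) (snd p)} (t, x) \<partial>lborel) = 0)" for t
  proof -
    have "(esssup lebesgue (g t) \<le> y) = (AE x in lebesgue. g t x \<le> y)"
    proof
      assume y: "esssup lebesgue (g t) \<le> y"
      show "AE x in lebesgue. g t x \<le> y"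
        using esssup_AE[of "g t" lebesgue] by eventually_elim (rule order_trans[OF _ y])
    next
      assume "AE x in lebesgue. g t x \<le> y"
      then show "esssup lebesgue (g t) \<le> y" by (intro esssup_I measurable_completion) auto
    qed
    also have "\<dots> = (AE x in lborel. g t x \<le> y)" by (rule AE_completion_iff)
    also have "\<dots> = ((\<integral>\<^sup>+x. indicator {p. y < g (fst p) (snd p)} (t, x) \<partial>lborel) = 0)"
      by (subst nn_integral_0_iff_AE) (auto simp: indicator_def not_less)
    finally show ?thesis .
  qed
  then show "{t \<in> space borel. esssup lebesgue (g t) \<le> y} \<in> sets borel"
    by simp
qed

section \<open>The quadratic form of a global Maxwellian\<close>

lemma norm_diff_scaleR_square:
  fixes x y :: "'a::real_inner"
  shows "(norm (x - s *\<^sub>R y))\<^sup>2 = (norm x)\<^sup>2 - 2 * s * (x \<bullet> y) + s\<^sup>2 * (norm y)\<^sup>2"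
  by (simp only: power2_norm_eq_inner inner_diff_left inner_diff_right inner_scaleR_left inner_scaleR_right
      inner_commute[of y x] power2_eq_square[of s]) algebra

locale maxwellian_parameters =
  fixes a b c :: real and B :: "real^'n^'n"
  assumes a: "0 < a" and c: "0 < c" and skew: "transpose B = - B"
    and pos: "y \<noteq> 0 \<Longrightarrow> 0 < y \<bullet> (maxwellian_matrix a b c B *v y)"
begin

lemma skew_inner: "x \<bullet> (B *v y) = - ((B *v x) \<bullet> y)"
proof -
  have "x \<bullet> (B *v y) = (transpose B *v x) \<bullet> y" by (simp add: dot_lmul_matrix)
  moreover have "(- B) *v x = - (B *v x)"
    by (simp add: matrix_vector_mult_def vec_eq_iff sum_negf)
  ultimately show ?thesis by (simp add: skew)
qed

lemma skew_inner_self: "x \<bullet> (B *v x) = 0"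
  using skew_inner[of x x] by (simp add: inner_commute)

lemma maxwellian_matrix_inner:
  "y \<bullet> (maxwellian_matrix a b c B *v y) = (a * c - b\<^sup>2) * (norm y)\<^sup>2 - (norm (B *v y))\<^sup>2"
proof -
  have "maxwellian_matrix a b c B *v y = (a * c - b\<^sup>2) *\<^sub>R y + B *v (B *v y)"
    by (simp add: maxwellian_matrix_def matrix_vector_mult_add_rdistrib scaleR_matrix_vector_assoc[symmetric] matrix_vector_mul_assoc)
  then have "y \<bullet> (maxwellian_matrix a b c B *v y) = (a * c - b\<^sup>2) * (y \<bullet> y) + y \<bullet> (B *v (B *v y))"
    by (simp only: inner_add_right inner_scaleR_right)
  also have "y \<bullet> (B *v (B *v y)) = - ((B *v y) \<bullet> (B *v y))" by (rule skew_inner)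
  finally show ?thesis by (simp only: power2_norm_eq_inner)
qed

text \<open>Evaluate the positive form at a unit vector: the skew part contributes minus a
  square.\<close>

lemma discriminant_pos: "b\<^sup>2 < a * c"
proof -
  have "0 < (a * c - b\<^sup>2) * (norm (axis undefined 1 :: real^'n))\<^sup>2 - (norm (B *v axis undefined 1))\<^sup>2"
    using pos[of "axis undefined 1"] by (simp add: maxwellian_matrix_inner)
  then have "0 < (a * c - b\<^sup>2) - (norm (B *v axis undefined 1))\<^sup>2"
    by (simp add: norm_axis_1)
  then show ?thesis using zero_le_power2[of "norm (B *v axis undefined 1)"] by linarith
qed

text \<open>The minimum over the compact unit sphere is positive, and the form is homogeneous of
  degree two.\<close>

lemma coercive: "\<exists>\<kappa>>0. \<forall>z. \<kappa> * (norm z)\<^sup>2 \<le> (a * c - b\<^sup>2) * (norm z)\<^sup>2 - (norm (B *v z))\<^sup>2"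
proof -
  let ?f = "\<lambda>z. (a * c - b\<^sup>2) * (norm z)\<^sup>2 - (norm (B *v z))\<^sup>2"
  have "axis undefined 1 \<in> sphere (0 :: real^'n) 1" by (simp add: norm_axis_1)
  then have "sphere (0 :: real^'n) 1 \<noteq> {}" by blast
  moreover have "continuous_on (sphere 0 1) ?f"
    by (intro continuous_intros linear_continuous_on matrix_vector_mul_bounded_linear)
  ultimately obtain z0 where z0: "z0 \<in> sphere 0 1" "\<And>z. z \<in> sphere 0 1 \<Longrightarrow> ?f z0 \<le> ?f z"
    using continuous_attains_inf[of "sphere 0 1" ?f] compact_sphere by blast
  have "z0 \<noteq> 0" using z0(1) by auto
  then have "0 < ?f z0" using pos[of z0] by (simp add: maxwellian_matrix_inner)
  moreover have "?f z0 * (norm z)\<^sup>2 \<le> ?f z" for z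
  proof (cases "z = 0")
    case False
    have "?f z0 \<le> ?f (z /\<^sub>R norm z)" using False by (intro z0(2)) simp
    also have "\<dots> = (a * c - b\<^sup>2) - (norm (B *v z) / norm z)\<^sup>2"
      using False by (simp add: matrix_vector_mult_scaleR divide_inverse mult.commute)
    finally show ?thesis using False by (simp add: power_divide field_simps)
  qed (simp add: matrix_vector_mult_0_right)
  ultimately show ?thesis by blast
qed

lemma coercive_form_nonneg: "0 \<le> (a * c - b\<^sup>2) * (norm z)\<^sup>2 - (norm (B *v z))\<^sup>2"
  using coercive by (meson mult_nonneg_nonneg order_trans less_imp_le zero_le_power2)

text \<open>The coefficient of |w|^2 / 2 in the exponent at time t, an inverse temperature. It
  equals a t^2 - 2 b t + c; the completed square shows that it is positive and grows
  quadratically.\<close>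

definition k :: "real \<Rightarrow> real" where
  "k t = a * (t - b / a)\<^sup>2 + (a * c - b\<^sup>2) / a"

text \<open>The coefficient of w in the negative exponent; divided by \<open>k t\<close> it is the
  mean velocity at position x and time t.\<close>

definition drift :: "real^'n \<Rightarrow> real \<Rightarrow> real^'n" where
  "drift x t = (a * t - b) *\<^sub>R x + B *v x"

lemma k_eq: "k t = a * t\<^sup>2 - 2 * b * t + c"
  using a by (simp add: k_def field_simps power2_eq_square)

lemma k_pos: "0 < k t"
  using a discriminant_pos unfolding k_def by (intro add_nonneg_pos) auto

lemma maxwellian_form_expand:
  "maxwellian_form a b c B w x t = k t * (norm w)\<^sup>2 / 2 - w \<bullet> drift x t + a * (norm x)\<^sup>2 / 2"
proof -
  have n: "(norm (x - t *\<^sub>R w))\<^sup>2 = (norm x)\<^sup>2 - 2 * t * (x \<bullet> w) + t\<^sup>2 * (norm w)\<^sup>2"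
    by (rule norm_diff_scaleR_square)
  have i: "(x - t *\<^sub>R w) \<bullet> w = x \<bullet> w - t * (norm w)\<^sup>2"
    by (simp add: inner_diff_left power2_norm_eq_inner)
  have s: "w \<bullet> (B *v (x - t *\<^sub>R w)) = w \<bullet> (B *v x)"
    by (simp add: matrix_vector_mult_diff_distrib matrix_vector_mult_scaleR inner_diff_right skew_inner_self)
  have d: "w \<bullet> drift x t = (a * t - b) * (x \<bullet> w) + w \<bullet> (B *v x)"
    by (simp add: drift_def inner_add_right inner_commute[of w x])
  show ?thesis
    unfolding maxwellian_form_def n i s d k_eq by (simp add: field_simps)
qed

lemma norm_drift: "(norm (drift x t))\<^sup>2 = (a * t - b)\<^sup>2 * (norm x)\<^sup>2 + (norm (B *v x))\<^sup>2"
  by (simp only: drift_def power2_norm_eq_inner inner_add_left inner_add_right inner_scaleR_left inner_scaleR_right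
      skew_inner_self inner_commute[of "B *v x" x] power2_eq_square[of "a * t - b"]) algebra

text \<open>The remainder rests on a k(t) - (a t - b)^2 = a c - b^2. It is the form of the matrix Q
  divided by 2 k(t), and hence nonnegative by positive definiteness.\<close>

lemma maxwellian_form_complete_square:
  "maxwellian_form a b c B w x t = k t * (norm (w - drift x t /\<^sub>R k t))\<^sup>2 / 2
     + ((a * c - b\<^sup>2) * (norm x)\<^sup>2 - (norm (B *v x))\<^sup>2) / (2 * k t)"
proof -
  have k0: "k t \<noteq> 0" using k_pos[of t] by simp
  have "(norm (w - drift x t /\<^sub>R k t))\<^sup>2 = (norm w)\<^sup>2 - 2 * (w \<bullet> drift x t) / k t + (norm (drift x t))\<^sup>2 / (k t)\<^sup>2"
  proof -
    from norm_diff_scaleR_square[of w "inverse (k t)" "drift x t"] show ?thesis by (simp add: divide_inverse power_inverse mult_ac)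
  qed
  then have "k t * (norm (w - drift x t /\<^sub>R k t))\<^sup>2 / 2 = k t * (norm w)\<^sup>2 / 2 - w \<bullet> drift x t + (norm (drift x t))\<^sup>2 / (2 * k t)"
    using k0 by (simp add: field_simps power2_eq_square)
  moreover have "(norm (drift x t))\<^sup>2 + ((a * c - b\<^sup>2) * (norm x)\<^sup>2 - (norm (B *v x))\<^sup>2) = a * (norm x)\<^sup>2 * k t"
    unfolding norm_drift k_eq by (simp add: power2_eq_square algebra_simps)
  then have "a * (norm x)\<^sup>2 / 2 = (norm (drift x t))\<^sup>2 / (2 * k t) + ((a * c - b\<^sup>2) * (norm x)\<^sup>2 - (norm (B *v x))\<^sup>2) / (2 * k t)"
    using k0 by (simp add: field_simps)
  ultimately show ?thesis unfolding maxwellian_form_expand by linarith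
qed

lemma maxwellian_form_lower: "k t * (norm (w - drift x t /\<^sub>R k t))\<^sup>2 / 2 \<le> maxwellian_form a b c B w x t"
  unfolding maxwellian_form_complete_square using coercive_form_nonneg[of x] k_pos[of t] by simp

lemma maxwellian_form_shear: "maxwellian_form a b c B w x t = maxwellian_form a b c B w (x - t *\<^sub>R w) 0"
  by (simp add: maxwellian_form_def)

lemma borel_measurable_maxwellian:
  "(\<lambda>(v, x, t). K * exp (- maxwellian_form a b c B (v - v0) (x - x0) t)) \<in> borel_measurable borel"
proof -
  have "continuous_on UNIV (\<lambda>z. K * exp (- maxwellian_form a b c B (fst z - v0) (fst (snd z) - x0) (snd (snd z))))"
    unfolding maxwellian_form_def
    by (intro continuous_intros bounded_linear.continuous_on[OF matrix_vector_mul_bounded_linear]) auto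
  then show ?thesis
    by (simp add: borel_measurable_continuous_onI split_beta)
qed

text \<open>As a function of velocity the exponent is a combination of 1, w and |w|^2, whose sums
  over the two particles are conserved; the shift by v0 commutes with collisions.\<close>

lemma maxwellian_form_collide:
  assumes "norm \<omega> = 1"
  shows "maxwellian_form a b c B (collide v w \<omega> - v0) x t + maxwellian_form a b c B (collide_star v w \<omega> - v0) x t
    = maxwellian_form a b c B (v - v0) x t + maxwellian_form a b c B (w - v0) x t"
proof -
  define v' where "v' = collide (v - v0) (w - v0) \<omega>"
  define w' where "w' = collide_star (v - v0) (w - v0) \<omega>"
  have e: "collide v w \<omega> - v0 = v'" "collide_star v w \<omega> - v0 = w'"
    by (simp_all add: v'_def w'_def collide_def collide_star_def)
  have s: "v' + w' = (v - v0) + (w - v0)"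
    by (simp add: v'_def w'_def collide_def collide_star_def)
  have "(v', w') \<bullet> (v', w') = (v - v0, w - v0) \<bullet> (v - v0, w - v0)"
    using orthogonal_transformation_collision[OF assms, unfolded orthogonal_transformation_def,
        THEN conjunct2, rule_format, of "(v - v0, w - v0)" "(v - v0, w - v0)"]
    by (simp only: fst_conv snd_conv v'_def w'_def)
  then have n: "(norm v')\<^sup>2 + (norm w')\<^sup>2 = (norm (v - v0))\<^sup>2 + (norm (w - v0))\<^sup>2"
    by (simp add: power2_norm_eq_inner)
  have "maxwellian_form a b c B p x t + maxwellian_form a b c B r x t
      = k t * ((norm p)\<^sup>2 + (norm r)\<^sup>2) / 2 - (p + r) \<bullet> drift x t + a * (norm x)\<^sup>2" for p r
    unfolding maxwellian_form_expand by (simp add: inner_add_left field_simps)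
  then show ?thesis unfolding e by (simp only: s n)
qed

end

section \<open>The attenuation of a Maxwellian\<close>

lemma total_angular_mass_nonneg:
  fixes b :: "real^'n \<Rightarrow> real^'n \<Rightarrow> real"
  assumes sep: "separated_form \<beta> bhat b"
  shows "0 \<le> total_angular_mass bhat TYPE('n)"
proof -
  define n :: "real^'n" where "n = (SOME n. norm n = 1)"
  have n: "norm n = 1"
    unfolding n_def by (rule someI[of "\<lambda>n. norm n = 1" "axis undefined 1"]) (simp add: norm_axis_1)
  have "0 \<le> bhat (\<omega> \<bullet> n)" if "norm \<omega> = 1" for \<omega> :: "real^'n"
  proof -
    have "\<omega> \<bullet> n \<in> {-1..1}" using Cauchy_Schwarz_ineq2[of \<omega> n] n that by (auto simp: abs_le_iff)
    then show ?thesis using sep by (auto simp: separated_form_def)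
  qed
  then show ?thesis
    unfolding total_angular_mass_def angular_mass_def n_def[symmetric]
    by (intro integral_nonneg_AE AE_I2) (auto simp: space_sphere_measure)
qed

text \<open>C stands for the normalising factor. Its positivity is assumed, so that the determinant
  need not be examined; the theorem disposes of the opposite sign separately.\<close>

locale maxwellian = maxwellian_parameters a b c B
  for a b c and B :: "real^'n^'n" +
  fixes C :: real and v0 x0 :: "real^'n" and M :: "real^'n \<Rightarrow> real^'n \<Rightarrow> real \<Rightarrow> real"
  assumes C: "0 < C" and M_eq: "M v x t = C * exp (- maxwellian_form a b c B (v - v0) (x - x0) t)"
begin

lemma M_pos: "0 < M v x t"
  using C by (simp add: M_eq)

lemma M_borel: "(\<lambda>(v, x, t). M v x t) \<in> borel_measurable borel"
  unfolding M_eq by (rule borel_measurable_maxwellian)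

lemma M_measurable[measurable (raw)]:
  assumes [measurable]: "f \<in> borel_measurable N" "g \<in> borel_measurable N" "h \<in> borel_measurable N"
  shows "(\<lambda>y. M (f y) (g y) (h y)) \<in> borel_measurable N"
  using measurable_compose[OF _ M_borel, of "\<lambda>y. (f y, g y, h y)" N] by simp

lemma M_collide:
  assumes "norm \<omega> = 1"
  shows "M (collide v w \<omega>) x t * M (collide_star v w \<omega>) x t = M v x t * M w x t"
proof -
  have "M p x t * M r x t = C * C * exp (- (maxwellian_form a b c B (p - v0) (x - x0) t + maxwellian_form a b c B (r - v0) (x - x0) t))" for p r
    by (simp add: M_eq mult_exp_exp)
  then show ?thesis by (simp only: maxwellian_form_collide[OF assms])
qed

text \<open>Along a characteristic the position relative to the centre of the Maxwellian moves with
  velocity v0: it rests for v0 = 0 and escapes to infinity otherwise.\<close>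

lemma M_shear: "M v (x + t *\<^sub>R v) t = M v (x + t *\<^sub>R v0) 0"
  unfolding M_eq
  by (subst maxwellian_form_shear) (simp add: algebra_simps)

text \<open>Dropping the nonnegative remainder of the completed square leaves a Gaussian in velocity
  around the mean velocity, and the Gaussian bound is uniform in its centre.\<close>

lemma nn_integral_M_powr:
  fixes \<beta> :: real
  assumes "- real CARD('n) < \<beta>" "\<beta> \<le> 0"
  shows "(\<integral>\<^sup>+w. ennreal (M w x t) * ennreal (norm (v - w) powr \<beta>) \<partial>lborel)
    \<le> ennreal (C * ((2 / (\<beta> / CARD('n) + 1) + sqrt (2 * pi)) ^ CARD('n) * k t powr (- (CARD('n) + \<beta>) / 2)))"
proof -
  define u where "u = v0 + drift (x - x0) t /\<^sub>R k t"
  let ?K = "(2 / (\<beta> / CARD('n) + 1) + sqrt (2 * pi)) ^ CARD('n) * k t powr (- (CARD('n) + \<beta>) / 2)"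
  have "ennreal (M w x t) \<le> ennreal C * ennreal (exp (- k t * (norm (w - u))\<^sup>2 / 2))" for w
    using maxwellian_form_lower[of t "w - v0" "x - x0"] C
    by (simp add: M_eq u_def ennreal_mult[symmetric] ennreal_leI algebra_simps)
  then have "(\<integral>\<^sup>+w. ennreal (M w x t) * ennreal (norm (v - w) powr \<beta>) \<partial>lborel)
      \<le> (\<integral>\<^sup>+w. ennreal C * (ennreal (exp (- k t * (norm (w - u))\<^sup>2 / 2)) * ennreal (norm (v - w) powr \<beta>)) \<partial>lborel)"
    unfolding mult.assoc[symmetric] by (intro nn_integral_mono mult_right_mono) auto
  also have "\<dots> = ennreal C * (\<integral>\<^sup>+w. ennreal (exp (- k t * (norm (w - u))\<^sup>2 / 2)) * ennreal (norm (v - w) powr \<beta>) \<partial>lborel)"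
    by (intro nn_integral_cmult) measurable
  also have "\<dots> \<le> ennreal C * ennreal ?K"
    by (intro mult_left_mono nn_integral_gaussian_powr k_pos assms) auto
  finally show ?thesis using C assms by (simp add: ennreal_mult')
qed

text \<open>The Bochner integral in \<open>attenuation\<close> is 0 when it diverges; finiteness
  from the Gaussian bound excludes this.\<close>

lemma ennreal_attenuation:
  fixes ker :: "real^'n \<Rightarrow> real^'n \<Rightarrow> real"
  assumes sep: "separated_form \<beta> bhat ker" and \<beta>: "- real CARD('n) < \<beta>" "\<beta> \<le> 0"
  shows "ennreal (total_angular_mass bhat TYPE('n)) * (\<integral>\<^sup>+w. ennreal (M w x t) * ennreal (norm (v - w) powr \<beta>) \<partial>lborel)
    = ennreal (attenuation \<beta> bhat M v x t)" (is "?T * ?I = _")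
    and "0 \<le> attenuation \<beta> bhat M v x t"
proof -
  have I: "?I = (\<integral>\<^sup>+w. ennreal (M w x t * norm (v - w) powr \<beta>) \<partial>lborel)"
    using M_pos by (simp add: ennreal_mult less_imp_le)
  have "(\<integral>w. M w x t * norm (v - w) powr \<beta> \<partial>lebesgue) = (\<integral>w. M w x t * norm (v - w) powr \<beta> \<partial>lborel)"
    by (rule integral_completion) measurable
  also have "\<dots> = enn2real ?I"
    unfolding I using M_pos by (intro integral_eq_nn_integral) (auto simp: less_imp_le)
  finally have att: "attenuation \<beta> bhat M v x t = total_angular_mass bhat TYPE('n) * enn2real ?I"
    by (simp add: attenuation_def total_angular_mass_def)
  have "?I < top"
    using nn_integral_M_powr[OF \<beta>, of x t v] by (rule le_less_trans) simp
  then show "?T * ?I = ennreal (attenuation \<beta> bhat M v x t)"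
    using total_angular_mass_nonneg[OF sep] by (simp add: att ennreal_mult)
  show "0 \<le> attenuation \<beta> bhat M v x t"
    using total_angular_mass_nonneg[OF sep] by (simp add: att)
qed

text \<open>The weight is at most a constant times k(t)^(-(D + \<beta>)/2), which behaves like
  |t|^-(D + \<beta>) at infinity. Integrability in time is therefore the condition D + \<beta> >
  1.\<close>

lemma dominated_collisions:
  fixes ker :: "real^'n \<Rightarrow> real^'n \<Rightarrow> real"
  assumes sep: "separated_form \<beta> bhat ker" and \<beta>: "1 - real CARD('n) < \<beta>" "\<beta> \<le> 0"
  defines "A \<equiv> \<lambda>t. e2ennreal (Linf_norm (\<lambda>(v, x). attenuation \<beta> bhat M v x t))"
  shows "dominated_collisions \<beta> bhat ker M A"
proof -
  have \<beta>': "- real CARD('n) < \<beta>" using \<beta> by simp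
  note att = ennreal_attenuation[OF sep \<beta>' \<beta>(2)]
  \<comment> \<open>The \<open>ennreal\<close> form is jointly Borel by Tonelli, and measurability
    of the attenuation is read off from it.\<close>
  define G where "G = (\<lambda>v x t. ennreal (total_angular_mass bhat TYPE('n)) * (\<integral>\<^sup>+w. ennreal (M w x t) * ennreal (norm (v - w) powr \<beta>) \<partial>lborel))"
  have G_att: "G v x t = ennreal (attenuation \<beta> bhat M v x t)" for v x t
    unfolding G_def by (rule att(1))
  have att_G: "attenuation \<beta> bhat M v x t = enn2real (G v x t)" for v x t
    unfolding G_att using att(2) by simp
  have G_meas[measurable (raw)]: "(\<lambda>y. G (f y) (g y) (h y)) \<in> borel_measurable N"
    if [measurable]: "f \<in> borel_measurable N" "g \<in> borel_measurable N" "h \<in> borel_measurable N" for f g h and N :: "'z measure"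
    unfolding G_def by measurable
  have G_le_A: "AE z in lebesgue. G (fst z) (snd z) t \<le> A t" for t
    using esssup_AE[of "\<lambda>z. ereal \<bar>(\<lambda>(v, x). attenuation \<beta> bhat M v x t) z\<bar>" lebesgue]
  proof eventually_elim
    case (elim z)
    then have "e2ennreal (ereal \<bar>(\<lambda>(v, x). attenuation \<beta> bhat M v x t) z\<bar>) \<le> A t"
      unfolding A_def Linf_norm_def by (rule e2ennreal_mono)
    then show ?case using att(2) by (simp add: split_beta G_att e2ennreal_ereal)
  qed
  have A_meas[measurable]: "A \<in> borel_measurable borel"
  proof -
    have "(\<lambda>t. esssup lebesgue (\<lambda>z. ereal \<bar>attenuation \<beta> bhat M (fst z) (snd z) t\<bar>)) \<in> borel_measurable borel"
      unfolding att_G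
    proof (rule borel_measurable_esssup)
      have [measurable]: "(\<lambda>p :: real \<times> (real^'n) \<times> (real^'n). fst p) \<in> borel_measurable borel"
        "(\<lambda>p :: real \<times> (real^'n) \<times> (real^'n). fst (snd p)) \<in> borel_measurable borel"
        "(\<lambda>p :: real \<times> (real^'n) \<times> (real^'n). snd (snd p)) \<in> borel_measurable borel"
        by (auto intro!: borel_measurable_continuous_onI continuous_intros)
      show "(\<lambda>p. ereal \<bar>enn2real (G (fst (snd p)) (snd (snd p)) (fst p))\<bar>) \<in> borel_measurable (borel \<Otimes>\<^sub>M borel)"
        unfolding borel_prod by measurable
    qed
    then show ?thesis unfolding A_def Linf_norm_def split_beta by measurable
  qed
  define K where "K = total_angular_mass bhat TYPE('n) * (C * (2 / (\<beta> / CARD('n) + 1) + sqrt (2 * pi)) ^ CARD('n))"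
  have K: "0 \<le> K"
  proof -
    have "- 1 < \<beta> / CARD('n)" using \<beta>' by (simp add: field_simps)
    then have "0 \<le> 2 / (\<beta> / CARD('n) + 1) + sqrt (2 * pi)" by simp
    then show ?thesis using total_angular_mass_nonneg[OF sep] C by (simp add: K_def)
  qed
  have A_le: "A t \<le> ennreal K * ennreal (k t powr (- (CARD('n) + \<beta>) / 2))" for t
  proof -
    have "attenuation \<beta> bhat M v x t \<le> K * k t powr (- (CARD('n) + \<beta>) / 2)" for v x
    proof -
      have "ennreal (attenuation \<beta> bhat M v x t) \<le> ennreal (total_angular_mass bhat TYPE('n)) *
          ennreal (C * ((2 / (\<beta> / CARD('n) + 1) + sqrt (2 * pi)) ^ CARD('n) * k t powr (- (CARD('n) + \<beta>) / 2)))"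
        unfolding att(1)[symmetric] by (intro mult_left_mono nn_integral_M_powr \<beta>' \<beta>(2)) simp
      also have "\<dots> = ennreal (K * k t powr (- (CARD('n) + \<beta>) / 2))"
        using total_angular_mass_nonneg[OF sep] by (simp add: ennreal_mult'[symmetric] K_def mult_ac)
      finally show ?thesis using K by (subst (asm) ennreal_le_iff) auto
    qed
    then have "Linf_norm (\<lambda>(v, x). attenuation \<beta> bhat M v x t) \<le> ereal (K * k t powr (- (CARD('n) + \<beta>) / 2))"
      unfolding Linf_norm_def split_beta
    proof (intro esssup_I measurable_completion)
      have [measurable]: "(\<lambda>p :: (real^'n) \<times> (real^'n). fst p) \<in> borel_measurable borel"
        "(\<lambda>p :: (real^'n) \<times> (real^'n). snd p) \<in> borel_measurable borel"
        by (auto intro!: borel_measurable_continuous_onI continuous_intros)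
      show "(\<lambda>z. ereal \<bar>attenuation \<beta> bhat M (fst z) (snd z) t\<bar>) \<in> borel_measurable lborel"
        unfolding att_G by measurable
    qed (use att(2) in auto)
    then have "A t \<le> e2ennreal (ereal (K * k t powr (- (CARD('n) + \<beta>) / 2)))"
      unfolding A_def by (rule e2ennreal_mono)
    then show ?thesis using K by (simp add: e2ennreal_ereal ennreal_mult)
  qed
  have A_int: "(\<integral>\<^sup>+t. A t \<partial>lborel) < top"
  proof -
    have [measurable]: "k \<in> borel_measurable borel" unfolding k_def by measurable
    have "(\<integral>\<^sup>+t. A t \<partial>lborel) \<le> (\<integral>\<^sup>+t. ennreal K * ennreal (k t powr (- (CARD('n) + \<beta>) / 2)) \<partial>lborel)"
      by (intro nn_integral_mono A_le)
    also have "\<dots> = ennreal K * (\<integral>\<^sup>+t. ennreal (k t powr (- (CARD('n) + \<beta>) / 2)) \<partial>lborel)"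
      by (intro nn_integral_cmult) measurable
    also have "\<dots> < top"
      unfolding k_def using a discriminant_pos \<beta>
      by (intro ennreal_mult_less_top[THEN iffD2] disjI2 conjI nn_integral_quadratic_powr) auto
    finally show ?thesis .
  qed
  \<comment> \<open>At each t the bound holds for almost every (v, x). Joint measurability makes the
    exceptional set measurable, so it is null in space and time together.\<close>
  have "AE p in lborel \<Otimes>\<^sub>M lborel. G (fst (snd p)) (snd (snd p)) (fst p) \<le> A (fst p)"
  proof (rule lborel_pair.AE_pair_measure)
    have [measurable]: "(\<lambda>p :: real \<times> (real^'n) \<times> (real^'n). fst p) \<in> borel_measurable borel"
      "(\<lambda>p :: real \<times> (real^'n) \<times> (real^'n). fst (snd p)) \<in> borel_measurable borel"
      "(\<lambda>p :: real \<times> (real^'n) \<times> (real^'n). snd (snd p)) \<in> borel_measurable borel"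
      by (auto intro!: borel_measurable_continuous_onI continuous_intros)
    show "{p \<in> space (lborel \<Otimes>\<^sub>M lborel). G (fst (snd p)) (snd (snd p)) (fst p) \<le> A (fst p)} \<in> sets (lborel \<Otimes>\<^sub>M lborel)"
      unfolding lborel_prod by measurable
  qed (use G_le_A in \<open>simp add: AE_completion_iff\<close>)
  then have "AE p in lebesgue. G (fst (snd p)) (snd (snd p)) (fst p) \<le> A (fst p)"
    by (simp only: AE_completion_iff lborel_prod)
  then have "AE z in lebesgue. (\<lambda>p. G (fst (snd p)) (snd (snd p)) (fst p) \<le> A (fst p)) ((\<lambda>(v, x, t). (t, v, x)) z)"
    by (rule AE_lebesgue_compose[where k = "\<lambda>(t, v, x). (v, x, t)"])
       (auto simp: split_beta intro!: linear_imp_differentiable_on linearI)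
  then have "AE z in lebesgue. (\<lambda>(v, x, t). G v x t \<le> A t) z"
    by (simp add: split_beta)
  then show ?thesis
    using sep M_borel M_pos M_collide A_meas A_int unfolding G_def by (intro dominated_collisions.intro) auto
qed

end

section \<open>Mass and decay in the past of a Maxwellian\<close>

context maxwellian
begin

lemma form_ge_0:
  obtains \<delta> where "0 < \<delta>"
    "\<And>w x. k 0 * (norm (w - drift x 0 /\<^sub>R k 0))\<^sup>2 / 2 + \<delta> * (norm x)\<^sup>2 / 2 \<le> maxwellian_form a b c B w x 0"
proof -
  obtain \<kappa> where \<kappa>: "0 < \<kappa>" "\<And>z. \<kappa> * (norm z)\<^sup>2 \<le> (a * c - b\<^sup>2) * (norm z)\<^sup>2 - (norm (B *v z))\<^sup>2"
    using coercive by blast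
  show ?thesis
  proof (rule that[of "\<kappa> / k 0"])
    fix w x :: "real^'n"
    have "\<kappa> / k 0 * (norm x)\<^sup>2 / 2 = \<kappa> * (norm x)\<^sup>2 / (2 * k 0)" by simp
    also have "\<dots> \<le> ((a * c - b\<^sup>2) * (norm x)\<^sup>2 - (norm (B *v x))\<^sup>2) / (2 * k 0)"
      using \<kappa>(2)[of x] k_pos[of 0] by (intro divide_right_mono) auto
    finally show "k 0 * (norm (w - drift x 0 /\<^sub>R k 0))\<^sup>2 / 2 + \<kappa> / k 0 * (norm x)\<^sup>2 / 2 \<le> maxwellian_form a b c B w x 0"
      unfolding maxwellian_form_complete_square by simp
  qed (use \<kappa> k_pos in simp)
qed

lemma nn_integral_gaussian_bounded:
  assumes "0 < d"
  obtains K where "\<And>u :: real^'n. (\<integral>\<^sup>+w. ennreal (exp (- d * (norm (w - u))\<^sup>2 / 2)) \<partial>lborel) \<le> ennreal K"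
proof -
  \<comment> \<open>The weighted bound with exponent 0: \<open>norm (0 - w) powr 0\<close> is 1
    except at w = 0, where it is 0.\<close>
  have "(\<integral>\<^sup>+w. ennreal (exp (- d * (norm (w - u))\<^sup>2 / 2)) \<partial>lborel)
      = (\<integral>\<^sup>+w. ennreal (exp (- d * (norm (w - u))\<^sup>2 / 2)) * ennreal (norm (0 - w) powr 0) \<partial>lborel)" for u :: "real^'n"
    using AE_lborel_singleton[of 0] by (intro nn_integral_cong_AE) (auto elim!: eventually_mono)
  then show ?thesis
    using nn_integral_gaussian_powr[OF assms, of 0 _ "0 :: real^'n"] that by auto
qed

text \<open>At fixed v a translation in position removes both t and the centre, so the mass is the
  same at all times. At time 0 the exponent dominates a Gaussian in velocity plus one in
  position.\<close>

lemma mass_bounded: "\<exists>K. \<forall>t. (\<integral>\<^sup>+x. \<integral>\<^sup>+v. ennreal (M v x t) \<partial>lborel \<partial>lborel) \<le> ennreal K"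
proof -
  obtain \<delta> where \<delta>: "0 < \<delta>"
    "\<And>w x. k 0 * (norm (w - drift x 0 /\<^sub>R k 0))\<^sup>2 / 2 + \<delta> * (norm x)\<^sup>2 / 2 \<le> maxwellian_form a b c B w x 0"
    using form_ge_0 by blast
  obtain K1 where K1: "\<And>u :: real^'n. (\<integral>\<^sup>+w. ennreal (exp (- k 0 * (norm (w - u))\<^sup>2 / 2)) \<partial>lborel) \<le> ennreal K1"
    using nn_integral_gaussian_bounded[OF k_pos] by blast
  obtain K2 where K2: "\<And>u :: real^'n. (\<integral>\<^sup>+w. ennreal (exp (- \<delta> * (norm (w - u))\<^sup>2 / 2)) \<partial>lborel) \<le> ennreal K2"
    using nn_integral_gaussian_bounded[OF \<delta>(1)] by blast
  define N where "N = (\<lambda>v x. M (v0 + v) (x0 + x) 0)"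
  have N: "N v x = C * exp (- maxwellian_form a b c B v x 0)" for v x
    by (simp add: N_def M_eq)
  have "(\<integral>\<^sup>+x. \<integral>\<^sup>+v. ennreal (M v x t) \<partial>lborel \<partial>lborel) = (\<integral>\<^sup>+x. \<integral>\<^sup>+v. ennreal (N v x) \<partial>lborel \<partial>lborel)" for t
  proof -
    have "(\<integral>\<^sup>+x. \<integral>\<^sup>+v. ennreal (M v x t) \<partial>lborel \<partial>lborel) = (\<integral>\<^sup>+v. \<integral>\<^sup>+x. ennreal (M v x t) \<partial>lborel \<partial>lborel)"
      by (rule lborel_pair.Fubini') measurable
    also have "\<dots> = (\<integral>\<^sup>+v. \<integral>\<^sup>+x. ennreal (N (- v0 + v) ((- x0 - t *\<^sub>R (v - v0)) + x)) \<partial>lborel \<partial>lborel)"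
    proof (intro nn_integral_cong)
      fix v x
      show "ennreal (M v x t) = ennreal (N (- v0 + v) ((- x0 - t *\<^sub>R (v - v0)) + x))"
        unfolding N M_eq by (subst maxwellian_form_shear) (simp add: algebra_simps)
    qed
    also have "\<dots> = (\<integral>\<^sup>+v. \<integral>\<^sup>+x. ennreal (N (- v0 + v) x) \<partial>lborel \<partial>lborel)"
      by (intro nn_integral_cong nn_integral_lborel_translate) (unfold N_def, measurable)
    also have "\<dots> = (\<integral>\<^sup>+v. \<integral>\<^sup>+x. ennreal (N v x) \<partial>lborel \<partial>lborel)"
      by (rule nn_integral_lborel_translate[of "\<lambda>v. \<integral>\<^sup>+x. ennreal (N v x) \<partial>lborel"]) (unfold N_def, measurable)
    also have "\<dots> = (\<integral>\<^sup>+x. \<integral>\<^sup>+v. ennreal (N v x) \<partial>lborel \<partial>lborel)"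
      by (rule lborel_pair.Fubini') (unfold N_def, measurable)
    finally show ?thesis .
  qed
  moreover have "(\<integral>\<^sup>+x. \<integral>\<^sup>+v. ennreal (N v x) \<partial>lborel \<partial>lborel) \<le> ennreal (C * \<bar>K1\<bar> * \<bar>K2\<bar>)"
  proof -
    have N_le: "ennreal (N v x) \<le> (ennreal C * ennreal (exp (- \<delta> * (norm (x - 0))\<^sup>2 / 2))) * ennreal (exp (- k 0 * (norm (v - drift x 0 /\<^sub>R k 0))\<^sup>2 / 2))" for v x
    proof -
      have "N v x \<le> C * exp (- (k 0 * (norm (v - drift x 0 /\<^sub>R k 0))\<^sup>2 / 2 + \<delta> * (norm x)\<^sup>2 / 2))"
        using \<delta>(2)[of v x] C by (simp add: N)
      also have "\<dots> = C * exp (- \<delta> * (norm (x - 0))\<^sup>2 / 2) * exp (- k 0 * (norm (v - drift x 0 /\<^sub>R k 0))\<^sup>2 / 2)"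
        by (simp add: mult_exp_exp algebra_simps)
      finally show ?thesis
        using C by (simp add: ennreal_mult[symmetric] ennreal_leI)
    qed
    have "(\<integral>\<^sup>+x. \<integral>\<^sup>+v. ennreal (N v x) \<partial>lborel \<partial>lborel)
        \<le> (\<integral>\<^sup>+x. (ennreal C * ennreal (exp (- \<delta> * (norm (x - 0 :: real^'n))\<^sup>2 / 2))) * ennreal K1 \<partial>lborel)"
    proof (rule nn_integral_mono)
      fix x :: "real^'n"
      have "(\<integral>\<^sup>+v. ennreal (N v x) \<partial>lborel)
          \<le> (\<integral>\<^sup>+v. (ennreal C * ennreal (exp (- \<delta> * (norm (x - 0))\<^sup>2 / 2))) * ennreal (exp (- k 0 * (norm (v - drift x 0 /\<^sub>R k 0))\<^sup>2 / 2)) \<partial>lborel)"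
        by (intro nn_integral_mono N_le)
      also have "\<dots> = (ennreal C * ennreal (exp (- \<delta> * (norm (x - 0))\<^sup>2 / 2))) * (\<integral>\<^sup>+v. ennreal (exp (- k 0 * (norm (v - drift x 0 /\<^sub>R k 0))\<^sup>2 / 2)) \<partial>lborel)"
        by (intro nn_integral_cmult) measurable
      also have "\<dots> \<le> (ennreal C * ennreal (exp (- \<delta> * (norm (x - 0))\<^sup>2 / 2))) * ennreal K1"
        by (intro mult_left_mono K1) simp
      finally show "(\<integral>\<^sup>+v. ennreal (N v x) \<partial>lborel) \<le> (ennreal C * ennreal (exp (- \<delta> * (norm (x - 0))\<^sup>2 / 2))) * ennreal K1" .
    qed
    also have "\<dots> = (\<integral>\<^sup>+x. (ennreal C * ennreal K1) * ennreal (exp (- \<delta> * (norm (x - 0 :: real^'n))\<^sup>2 / 2)) \<partial>lborel)"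
      by (simp add: mult_ac)
    also have "\<dots> = (ennreal C * ennreal K1) * (\<integral>\<^sup>+x. ennreal (exp (- \<delta> * (norm (x - 0 :: real^'n))\<^sup>2 / 2)) \<partial>lborel)"
      by (intro nn_integral_cmult) measurable
    also have "\<dots> \<le> (ennreal C * ennreal K1) * ennreal K2"
      by (intro mult_left_mono K2) simp
    also have "\<dots> \<le> ennreal (C * \<bar>K1\<bar> * \<bar>K2\<bar>)"
      using C by (simp add: ennreal_mult) (intro mult_mono ennreal_leI, auto)
    finally show ?thesis .
  qed
  ultimately show ?thesis by auto
qed

text \<open>The relative position y + t v0 leaves every bounded set, and the exponent is coercive in
  position whatever the velocity.\<close>

lemma vanishes_in_past:
  assumes v0: "v0 \<noteq> 0"
  shows "((\<lambda>t. M v (x + t *\<^sub>R v) t) \<longlongrightarrow> 0) at_bot"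
proof -
  obtain \<delta> where \<delta>: "0 < \<delta>"
    "\<And>w x. k 0 * (norm (w - drift x 0 /\<^sub>R k 0))\<^sup>2 / 2 + \<delta> * (norm x)\<^sup>2 / 2 \<le> maxwellian_form a b c B w x 0"
    using form_ge_0 by blast
  define y where "y = x - x0"
  have le: "M v (x + t *\<^sub>R v) t \<le> C * exp (- (\<delta> / 2 * (norm (y + t *\<^sub>R v0))\<^sup>2))" for t
  proof -
    have "0 \<le> k 0 * (norm (v - v0 - drift (y + t *\<^sub>R v0) 0 /\<^sub>R k 0))\<^sup>2 / 2"
      using k_pos[of 0] by simp
    then have "\<delta> / 2 * (norm (y + t *\<^sub>R v0))\<^sup>2 \<le> maxwellian_form a b c B (v - v0) (y + t *\<^sub>R v0) 0"
      using \<delta>(2)[of "v - v0" "y + t *\<^sub>R v0"] by simp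
    moreover have "M v (x + t *\<^sub>R v) t = C * exp (- maxwellian_form a b c B (v - v0) (y + t *\<^sub>R v0) 0)"
      unfolding M_shear unfolding M_eq y_def by (simp add: algebra_simps)
    ultimately show ?thesis using C by simp
  qed
  have lim: "((\<lambda>t. C * exp (- (\<delta> / 2 * (norm (y + t *\<^sub>R v0))\<^sup>2))) \<longlongrightarrow> 0) at_bot"
  proof -
    have "filterlim (\<lambda>t. norm (y + t *\<^sub>R v0)) at_top at_bot"
      unfolding filterlim_at_top
    proof
      fix Z :: real
      show "\<forall>\<^sub>F t in at_bot. Z \<le> norm (y + t *\<^sub>R v0)"
        using eventually_le_at_bot[of "min 0 (- (Z + norm y) / norm v0)"]
      proof eventually_elim
        case (elim t)
        then have "Z + norm y \<le> \<bar>t\<bar> * norm v0" using v0 by (simp add: field_simps)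
        also have "\<dots> = norm (t *\<^sub>R v0)" by simp
        also have "\<dots> \<le> norm (y + t *\<^sub>R v0) + norm y"
          using norm_triangle_ineq4[of "y + t *\<^sub>R v0" y] by simp
        finally show ?case by simp
      qed
    qed
    then have "filterlim (\<lambda>t. \<delta> / 2 * (norm (y + t *\<^sub>R v0))\<^sup>2) at_top at_bot"
      using \<delta>(1) by (intro filterlim_tendsto_pos_mult_at_top[OF tendsto_const] filterlim_pow_at_top) auto
    then have "filterlim (\<lambda>t. - (\<delta> / 2 * (norm (y + t *\<^sub>R v0))\<^sup>2)) at_bot at_bot"
      by (simp add: filterlim_uminus_at_top)
    then have "((\<lambda>t. exp (- (\<delta> / 2 * (norm (y + t *\<^sub>R v0))\<^sup>2))) \<longlongrightarrow> 0) at_bot"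
      by (rule filterlim_compose[OF exp_at_bot])
    then show ?thesis by (rule tendsto_mult_right_zero)
  qed
  show ?thesis
  proof (rule tendsto_sandwich[OF _ _ tendsto_const lim])
    show "\<forall>\<^sub>F t in at_bot. 0 \<le> M v (x + t *\<^sub>R v) t" by (simp add: M_pos less_imp_le)
    show "\<forall>\<^sub>F t in at_bot. M v (x + t *\<^sub>R v) t \<le> C * exp (- (\<delta> / 2 * (norm (y + t *\<^sub>R v0))\<^sup>2))"
      by (intro always_eventually allI le)
  qed
qed

end

section \<open>The stability estimate\<close>

lemma Linf_norm_nonneg: "0 \<le> Linf_norm (f :: 'a::euclidean_space \<Rightarrow> real)"
proof (cases "(\<lambda>z. ereal \<bar>f z\<bar>) \<in> borel_measurable lebesgue")
  case True
  have "0 = esssup lebesgue (\<lambda>z :: 'a. 0 :: ereal)"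
    by (rule esssup_const[symmetric]) (simp add: emeasure_lborel_UNIV)
  also have "\<dots> \<le> Linf_norm f"
    unfolding Linf_norm_def by (rule esssup_mono) auto
  finally show ?thesis .
next
  case False
  \<comment> \<open>The essential supremum of a non-measurable function is top.\<close>
  then show ?thesis by (simp add: Linf_norm_def esssup_non_measurable)
qed

theorem theorem2p3:
  fixes \<beta> :: real
    and bhat :: "real \<Rightarrow> real"
    and b :: "real^'n \<Rightarrow> real^'n \<Rightarrow> real"
    and M F1 F2 :: "real^'n \<Rightarrow> real^'n \<Rightarrow> real \<Rightarrow> real"
  assumes "1 - real CARD('n) < \<beta>" and "\<beta> \<le> 0"
    and "separated_form \<beta> bhat b"
    and "global_maxwellian M"
    and "mild_solution b UNIV F1" and "mild_solution b UNIV F2"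
    and "AE (v, x, t) in lebesgue. \<bar>F1 v x t\<bar> \<le> M v x t"
    and "AE (v, x, t) in lebesgue. \<bar>F2 v x t\<bar> \<le> M v x t"
  shows "maxwellian_norm M (\<lambda>v x t. F1 v x t - F2 v x t)
           \<le> initial_norm M (\<lambda>v x. F1 v x 0 - F2 v x 0) * ereal (exp (4 * mu \<beta> bhat M))"
proof -
  obtain m a b' c x0 v0 B where par: "0 < m" "0 < a" "0 < c" "transpose B = - B"
      "\<forall>y. y \<noteq> 0 \<longrightarrow> 0 < y \<bullet> (maxwellian_matrix a b' c B *v y)"
    and M: "\<forall>v x t. M v x t = m / (2 * pi) ^ CARD('n) * sqrt (det (maxwellian_matrix a b' c B))
                             * exp (- maxwellian_form a b' c B (v - v0) (x - x0) t)"
    using assms(4) unfolding global_maxwellian_def by metis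
  define C where "C = m / (2 * pi) ^ CARD('n) * sqrt (det (maxwellian_matrix a b' c B))"
  have M_eq: "M v x t = C * exp (- maxwellian_form a b' c B (v - v0) (x - x0) t)" for v x t
    using M by (simp add: C_def)
  interpret maxwellian_parameters a b' c B
    using par by unfold_locales auto
  have D: "2 \<le> CARD('n)" using assms(1,2) by simp
  let ?D = "\<lambda>(v, x, t). F1 v x t - F2 v x t"
  have "(\<lambda>(v, x, t). M v x t) \<in> borel_measurable borel"
    unfolding M_eq by (rule borel_measurable_maxwellian)
  then have [measurable]: "(\<lambda>(v, x, t). M v x t) \<in> borel_measurable lebesgue"
    by (intro measurable_completion) simp
  note [measurable] = mild_solutionD(1)[OF assms(5)] mild_solutionD(1)[OF assms(6)]
  have meas: "(\<lambda>z. ereal \<bar>(\<lambda>(v, x, t). (F1 v x t - F2 v x t) / M v x t) z\<bar>) \<in> borel_measurable lebesgue"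
  proof -
    have "(\<lambda>z. ereal \<bar>((\<lambda>(v, x, t). F1 v x t) z - (\<lambda>(v, x, t). F2 v x t) z) / (\<lambda>(v, x, t). M v x t) z\<bar>) \<in> borel_measurable lebesgue"
      by measurable
    then show ?thesis by (simp add: split_beta)
  qed
  let ?R = "initial_norm M (\<lambda>v x. F1 v x 0 - F2 v x 0)"
  have R0: "0 \<le> ?R" unfolding initial_norm_def by (rule Linf_norm_nonneg)
  have zero: ?thesis if "AE (v, x, t) in lebesgue. F1 v x t = 0" "AE (v, x, t) in lebesgue. F2 v x t = 0"
  proof -
    have "AE z in lebesgue. ereal \<bar>(\<lambda>(v, x, t). (F1 v x t - F2 v x t) / M v x t) z\<bar> \<le> 0"
      using that by eventually_elim auto
    then have "maxwellian_norm M (\<lambda>v x t. F1 v x t - F2 v x t) \<le> 0"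
      unfolding maxwellian_norm_def Linf_norm_def by (intro esssup_I meas)
    also have "0 \<le> ?R * ereal (exp (4 * mu \<beta> bhat M))" using R0 by simp
    finally show ?thesis .
  qed
  show ?thesis
  proof (cases "0 < C")
    case False
    \<comment> \<open>A factor that is not positive makes M nonpositive, so the bounds by M force
      both solutions to vanish.\<close>
    then have "M v x t \<le> 0" for v x t by (simp add: M_eq mult_nonpos_nonneg)
    then have z: "r = 0" if "\<bar>r\<bar> \<le> M v x t" for r v x t
      using that by (meson abs_ge_zero abs_le_zero_iff order_trans)
    show ?thesis
    proof (rule zero)
      show "AE (v, x, t) in lebesgue. F1 v x t = 0" using assms(7) by eventually_elim (auto dest: z)
      show "AE (v, x, t) in lebesgue. F2 v x t = 0" using assms(8) by eventually_elim (auto dest: z)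
    qed
  next
    case True
    interpret maxwellian a b' c B C v0 x0 M
      using True M_eq by unfold_locales
    interpret dominated_collisions \<beta> bhat b M "\<lambda>t. e2ennreal (Linf_norm (\<lambda>(v, x). attenuation \<beta> bhat M v x t))"
      by (rule dominated_collisions[OF assms(3,1,2)])
    show ?thesis
    proof (cases "v0 = 0")
      case False
      obtain K where "\<And>t. (\<integral>\<^sup>+x. \<integral>\<^sup>+v. ennreal (M v x t) \<partial>lborel \<partial>lborel) \<le> ennreal K"
        using mass_bounded by blast
      note vanish = mild_solution_vanishes[OF D _ _ this vanishes_in_past[OF False]]
      show ?thesis by (intro zero vanish assms)
    next
      case True
      interpret transported_dominated_collisions \<beta> bhat b M "\<lambda>t. e2ennreal (Linf_norm (\<lambda>(v, x). attenuation \<beta> bhat M v x t))"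
        by unfold_locales (simp add: M_shear True)
      show ?thesis
      proof (cases ?R)
        case (real r)
        have r: "0 \<le> r" using R0 by (simp add: real)
        have "AE z in lebesgue. ereal \<bar>(\<lambda>(v, x). (F1 v x 0 - F2 v x 0) / M v x 0) z\<bar> \<le> ereal r"
          unfolding real[symmetric] initial_norm_def Linf_norm_def by (rule esssup_AE)
        then have "AE (v, x) in lebesgue. \<bar>F1 v x 0 - F2 v x 0\<bar> \<le> r * M v x 0"
          by eventually_elim (auto simp: abs_divide divide_le_eq M_pos abs_of_pos[OF M_pos])
        from mild_difference_bound[OF assms(5,7,6,8) this r]
        have "AE z in lebesgue. ereal \<bar>(\<lambda>(v, x, t). (F1 v x t - F2 v x t) / M v x t) z\<bar> \<le> ereal (r * exp (4 * mu \<beta> bhat M))"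
          unfolding mu_def nn_integral_completion
          by eventually_elim (auto simp: abs_divide divide_le_eq M_pos abs_of_pos[OF M_pos])
        then show ?thesis
          unfolding maxwellian_norm_def Linf_norm_def[of "\<lambda>(v, x, t). _ v x t"] real
          by (simp only: times_ereal.simps(1)) (rule esssup_I[OF meas])
      next
        \<comment> \<open>The exponential is positive, so the right-hand side is infinite.\<close>
        case PInf
        then show ?thesis by simp
      next
        case MInf
        then show ?thesis using R0 by simp
      qed
    qed
  qed
qed

end
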